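(* Let $G$ be a finite $4$-connected graph. If $G$ is $k$-regular and $G\neq K_{k+1}$, then $G$ is $k$-swappable. If $G=K_{k+1}$ and $L$ is a $k$-assignment for $G$ that is not identical everywhere (i.e., $L(u)\ne L(w)$ for some $u,w\in V(G)$), then $G$ is $L$-swappable.
   Context: A list-assignment $L$ assigns to each vertex $v$ a set $L(v)$ of colors; a $k$-assignment has $|L(v)|=k$ for all $v$. An $L$-coloring is a proper coloring $\varphi$ with $\varphi(v)\in L(v)$. An $\alpha,\beta$-Kempe swap at a vertex $u$ with $\varphi(u)\in\{\alpha,\beta\}$ interchanges $\alpha$ and $\beta$ on the component containing $u$ of the subgraph induced by vertices colored $\alpha$ or $\beta$; it is $L$-valid if the result is again an $L$-coloring. Two $L$-colorings are $L$-equivalent if one is obtained from the other by a sequence of $L$-valid Kempe swaps. $G$ is $L$-swappable if it has an $L$-coloring and all its $L$-colorings are pairwise $L$-equivalent; $G$ is $k$-swappable if it is $L$-swappable for every $k$-assignment $L$. *)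

theory Defs
  imports
    "Graph_Theory.Graph_Theory"
    "HOL-Library.FuncSet"
    "HOL-Combinatorics.Transposition"
begin

text \<open>
  A finite simple graph is \<^term>\<open>graph G\<close>, i.e. a finite symmetric digraph without loops and
  parallel arcs; every undirected edge is the pair of its two orientations. Hence the degree
  of a vertex is its out-degree, and components are strongly connected components.
\<close>

definition regular_graph :: "nat \<Rightarrow> ('a, 'b) pre_digraph \<Rightarrow> bool" where
  "regular_graph k G \<longleftrightarrow> (\<forall>v \<in> verts G. out_degree G v = k)"

definition vertex_connected :: "nat \<Rightarrow> ('a, 'b) pre_digraph \<Rightarrow> bool" where
  "vertex_connected k G \<longleftrightarrow>
     k < card (verts G) \<and>
     (\<forall>S \<subseteq> verts G. card S < k \<longrightarrow> Digraph_Component.connected (G \<restriction> (verts G - S)))"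

definition list_assignment :: "('a, 'b) pre_digraph \<Rightarrow> nat \<Rightarrow> ('a \<Rightarrow> 'c set) \<Rightarrow> bool" where
  "list_assignment G k L \<longleftrightarrow> (\<forall>v \<in> verts G. finite (L v) \<and> card (L v) = k)"

text \<open>
  Colorings are extensional functions, so that equality of colorings is equality on the vertices.
\<close>

definition list_colorings :: "('a, 'b) pre_digraph \<Rightarrow> ('a \<Rightarrow> 'c set) \<Rightarrow> ('a \<Rightarrow> 'c) set" where
  "list_colorings G L =
     {\<phi> \<in> Pi\<^sub>E (verts G) L. \<forall>u v. u \<rightarrow>\<^bsub>G\<^esub> v \<longrightarrow> \<phi> u \<noteq> \<phi> v}"

definition kempe_component ::
  "('a, 'b) pre_digraph \<Rightarrow> ('a \<Rightarrow> 'c) \<Rightarrow> 'c \<Rightarrow> 'c \<Rightarrow> 'a \<Rightarrow> 'a set" where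
  "kempe_component G \<phi> \<alpha> \<beta> u =
     pre_digraph.scc_of (G \<restriction> {v \<in> verts G. \<phi> v \<in> {\<alpha>, \<beta>}}) u"

definition kempe_swap ::
  "('a, 'b) pre_digraph \<Rightarrow> 'c \<Rightarrow> 'c \<Rightarrow> 'a \<Rightarrow> ('a \<Rightarrow> 'c) \<Rightarrow> ('a \<Rightarrow> 'c)" where
  "kempe_swap G \<alpha> \<beta> u \<phi> =
     (\<lambda>v. if v \<in> kempe_component G \<phi> \<alpha> \<beta> u then Transposition.transpose \<alpha> \<beta> (\<phi> v) else \<phi> v)"

definition valid_kempe_step ::
  "('a, 'b) pre_digraph \<Rightarrow> ('a \<Rightarrow> 'c set) \<Rightarrow> ('a \<Rightarrow> 'c) \<Rightarrow> ('a \<Rightarrow> 'c) \<Rightarrow> bool" where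
  "valid_kempe_step G L \<phi> \<psi> \<longleftrightarrow>
     \<phi> \<in> list_colorings G L \<and> \<psi> \<in> list_colorings G L \<and>
     (\<exists>\<alpha> \<beta>. \<exists>u \<in> verts G. \<phi> u \<in> {\<alpha>, \<beta>} \<and> \<psi> = kempe_swap G \<alpha> \<beta> u \<phi>)"

definition list_equivalent ::
  "('a, 'b) pre_digraph \<Rightarrow> ('a \<Rightarrow> 'c set) \<Rightarrow> ('a \<Rightarrow> 'c) \<Rightarrow> ('a \<Rightarrow> 'c) \<Rightarrow> bool" where
  "list_equivalent G L = (valid_kempe_step G L)\<^sup>*\<^sup>*"

definition list_swappable :: "('a, 'b) pre_digraph \<Rightarrow> ('a \<Rightarrow> 'c set) \<Rightarrow> bool" where
  "list_swappable G L \<longleftrightarrow>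
     list_colorings G L \<noteq> {} \<and>
     (\<forall>\<phi> \<in> list_colorings G L. \<forall>\<psi> \<in> list_colorings G L. list_equivalent G L \<phi> \<psi>)"

text \<open>
  HOL cannot quantify over types inside a formula, so the type of colors is an explicit parameter;
  a theorem for a type variable \<open>'c\<close> covers lists of colors drawn from any type.
\<close>

definition swappable :: "'c itself \<Rightarrow> ('a, 'b) pre_digraph \<Rightarrow> nat \<Rightarrow> bool" where
  "swappable (_ :: 'c itself) G k \<longleftrightarrow>
     (\<forall>L :: 'a \<Rightarrow> 'c set. list_assignment G k L \<longrightarrow> list_swappable G L)"

end

theory Submission
  imports Defs
begin

text \<open>
  If every vertex of a graph has at least as many colors as neighbors, and every component has a vertex
  with a spare color, then all list colorings are equivalent (Las Vergnas and Meyniel: delete a vertex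
  with a spare color). Hence in a 4-connected \<open>k\<close>-regular graph all \<open>L\<close>-colorings that agree on a set \<open>S\<close>
  of at most three vertices are equivalent as soon as some vertex \<open>w\<close> outside \<open>S\<close> sees in \<open>S\<close> a color not
  in \<open>L(w)\<close> or the same color twice. Moreover, counting colors around any vertex \<open>w\<close> shows that every
  coloring has a neighbor of \<open>w\<close> with a color outside \<open>L(w)\<close>, or two neighbors of \<open>w\<close> of the same color.
  So for a single well-chosen \<open>w\<close> the finitely many classes of colorings arising in this way have to be
  linked to each other by common colorings.

  If the lists differ, \<open>w\<close> is chosen according to how many of its neighbors have another list. If all lists
  are equal, the classes are indexed by the pairs of nonadjacent neighbors of \<open>w\<close>. Without a clique on
  \<open>k - 1\<close> vertices, take \<open>w\<close> in a smallest fragment of the graph: then disjoint pairs are linked, and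
  this links all of them. With a clique \<open>Q\<close> on \<open>k - 1\<close> or \<open>k\<close> vertices, take \<open>w\<close> in \<open>Q\<close> and color first the
  graph without \<open>Q\<close>, all of whose components have spare colors. The case \<open>k = 4\<close>, where \<open>Q\<close> is a triangle,
  needs a closer look at the neighborhoods.
\<close>

section \<open>Kempe swaps on closed sets of vertices\<close>

text \<open>Fixing colors on \<open>S\<close> costs a vertex at most one color per neighbor in
  \<open>S\<close>, so lists stay at least as large as degrees; a vertex that sees in
  \<open>S\<close> a foreign or a repeated color loses less and has a spare color. By 4-connectivity
  \<open>G - S\<close> is connected for \<open>card S \<le> 3\<close>, so one such vertex serves all
  of it, both for extending a coloring from \<open>S\<close> and for connecting the extensions. This
  budget of three fixed vertices shapes everything. A foreign color fixes one vertex and a repeated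
  one fixes two, so only two disjoint pairs exceed the budget. With equal lists all classes come
  from pairs, and four fixed vertices may separate the graph. The ways around are pairs that share a
  vertex, cuts through a smallest fragment, colors that are only reserved for clique vertices
  colored later, swaps along a single edge, and explicit colorings of the few small graphs that
  resist. The complete graph with equal lists is excluded since it has no coloring at all:
  \<open>k\<close> colors do not suffice for \<open>k + 1\<close> vertices.\<close>

definition nb :: "('a \<Rightarrow> 'a \<Rightarrow> bool) \<Rightarrow> 'a set \<Rightarrow> 'a \<Rightarrow> 'a set" where
  "nb E U v = {u \<in> U. E v u}"

text \<open>For a symmetric \<open>E\<close> these are the unions of components of
  \<open>G[U]\<close>. Connectivity, Kempe components and cuts are all expressed by such sets, which
  keeps paths out of the graph-theoretic arguments.\<close>

definition closed_in :: "('a \<Rightarrow> 'a \<Rightarrow> bool) \<Rightarrow> 'a set \<Rightarrow> 'a set \<Rightarrow> bool" where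
  "closed_in E U D \<longleftrightarrow> D \<subseteq> U \<and> (\<forall>u \<in> D. \<forall>v \<in> U. E u v \<longrightarrow> v \<in> D)"

definition proper_on ::
  "('a \<Rightarrow> 'a \<Rightarrow> bool) \<Rightarrow> 'a set \<Rightarrow> ('a \<Rightarrow> 'c set) \<Rightarrow> ('a \<Rightarrow> 'c) \<Rightarrow> bool" where
  "proper_on E U L f \<longleftrightarrow> (\<forall>v \<in> U. f v \<in> L v) \<and> (\<forall>u \<in> U. \<forall>v \<in> U. E u v \<longrightarrow> f u \<noteq> f v)"

text \<open>A step may swap the two colors on any union of Kempe components of \<open>G[U]\<close>. Values outside
  \<open>U\<close> are irrelevant and may change arbitrarily.\<close>

definition kempe_step ::
  "('a \<Rightarrow> 'a \<Rightarrow> bool) \<Rightarrow> 'a set \<Rightarrow> ('a \<Rightarrow> 'c set) \<Rightarrow> ('a \<Rightarrow> 'c) \<Rightarrow> ('a \<Rightarrow> 'c) \<Rightarrow> bool" where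
  "kempe_step E U L f g \<longleftrightarrow> proper_on E U L f \<and> proper_on E U L g \<and>
     (\<exists>\<alpha> \<beta> K. closed_in E {v \<in> U. f v \<in> {\<alpha>, \<beta>}} K \<and>
        (\<forall>u \<in> U. g u = (if u \<in> K then Transposition.transpose \<alpha> \<beta> (f u) else f u)))"

definition kempe_eq ::
  "('a \<Rightarrow> 'a \<Rightarrow> bool) \<Rightarrow> 'a set \<Rightarrow> ('a \<Rightarrow> 'c set) \<Rightarrow> ('a \<Rightarrow> 'c) \<Rightarrow> ('a \<Rightarrow> 'c) \<Rightarrow> bool" where
  "kempe_eq E U L = (kempe_step E U L)\<^sup>*\<^sup>*"

lemma proper_onD: "proper_on E U L f \<Longrightarrow> u \<in> U \<Longrightarrow> v \<in> U \<Longrightarrow> E u v \<Longrightarrow> f u \<noteq> f v"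
  and proper_on_inL: "proper_on E U L f \<Longrightarrow> u \<in> U \<Longrightarrow> f u \<in> L u"
  unfolding proper_on_def by blast+

lemma kempe_stepI:
  assumes "proper_on E U L f" "proper_on E U L g"
    "closed_in E {v \<in> U. f v \<in> {\<alpha>, \<beta>}} K"
    "\<And>u. u \<in> U \<Longrightarrow> g u = (if u \<in> K then Transposition.transpose \<alpha> \<beta> (f u) else f u)"
  shows "kempe_step E U L f g"
  using assms unfolding kempe_step_def by blast

lemma kempe_stepE:
  assumes "kempe_step E U L f g"
  obtains \<alpha> \<beta> K where "proper_on E U L f" "proper_on E U L g"
    "closed_in E {v \<in> U. f v \<in> {\<alpha>, \<beta>}} K"
    "\<And>u. u \<in> U \<Longrightarrow> g u = (if u \<in> K then Transposition.transpose \<alpha> \<beta> (f u) else f u)"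
proof -
  from assms obtain \<alpha> \<beta> K where "proper_on E U L f" "proper_on E U L g"
    "closed_in E {v \<in> U. f v \<in> {\<alpha>, \<beta>}} K"
    "\<forall>u \<in> U. g u = (if u \<in> K then Transposition.transpose \<alpha> \<beta> (f u) else f u)"
    unfolding kempe_step_def by (elim conjE exE)
  then show ?thesis by (intro that) auto
qed

lemma transpose_in_pair: "x \<in> {\<alpha>, \<beta>} \<Longrightarrow> Transposition.transpose \<alpha> \<beta> x \<in> {\<alpha>, \<beta>}"
  by (auto simp: Transposition.transpose_def)

text \<open>The swap maps \<open>{\<alpha>, \<beta>}\<close> to itself, so the vertices with these
  colors are the same before and after, and the same \<open>K\<close> undoes it.\<close>

lemma kempe_step_sym:
  assumes "kempe_step E U L f g"
  shows "kempe_step E U L g f"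
proof -
  obtain \<alpha> \<beta> K where K: "closed_in E {v \<in> U. f v \<in> {\<alpha>, \<beta>}} K"
    and g: "\<And>u. u \<in> U \<Longrightarrow> g u = (if u \<in> K then Transposition.transpose \<alpha> \<beta> (f u) else f u)"
    and p: "proper_on E U L f" "proper_on E U L g"
    using assms by (elim kempe_stepE) (rule that)
  have eq: "{v \<in> U. g v \<in> {\<alpha>, \<beta>}} = {v \<in> U. f v \<in> {\<alpha>, \<beta>}}"
  proof -
    have "g v \<in> {\<alpha>, \<beta>} \<longleftrightarrow> f v \<in> {\<alpha>, \<beta>}" if "v \<in> U" for v
      unfolding g[OF that] by (auto simp: Transposition.transpose_def split: if_splits)
    then show ?thesis by blast
  qed
  show ?thesis
  proof (rule kempe_stepI[OF p(2,1)])
    show "closed_in E {v \<in> U. g v \<in> {\<alpha>, \<beta>}} K" using K eq by simp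
    show "f u = (if u \<in> K then Transposition.transpose \<alpha> \<beta> (g u) else g u)" if "u \<in> U" for u
      using g[OF that] by auto
  qed
qed

lemma kempe_eq_sym: "kempe_eq E U L f g \<Longrightarrow> kempe_eq E U L g f"
  unfolding kempe_eq_def
proof (induction rule: rtranclp_induct)
  case (step y z)
  then show ?case using kempe_step_sym by (metis converse_rtranclp_into_rtranclp)
qed simp

lemma kempe_eq_trans: "kempe_eq E U L f g \<Longrightarrow> kempe_eq E U L g h \<Longrightarrow> kempe_eq E U L f h"
  unfolding kempe_eq_def by simp

text \<open>Functions that agree on \<open>U\<close> may differ elsewhere; a step with empty
  \<open>K\<close> passes between them.\<close>

lemma kempe_eq_cong:
  assumes "proper_on E U L f" "\<And>u. u \<in> U \<Longrightarrow> f u = g u"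
  shows "kempe_eq E U L f g"
proof -
  have "proper_on E U L g" using assms unfolding proper_on_def by metis
  then have "kempe_step E U L f g"
    using assms by (intro kempe_stepI[where K = "{}"]) (auto simp: closed_in_def)
  then show ?thesis unfolding kempe_eq_def by blast
qed

section \<open>Recoloring a vertex and lifting swaps over it\<close>

lemma proper_on_upd:
  assumes h: "proper_on E (U - {v}) L h" and c: "c \<in> L v"
    and n: "\<And>u. u \<in> U \<Longrightarrow> u \<noteq> v \<Longrightarrow> E v u \<Longrightarrow> h u \<noteq> c"
    and sym: "\<And>x y. E x y \<Longrightarrow> E y x" and irr: "\<And>x. \<not> E x x"
  shows "proper_on E U L (h(v := c))"
  unfolding proper_on_def
proof (intro conjI ballI impI)
  fix u assume "u \<in> U" then show "(h(v := c)) u \<in> L u"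
    using h c unfolding proper_on_def by auto
next
  fix x y assume xy: "x \<in> U" "y \<in> U" "E x y"
  show "(h(v := c)) x \<noteq> (h(v := c)) y"
  proof (cases "x = v \<or> y = v")
    case True
    then show ?thesis using xy n[of x] n[of y] sym[OF xy(3)] irr by (auto split: if_splits)
  next
    case False then show ?thesis using h xy unfolding proper_on_def by auto
  qed
qed

text \<open>No neighbor has the old color of \<open>v\<close> and none has \<open>\<gamma>\<close>,
  so \<open>{v}\<close> is a whole component for these two colors and the recoloring is a
  swap.\<close>

lemma recolor_vertex:
  assumes "proper_on E U L f" "v \<in> U" "\<gamma> \<in> L v" "\<And>u. u \<in> U \<Longrightarrow> E v u \<Longrightarrow> f u \<noteq> \<gamma>"
    and sym: "\<And>x y. E x y \<Longrightarrow> E y x" and irr: "\<And>x. \<not> E x x"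
  shows "proper_on E U L (f(v := \<gamma>)) \<and> kempe_step E U L f (f(v := \<gamma>))"
proof -
  have "proper_on E (U - {v}) L f" using assms(1) unfolding proper_on_def by auto
  then have p: "proper_on E U L (f(v := \<gamma>))"
    using assms(3,4) sym irr by (intro proper_on_upd) auto
  have "kempe_step E U L f (f(v := \<gamma>))"
  proof (rule kempe_stepI[where \<alpha> = "f v" and \<beta> = \<gamma> and K = "{v}", OF assms(1) p])
    show "closed_in E {w \<in> U. f w \<in> {f v, \<gamma>}} {v}"
      using assms unfolding closed_in_def proper_on_def by auto
  qed auto
  with p show ?thesis by blast
qed

text \<open>A swap of \<open>G - v\<close> works verbatim in \<open>G\<close> unless
  \<open>v\<close> has one of the two colors and a neighbor in \<open>K\<close>. In that case either
  \<open>v\<close> can be swapped along with \<open>K\<close>, or its spare color yields a free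
  color outside \<open>{\<alpha>, \<beta>}\<close>, to which \<open>v\<close> is moved
  beforehand.\<close>

lemma kempe_step_extend_vertex:
  assumes sym: "\<And>x y. E x y \<Longrightarrow> E y x" and irr: "\<And>x. \<not> E x x"
    and finU: "finite U" and vU: "v \<in> U"
    and fin: "finite (L v)" and sur: "card (nb E U v) < card (L v)"
    and f: "proper_on E U L f" and st: "kempe_step E (U - {v}) L f h"
  shows "\<exists>g. proper_on E U L g \<and> (\<forall>u \<in> U - {v}. g u = h u) \<and> kempe_eq E U L f g"
proof -
  obtain \<alpha> \<beta> K where K: "closed_in E {u \<in> U - {v}. f u \<in> {\<alpha>, \<beta>}} K"
    and h: "\<And>u. u \<in> U - {v} \<Longrightarrow> h u = (if u \<in> K then Transposition.transpose \<alpha> \<beta> (f u) else f u)"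
    and ph: "proper_on E (U - {v}) L h"
    using st by (elim kempe_stepE) (rule that)
  have KU: "K \<subseteq> U - {v}" and Kc: "\<And>u. u \<in> K \<Longrightarrow> f u \<in> {\<alpha>, \<beta>}"
    and Kcl: "\<And>u w. u \<in> K \<Longrightarrow> w \<in> U - {v} \<Longrightarrow> E u w \<Longrightarrow> f w \<in> {\<alpha>, \<beta>} \<Longrightarrow> w \<in> K"
    using K unfolding closed_in_def by auto
  \<comment> \<open>Stated for an arbitrary \<open>f'\<close> that agrees with \<open>f\<close> off
    \<open>v\<close>, because it is used both for \<open>f\<close> and for \<open>f\<close> after
    \<open>v\<close> has been moved.\<close>
  have away: "\<exists>g. proper_on E U L g \<and> (\<forall>u \<in> U - {v}. g u = h u) \<and> kempe_eq E U L f' g"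
    if f': "proper_on E U L f'" and same: "\<And>u. u \<in> U - {v} \<Longrightarrow> f' u = f u"
      and aw: "f' v \<in> {\<alpha>, \<beta>} \<Longrightarrow> \<forall>u \<in> K. \<not> E v u" for f'
  proof -
    define g where "g = h(v := f' v)"
    have vK: "f' v \<noteq> h u" if "u \<in> U - {v}" "E v u" for u
    proof (cases "u \<in> K")
      case True
      then have "f' v \<notin> {\<alpha>, \<beta>}" using aw that by blast
      moreover have "h u \<in> {\<alpha>, \<beta>}" using True h[OF that(1)] Kc transpose_in_pair by fastforce
      ultimately show ?thesis by auto
    next
      case False
      have "f' v \<noteq> f' u" using f' that vU unfolding proper_on_def by blast
      then show ?thesis using h[OF that(1)] same[OF that(1)] False by simp
    qed
    have pg: "proper_on E U L g"
      unfolding g_def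
    proof (rule proper_on_upd[OF ph _ _ sym irr])
      show "f' v \<in> L v" using f' vU unfolding proper_on_def by auto
      show "h u \<noteq> f' v" if "u \<in> U" "u \<noteq> v" "E v u" for u using vK[of u] that by auto
    qed
    have "kempe_step E U L f' g"
    proof (rule kempe_stepI[where \<alpha> = \<alpha> and \<beta> = \<beta> and K = K, OF f' pg])
      show "closed_in E {u \<in> U. f' u \<in> {\<alpha>, \<beta>}} K"
        unfolding closed_in_def
      proof (intro conjI ballI impI subsetI)
        fix u assume "u \<in> K" then show "u \<in> {u \<in> U. f' u \<in> {\<alpha>, \<beta>}}"
          using KU Kc[of u] same[of u] by auto
      next
        fix u w assume u: "u \<in> K" and w: "w \<in> {u \<in> U. f' u \<in> {\<alpha>, \<beta>}}" and e: "E u w"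
        show "w \<in> K"
        proof (cases "w = v")
          case True then show ?thesis using aw u w e sym by blast
        next
          case False then show ?thesis using Kcl[OF u _ e] w same[of w] by auto
        qed
      qed
      show "g u = (if u \<in> K then Transposition.transpose \<alpha> \<beta> (f' u) else f' u)" if "u \<in> U" for u
        using that KU h same unfolding g_def by auto
    qed
    then show ?thesis using pg unfolding kempe_eq_def g_def by (intro exI[of _ g]) (auto simp: g_def)
  qed
  show ?thesis
  proof (cases "f v \<in> {\<alpha>, \<beta>} \<and> (\<exists>u \<in> K. E v u)")
    case False
    then show ?thesis using away[OF f] by blast
  next
    case True
    then obtain u where u: "u \<in> K" "E v u" by blast
    define \<gamma> where "\<gamma> = Transposition.transpose \<alpha> \<beta> (f v)"
    have pair: "{\<alpha>, \<beta>} = {f v, \<gamma>}" using True unfolding \<gamma>_def by (auto simp: Transposition.transpose_def)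
    have uU: "u \<in> U - {v}" using u KU by blast
    have col: "f w = \<gamma>" if "w \<in> U" "E v w" "f w \<in> {\<alpha>, \<beta>}" for w
    proof -
      have "f v \<noteq> f w" using that f vU unfolding proper_on_def by blast
      then show ?thesis using that(3) pair by auto
    qed
    have fu: "f u = \<gamma>" using col[OF _ u(2) Kc[OF u(1)]] uU by blast
    show ?thesis
    proof (cases "\<gamma> \<in> L v \<and> (\<forall>w \<in> nb E U v. f w = \<gamma> \<longrightarrow> w \<in> K)")
      case good: True
      define g where "g = h(v := \<gamma>)"
      have vK: "\<gamma> \<noteq> h w" if w: "w \<in> U - {v}" "E v w" for w
      proof (cases "w \<in> K")
        case True
        then have "f w = \<gamma>" using col w Kc by blast
        then have "h w = f v" using h[OF w(1)] True \<gamma>_def by simp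
        moreover have "f v \<noteq> \<gamma>" using proper_onD[OF f vU _ u(2)] uU fu by auto
        ultimately show ?thesis by simp
      next
        case False
        then have "f w \<noteq> \<gamma>" using good w unfolding nb_def by auto
        then show ?thesis using h[OF w(1)] False by simp
      qed
      have pg: "proper_on E U L g"
        unfolding g_def
      proof (rule proper_on_upd[OF ph _ _ sym irr])
        show "\<gamma> \<in> L v" using good by blast
        show "h u \<noteq> \<gamma>" if "u \<in> U" "u \<noteq> v" "E v u" for u using vK[of u] that by auto
      qed
      have "kempe_step E U L f g"
      proof (rule kempe_stepI[where \<alpha> = \<alpha> and \<beta> = \<beta> and K = "insert v K", OF f pg])
        show "closed_in E {u \<in> U. f u \<in> {\<alpha>, \<beta>}} (insert v K)"
          unfolding closed_in_def
        proof (intro conjI ballI impI subsetI)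
          fix u assume "u \<in> insert v K" then show "u \<in> {u \<in> U. f u \<in> {\<alpha>, \<beta>}}"
            using KU Kc vU True by blast
        next
          fix x w assume x: "x \<in> insert v K" and w: "w \<in> {u \<in> U. f u \<in> {\<alpha>, \<beta>}}" and e: "E x w"
          show "w \<in> insert v K"
          proof (cases "x = v \<or> w = v")
            case True then show ?thesis using x w e col good unfolding nb_def by auto
          next
            case False then show ?thesis using Kcl[of x w] x w e by auto
          qed
        qed
        show "g u = (if u \<in> insert v K then Transposition.transpose \<alpha> \<beta> (f u) else f u)"
          if "u \<in> U" for u
          using that KU h unfolding g_def \<gamma>_def by auto
      qed
      then show ?thesis using pg unfolding kempe_eq_def by (intro exI[of _ g]) (auto simp: g_def)
    next
      case bad: False
      text \<open>Two neighbors share a color or a color of a neighbor is not available, so \<open>v\<close> has a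
        second free color and can be moved out of the way.\<close>
      have uN: "u \<in> nb E U v" using uU u unfolding nb_def by auto
      have finN: "finite (nb E U v)" using finU unfolding nb_def by auto
      have "L v \<inter> f ` nb E U v \<subseteq> f ` (nb E U v - {u})"
      proof (cases "\<gamma> \<in> L v")
        case True
        then obtain w where "w \<in> nb E U v" "f w = \<gamma>" "w \<notin> K" using bad by blast
        then show ?thesis using u fu by auto
      next
        case False then show ?thesis using fu by auto
      qed
      then have "card (L v \<inter> f ` nb E U v) \<le> card (nb E U v - {u})"
        by (meson card_image_le card_mono finN finite_Diff finite_imageI order_trans)
      also have "\<dots> < card (nb E U v)" using uN finN by (meson card_Diff1_less)
      finally have c1: "card (L v \<inter> f ` nb E U v) + 2 \<le> card (L v)" using sur by linarith
      have "card (L v - f ` nb E U v) + card (L v \<inter> f ` nb E U v) = card (L v)"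
        using fin card_Diff_subset_Int[of "L v" "f ` nb E U v"] card_mono[OF fin, of "L v \<inter> f ` nb E U v"]
        by auto
      then have "card (L v - f ` nb E U v) \<ge> 2" using c1 by linarith
      then have "\<not> L v - f ` nb E U v \<subseteq> {f v}"
        using card_mono[of "{f v}" "L v - f ` nb E U v"] by fastforce
      then obtain \<delta> where d: "\<delta> \<in> L v" "\<delta> \<notin> f ` nb E U v" "\<delta> \<noteq> f v" by blast
      then have dg: "\<delta> \<noteq> \<gamma>" using uN fu by auto
      let ?f = "f(v := \<delta>)"
      have re: "proper_on E U L ?f" "kempe_step E U L f ?f"
        using recolor_vertex[OF f vU d(1) _ sym irr] d(2) unfolding nb_def by auto
      have "\<exists>g. proper_on E U L g \<and> (\<forall>u \<in> U - {v}. g u = h u) \<and> kempe_eq E U L ?f g"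
        using away[OF re(1)] d(3) dg pair by auto
      then show ?thesis using re(2) unfolding kempe_eq_def by (meson converse_rtranclp_into_rtranclp)
    qed
  qed
qed

text \<open>Nonempty closed sets are unions of components, so the last clause gives every component of
  \<open>G[U]\<close> a vertex with a spare color.\<close>

definition slack_on :: "('a \<Rightarrow> 'a \<Rightarrow> bool) \<Rightarrow> 'a set \<Rightarrow> ('a \<Rightarrow> 'c set) \<Rightarrow> bool" where
  "slack_on E U L \<longleftrightarrow> finite U \<and> (\<forall>v \<in> U. finite (L v) \<and> card (nb E U v) \<le> card (L v)) \<and>
     (\<forall>D. D \<noteq> {} \<and> closed_in E U D \<longrightarrow> (\<exists>v \<in> D. card (nb E U v) < card (L v)))"

text \<open>Every neighbor of the removed vertex gains slack. A closed set of \<open>G - v\<close>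
  contains such a neighbor or is closed already in \<open>G\<close>.\<close>

lemma slack_on_remove:
  assumes sym: "\<And>x y. E x y \<Longrightarrow> E y x"
    and s: "slack_on E U L" and v: "v \<in> U"
  shows "slack_on E (U - {v}) L"
proof -
  have fin: "finite U" using s unfolding slack_on_def by blast
  have sub: "nb E (U - {v}) u \<subseteq> nb E U u" for u unfolding nb_def by auto
  have finn: "finite (nb E U u)" for u using fin unfolding nb_def by auto
  have le: "card (nb E (U - {v}) u) \<le> card (nb E U u)" for u using card_mono[OF finn sub] .
  have less: "card (nb E (U - {v}) u) < card (nb E U u)" if "E u v" for u
    using that v by (intro psubset_card_mono[OF finn]) (auto simp: nb_def)
  have "\<exists>u \<in> D. card (nb E (U - {v}) u) < card (L u)" if D: "D \<noteq> {}" "closed_in E (U - {v}) D" for D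
  proof (cases "\<exists>u \<in> D. E u v")
    case True
    then obtain u where u: "u \<in> D" "E u v" by blast
    then have "u \<in> U" using D unfolding closed_in_def by auto
    then have "card (nb E U u) \<le> card (L u)" using s unfolding slack_on_def by blast
    then show ?thesis using less[OF u(2)] u(1) by (meson order_less_le_trans)
  next
    case False
    then have "closed_in E U D" using D unfolding closed_in_def by blast
    then obtain u where "u \<in> D" "card (nb E U u) < card (L u)" using s D unfolding slack_on_def by blast
    then show ?thesis using le order_le_less_trans by blast
  qed
  moreover have "finite (L u) \<and> card (nb E (U - {v}) u) \<le> card (L u)" if "u \<in> U - {v}" for u
    using that s le[of u] unfolding slack_on_def by fastforce
  ultimately show ?thesis using fin unfolding slack_on_def by blast
qed

text \<open>Induction on the number of vertices, deleting a vertex \<open>v\<close> with a spare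
  color: its slack extends colorings and lifts swaps from \<open>G - v\<close>, and the deletion
  hands slack on to its neighbors.\<close>

lemma slack_on_colorable_and_connected:
  assumes sym: "\<And>x y. E x y \<Longrightarrow> E y x" and irr: "\<And>x. \<not> E x x"
    and "slack_on E U L"
  shows "(\<exists>f. proper_on E U L f) \<and>
    (\<forall>f g. proper_on E U L f \<longrightarrow> proper_on E U L g \<longrightarrow> kempe_eq E U L f g)"
  using assms(3)
proof (induction "card U" arbitrary: U)
  case 0
  then have "U = {}" unfolding slack_on_def by auto
  then show ?case using kempe_eq_cong[of E "{}"] by (auto simp: proper_on_def)
next
  case (Suc n)
  have fin: "finite U" using Suc.prems unfolding slack_on_def by blast
  have "U \<noteq> {}" using Suc by auto
  moreover have "closed_in E U U" unfolding closed_in_def by blast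
  ultimately obtain v where v: "v \<in> U" "card (nb E U v) < card (L v)"
    using Suc.prems unfolding slack_on_def by blast
  have finL: "finite (L v)" using v Suc.prems unfolding slack_on_def by blast
  have finN: "finite (nb E U v)" using fin unfolding nb_def by auto
  have IH: "\<exists>f. proper_on E (U - {v}) L f"
    "\<And>f g. proper_on E (U - {v}) L f \<Longrightarrow> proper_on E (U - {v}) L g \<Longrightarrow> kempe_eq E (U - {v}) L f g"
    using Suc.hyps(1)[of "U - {v}"] Suc.hyps(2) slack_on_remove[OF sym Suc.prems v(1)] v fin by auto
  show ?case
  proof (intro conjI allI impI)
    obtain f where f: "proper_on E (U - {v}) L f" using IH by blast
    have "\<not> L v \<subseteq> f ` nb E U v"
      using card_mono[of "f ` nb E U v" "L v"] card_image_le[OF finN, of f] finN v(2) by fastforce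
    then obtain c where c: "c \<in> L v" "c \<notin> f ` nb E U v" by blast
    have "proper_on E U L (f(v := c))"
      using c by (intro proper_on_upd[OF f _ _ sym irr]) (auto simp: nb_def)
    then show "\<exists>f. proper_on E U L f" by blast
  next
    fix f g assume f: "proper_on E U L f" and g: "proper_on E U L g"
    have r: "proper_on E (U - {v}) L x" if "proper_on E U L x" for x
      using that unfolding proper_on_def by auto
    \<comment> \<open>The color of \<open>v\<close> is not controlled along the lifted sequence; it
      is corrected by one recoloring at the end.\<close>
    have "\<exists>h. proper_on E U L h \<and> (\<forall>u \<in> U - {v}. h u = g' u) \<and> kempe_eq E U L f h"
      if "kempe_eq E (U - {v}) L f g'" for g'
      using that unfolding kempe_eq_def
    proof (induction rule: rtranclp_induct)
      case base then show ?case using f by blast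
    next
      case (step y z)
      then obtain h where h: "proper_on E U L h" "\<forall>u \<in> U - {v}. h u = y u"
        "kempe_eq E U L f h" unfolding kempe_eq_def by blast
      have "kempe_step E (U - {v}) L h z"
      proof -
        obtain \<alpha> \<beta> K where K: "closed_in E {v' \<in> U - {v}. y v' \<in> {\<alpha>, \<beta>}} K"
          and zz: "\<And>u. u \<in> U - {v} \<Longrightarrow> z u = (if u \<in> K then Transposition.transpose \<alpha> \<beta> (y u) else y u)"
          and p: "proper_on E (U - {v}) L z"
          using step(2) by (elim kempe_stepE) (rule that)
        have "{v' \<in> U - {v}. y v' \<in> {\<alpha>, \<beta>}} = {v' \<in> U - {v}. h v' \<in> {\<alpha>, \<beta>}}" using h(2) by auto
        then show ?thesis using K zz p h(2) r[OF h(1)] by (intro kempe_stepI[where \<alpha> = \<alpha> and \<beta> = \<beta> and K = K]) auto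
      qed
      from kempe_step_extend_vertex[OF sym irr fin v(1) finL v(2) h(1) this] h(3)
      show ?case unfolding kempe_eq_def by (meson rtranclp_trans)
    qed
    then obtain h where h: "proper_on E U L h" "\<forall>u \<in> U - {v}. h u = g u" "kempe_eq E U L f h"
      using IH(2)[OF r[OF f] r[OF g]] by blast
    have "g v \<in> L v" using g v unfolding proper_on_def by blast
    moreover have "h u \<noteq> g v" if "u \<in> U" "E v u" for u
    proof -
      have "u \<noteq> v" using that irr by auto
      then have "h u = g u" using h(2) that by auto
      then show ?thesis using g v that unfolding proper_on_def by metis
    qed
    ultimately have "kempe_step E U L h (h(v := g v))"
      using recolor_vertex[OF h(1) v(1) _ _ sym irr] by blast
    then have "kempe_eq E U L f (h(v := g v))" using h(3) unfolding kempe_eq_def by auto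
    moreover have "kempe_eq E U L (h(v := g v)) g"
      using h(2) by (intro kempe_eq_sym[OF kempe_eq_cong[OF g]]) auto
    ultimately show "kempe_eq E U L f g" using kempe_eq_trans by blast
  qed
qed

text \<open>The reduced lists omit the colors of fixed neighbors. A vertex of \<open>K\<close> has
  one of the colors \<open>\<alpha>\<close>, \<open>\<beta>\<close> before the swap and the other
  one after it, both from its reduced list, so no fixed neighbor has either color and
  \<open>K\<close> stays closed in the whole graph.\<close>

lemma kempe_eq_lift:
  assumes sym: "\<And>x y. E x y \<Longrightarrow> E y x"
    and UV: "U \<subseteq> V" and f: "proper_on E V L f" and g: "proper_on E V L g"
    and agree: "\<And>v. v \<in> V - U \<Longrightarrow> f v = g v"
    and eq: "kempe_eq E U (\<lambda>v. L v - f ` nb E (V - U) v) f g"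
  shows "kempe_eq E V L f g"
proof -
  let ?L = "\<lambda>v. L v - f ` nb E (V - U) v"
  define ext where "ext h = (\<lambda>v. if v \<in> U then h v else f v)" for h
  have pe: "proper_on E V L (ext h)" if "proper_on E U ?L h" for h
    unfolding proper_on_def
  proof (intro conjI ballI impI)
    fix v assume "v \<in> V" then show "ext h v \<in> L v"
      using that f unfolding proper_on_def ext_def by auto
  next
    fix x y assume xy: "x \<in> V" "y \<in> V" "E x y"
    consider "x \<in> U" "y \<in> U" | "x \<notin> U" "y \<notin> U" | "x \<in> U" "y \<notin> U" | "x \<notin> U" "y \<in> U" by blast
    then show "ext h x \<noteq> ext h y"
    proof cases
      case 1 then show ?thesis using that xy unfolding proper_on_def ext_def by auto
    next
      case 2 then show ?thesis using f xy unfolding proper_on_def ext_def by auto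
    next
      case 3
      then have "h x \<in> L x - f ` nb E (V - U) x" using that unfolding proper_on_def by auto
      moreover have "y \<in> nb E (V - U) x" using xy 3 unfolding nb_def by auto
      ultimately show ?thesis using 3 unfolding ext_def by (auto simp: image_iff)
    next
      case 4
      then have "h y \<in> L y - f ` nb E (V - U) y" using that unfolding proper_on_def by auto
      moreover have "x \<in> nb E (V - U) y" using xy sym 4 unfolding nb_def by auto
      ultimately show ?thesis using 4 unfolding ext_def by (auto simp: image_iff)
    qed
  qed
  have "kempe_eq E V L f (ext h)" if "kempe_eq E U ?L f h" for h
    using that unfolding kempe_eq_def
  proof (induction rule: rtranclp_induct)
    case base
    then show ?case using kempe_eq_cong[OF f, of "ext f"] unfolding kempe_eq_def ext_def by auto
  next
    case (step y z)
    from step(2) obtain \<alpha> \<beta> K where K: "closed_in E {v \<in> U. y v \<in> {\<alpha>, \<beta>}} K"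
      and z: "\<And>u. u \<in> U \<Longrightarrow> z u = (if u \<in> K then Transposition.transpose \<alpha> \<beta> (y u) else y u)"
      and p: "proper_on E U ?L y" "proper_on E U ?L z"
      by (elim kempe_stepE) (rule that)
    have "kempe_step E V L (ext y) (ext z)"
    proof (rule kempe_stepI[where \<alpha> = \<alpha> and \<beta> = \<beta> and K = K, OF pe[OF p(1)] pe[OF p(2)]])
      show "closed_in E {v \<in> V. ext y v \<in> {\<alpha>, \<beta>}} K"
        unfolding closed_in_def
      proof (intro conjI subsetI ballI impI)
        fix u assume "u \<in> K" then show "u \<in> {v \<in> V. ext y v \<in> {\<alpha>, \<beta>}}"
          using K UV unfolding closed_in_def ext_def by auto
      next
        fix u w assume u: "u \<in> K" and w: "w \<in> {v \<in> V. ext y v \<in> {\<alpha>, \<beta>}}" and e: "E u w"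
        have uU: "u \<in> U" "y u \<in> {\<alpha>, \<beta>}" using u K unfolding closed_in_def by auto
        show "w \<in> K"
        proof (cases "w \<in> U")
          case True then show ?thesis using K u w e unfolding closed_in_def ext_def by auto
        next
          case False
          then have "f w \<in> f ` nb E (V - U) u" using w e unfolding nb_def by auto
          then have "y u \<noteq> f w" "z u \<noteq> f w" using p uU unfolding proper_on_def by auto
          moreover have "z u = Transposition.transpose \<alpha> \<beta> (y u)" using z[OF uU(1)] u by simp
          moreover have "f w \<in> {\<alpha>, \<beta>}" using w False unfolding ext_def by auto
          ultimately show ?thesis using uU(2) by (auto simp: Transposition.transpose_def split: if_splits)
        qed
      qed
      show "ext z u = (if u \<in> K then Transposition.transpose \<alpha> \<beta> (ext y u) else ext y u)" if "u \<in> V" for u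
        using z K unfolding ext_def closed_in_def by auto
    qed
    then show ?case using step by auto
  qed
  from this[OF eq] have "kempe_eq E V L f (ext g)" .
  moreover have "ext g v = g v" if "v \<in> V" for v using agree that unfolding ext_def by auto
  ultimately show ?thesis using kempe_eq_cong[of E V L g "ext g"] g kempe_eq_sym kempe_eq_trans by metis
qed

section \<open>Lists that are not all equal\<close>

locale sgraph =
  fixes V :: "'a set" and E :: "'a \<Rightarrow> 'a \<Rightarrow> bool"
  assumes finV: "finite V"
    and E_sym: "E u v \<Longrightarrow> E v u"
    and E_irr: "\<not> E v v"
    and E_V: "E u v \<Longrightarrow> u \<in> V"
begin

abbreviation N :: "'a \<Rightarrow> 'a set" where "N \<equiv> nb E V"

lemma E_V2: "E u v \<Longrightarrow> v \<in> V"
  using E_V E_sym by blast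

lemma E_neq: "E u v \<Longrightarrow> u \<noteq> v"
  using E_irr by auto

lemma mem_N: "u \<in> N v \<longleftrightarrow> E v u"
  using E_V2 unfolding nb_def by auto

lemma finite_nb: "finite P \<Longrightarrow> finite (nb E P v)"
  unfolding nb_def by auto

lemma finite_N [simp]: "finite (N v)"
  using finite_nb[OF finV] .

lemma extend_coloring:
  assumes "P \<subseteq> W" "proper_on E P L f" "slack_on E (W - P) (\<lambda>v. L v - f ` nb E P v)"
  shows "\<exists>g. proper_on E W L g \<and> (\<forall>v \<in> P. g v = f v)"
proof -
  obtain h where h: "proper_on E (W - P) (\<lambda>v. L v - f ` nb E P v) h"
    using slack_on_colorable_and_connected[OF E_sym E_irr assms(3)] by blast
  define g where "g = (\<lambda>v. if v \<in> P then f v else h v)"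
  have "proper_on E W L g"
    unfolding proper_on_def
  proof (intro conjI ballI impI)
    fix v assume v: "v \<in> W" show "g v \<in> L v"
    proof (cases "v \<in> P")
      case True then show ?thesis using proper_on_inL[OF assms(2)] unfolding g_def by auto
    next
      case False then show ?thesis using proper_on_inL[OF h, of v] v unfolding g_def by auto
    qed
  next
    fix x y assume xy: "x \<in> W" "y \<in> W" "E x y"
    consider "x \<in> P" "y \<in> P" | "x \<notin> P" "y \<notin> P" | "x \<in> P" "y \<notin> P" | "x \<notin> P" "y \<in> P" by blast
    then show "g x \<noteq> g y"
    proof cases
      case 1 then show ?thesis using proper_onD[OF assms(2) _ _ xy(3)] unfolding g_def by auto
    next
      case 2 then show ?thesis using proper_onD[OF h _ _ xy(3)] xy unfolding g_def by auto
    next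
      case 3
      then have "h y \<in> L y - f ` nb E P y" using proper_on_inL[OF h] xy by auto
      moreover have "x \<in> nb E P y" using 3 E_sym[OF xy(3)] unfolding nb_def by auto
      ultimately show ?thesis using 3 unfolding g_def by (auto simp: image_iff)
    next
      case 4
      then have "h x \<in> L x - f ` nb E P x" using proper_on_inL[OF h] xy by auto
      moreover have "y \<in> nb E P x" using 4 xy(3) unfolding nb_def by auto
      ultimately show ?thesis using 4 unfolding g_def by (auto simp: image_iff)
    qed
  qed
  then show ?thesis unfolding g_def by (intro exI[of _ g]) (auto simp: g_def)
qed

lemma kempe_eq_if_agree:
  assumes "P \<subseteq> V" "proper_on E V L f" "proper_on E V L g" "\<And>v. v \<in> P \<Longrightarrow> f v = g v"
    "slack_on E (V - P) (\<lambda>v. L v - f ` nb E P v)"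
  shows "kempe_eq E V L f g"
proof -
  let ?L = "\<lambda>v. L v - f ` nb E P v"
  have VP: "V - (V - P) = P" using assms(1) by auto
  have p: "proper_on E (V - P) ?L h" if h: "proper_on E V L h" "\<And>v. v \<in> P \<Longrightarrow> f v = h v" for h
    unfolding proper_on_def
  proof (intro conjI ballI impI)
    fix v assume v: "v \<in> V - P"
    have "h v \<noteq> f u" if "u \<in> nb E P v" for u
      using that h(2)[of u] proper_onD[OF h(1), of v u] v assms(1) unfolding nb_def by auto
    then show "h v \<in> ?L v" using proper_on_inL[OF h(1)] v by auto
  next
    fix u v assume "u \<in> V - P" "v \<in> V - P" "E u v"
    then show "h u \<noteq> h v" using proper_onD[OF h(1)] by auto
  qed
  have "kempe_eq E (V - P) ?L f g"
    using slack_on_colorable_and_connected[OF E_sym E_irr assms(5)] p[OF assms(2)] p[OF assms(3)] assms(4)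
    by blast
  then have e: "kempe_eq E (V - P) (\<lambda>v. L v - f ` nb E (V - (V - P)) v) f g" unfolding VP .
  show ?thesis
    by (rule kempe_eq_lift[OF E_sym _ assms(2,3) _ e]) (use assms(4) in auto)
qed

end

section \<open>4-connected regular graphs\<close>

locale conn4reg = sgraph +
  fixes k :: nat
  assumes reg: "v \<in> V \<Longrightarrow> card (N v) = k"
    and conn: "S \<subseteq> V \<Longrightarrow> card S < 4 \<Longrightarrow> D \<noteq> {} \<Longrightarrow> closed_in E (V - S) D \<Longrightarrow> D = V - S"
    and big: "4 < card V"
begin

text \<open>If \<open>k \<le> 3\<close>, the neighborhood of a vertex is too small to separate, so
  the vertex and its neighbors would be the whole graph, which has more than four vertices.\<close>

lemma k_ge_4: "4 \<le> k"
proof (rule ccontr)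
  assume k: "\<not> 4 \<le> k"
  have "V \<noteq> {}" using big by auto
  then obtain v where v: "v \<in> V" by blast
  have vN: "v \<notin> N v" using mem_N E_irr by blast
  have "{v} = V - N v"
  proof (rule conn)
    show "N v \<subseteq> V" unfolding nb_def by blast
    show "card (N v) < 4" using reg[OF v] k by simp
    show "closed_in E (V - N v) {v}" using v vN mem_N unfolding closed_in_def by blast
  qed simp
  then have "V \<subseteq> insert v (N v)" by blast
  then have "card V \<le> card (insert v (N v))" by (intro card_mono) simp_all
  also have "\<dots> = Suc (card (N v))" using vN by simp
  finally show False using big k reg[OF v] by simp
qed

lemma card_nb_split:
  assumes "S \<subseteq> V" "v \<in> V"
  shows "card (nb E (V - S) v) + card (nb E S v) = k"
proof -
  have "N v = nb E (V - S) v \<union> nb E S v" using assms unfolding nb_def by auto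
  moreover have "nb E (V - S) v \<inter> nb E S v = {}" unfolding nb_def by auto
  moreover have "finite (nb E (V - S) v)" "finite (nb E S v)"
    using finV assms finite_subset finite_nb by blast+
  ultimately show ?thesis using card_Un_disjoint reg[OF assms(2)] by metis
qed

lemma other_neighbor:
  assumes "v \<in> V" "finite X" "card X < k"
  obtains u where "E v u" "u \<notin> X"
proof -
  have "\<not> N v \<subseteq> X" using card_mono[OF assms(2), of "N v"] reg[OF assms(1)] assms(3) by linarith
  then show ?thesis using that mem_N by blast
qed

lemma other_neighbor3:
  assumes "v \<in> V"
  obtains u where "E v u" "u \<noteq> a" "u \<noteq> b" "u \<noteq> c"
proof -
  have "card {a, b, c} \<le> 3" by (auto simp: card_insert_if)
  then show ?thesis using other_neighbor[OF assms, of "{a, b, c}"] k_ge_4 that by auto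
qed

text \<open>By regularity the clique \<open>insert z (N z)\<close> contains all \<open>k\<close>
  neighbors of each of its vertices, hence it is closed.\<close>

lemma clique_neighborhood:
  assumes z: "z \<in> V" and cl: "\<And>y y'. E z y \<Longrightarrow> E z y' \<Longrightarrow> y \<noteq> y' \<Longrightarrow> E y y'"
  shows "V = insert z (N z)"
proof -
  have "closed_in E (V - {}) (insert z (N z))"
    unfolding closed_in_def
  proof (intro conjI ballI impI)
    show "insert z (N z) \<subseteq> V - {}" using z unfolding nb_def by auto
    fix u v assume u: "u \<in> insert z (N z)" and uv: "E u v"
    show "v \<in> insert z (N z)"
    proof (cases "u = z")
      case True then show ?thesis using uv mem_N by auto
    next
      case False
      then have zu: "E z u" using u mem_N by auto
      have "N u = insert z (N z - {u})"
      proof (rule sym, rule card_subset_eq[OF finite_N])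
        show "insert z (N z - {u}) \<subseteq> N u"
          using cl zu E_sym unfolding mem_N subset_iff insert_iff Diff_iff by blast
        have "z \<notin> N z" "u \<in> N z" using mem_N E_irr zu by auto
        then show "card (insert z (N z - {u})) = card (N u)"
          using reg[OF z] reg[OF E_V2[OF zu]] k_ge_4 by auto
      qed
      then show ?thesis using uv mem_N by blast
    qed
  qed
  from conn[OF _ _ _ this] show ?thesis by simp
qed

end

section \<open>Classes of colorings that are fixed on at most three vertices\<close>

locale conn4lists = conn4reg +
  fixes L :: "'a \<Rightarrow> 'c set"
  assumes finL: "v \<in> V \<Longrightarrow> finite (L v)"
    and cardL: "v \<in> V \<Longrightarrow> card (L v) = k"
begin

abbreviation Col :: "('a \<Rightarrow> 'c) \<Rightarrow> bool" where "Col \<equiv> proper_on E V L"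

abbreviation eqv (infix "\<approx>" 50) where "f \<approx> g \<equiv> kempe_eq E V L f g"

definition swap_conn :: bool where
  "swap_conn \<longleftrightarrow> (\<exists>f. Col f) \<and> (\<forall>f g. Col f \<longrightarrow> Col g \<longrightarrow> f \<approx> g)"

text \<open>Slack of \<open>w\<close> after fixing \<open>f\<close> on \<open>S\<close>: fewer
  colors leave \<open>L w\<close> than neighbors leave the graph. A foreign color and a repeated
  color are the two sources, marked \<open>A\<close> and \<open>B\<close> in the names of the lemmas
  and classes below.\<close>

definition sur :: "'a set \<Rightarrow> ('a \<Rightarrow> 'c) \<Rightarrow> 'a \<Rightarrow> bool" where
  "sur S f w \<longleftrightarrow> card (L w \<inter> f ` nb E S w) < card (nb E S w)"

lemma surA:
  assumes "finite S" "x \<in> S" "E w x" "f x \<notin> L w"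
  shows "sur S f w"
proof -
  have "L w \<inter> f ` nb E S w \<subseteq> f ` (nb E S w - {x})" using assms by auto
  then have "card (L w \<inter> f ` nb E S w) \<le> card (nb E S w - {x})"
    by (meson assms(1) card_image_le card_mono finite_Diff finite_imageI finite_nb le_trans)
  also have "\<dots> < card (nb E S w)"
    by (rule card_Diff1_less) (use assms finite_nb in \<open>auto simp: nb_def\<close>)
  finally show ?thesis unfolding sur_def .
qed

lemma surB:
  assumes "finite S" "x \<in> S" "y \<in> S" "x \<noteq> y" "E w x" "E w y" "f x = f y"
  shows "sur S f w"
proof -
  have "y \<in> nb E S w - {x}" using assms unfolding nb_def by auto
  then have "L w \<inter> f ` nb E S w \<subseteq> f ` (nb E S w - {x})" using assms(7) by auto
  then have "card (L w \<inter> f ` nb E S w) \<le> card (nb E S w - {x})"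
    by (meson assms(1) card_image_le card_mono finite_Diff finite_imageI finite_nb le_trans)
  also have "\<dots> < card (nb E S w)"
    by (rule card_Diff1_less) (use assms finite_nb in \<open>auto simp: nb_def\<close>)
  finally show ?thesis unfolding sur_def .
qed

lemma card_list_minus:
  assumes "v \<in> V"
  shows "card (L v - X) + card (L v \<inter> X) = k"
  using card_Diff_subset_Int[of "L v" X] card_mono[of "L v" "L v \<inter> X"] finL[OF assms] cardL[OF assms]
  by auto

lemma slack_conn:
  assumes "S \<subseteq> V" and cl: "\<And>D. D \<noteq> {} \<Longrightarrow> closed_in E (V - S) D \<Longrightarrow> \<exists>w \<in> D. sur S f w"
  shows "slack_on E (V - S) (\<lambda>v. L v - f ` nb E S v)"
proof -
  have finS: "finite S" using assms(1) finV finite_subset by blast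
  have le: "card (L v \<inter> f ` nb E S v) \<le> card (nb E S v)" for v
    by (meson card_image_le card_mono finS finite_imageI finite_nb inf_le2 le_trans)
  have 1: "finite (L v - f ` nb E S v) \<and> card (nb E (V - S) v) \<le> card (L v - f ` nb E S v)"
    if "v \<in> V - S" for v
    using that le[of v] card_nb_split[OF assms(1), of v] card_list_minus[of v "f ` nb E S v"] finL[of v] by auto
  have "card (nb E (V - S) w) < card (L w - f ` nb E S w)" if "w \<in> V - S" "sur S f w" for w
    using that le[of w] card_nb_split[OF assms(1), of w] card_list_minus[of w "f ` nb E S w"]
    unfolding sur_def by auto
  then show ?thesis using 1 finV cl unfolding slack_on_def closed_in_def by (meson finite_Diff subsetD)
qed

text \<open>With at most three vertices removed, the only nonempty closed set is all of
  \<open>V - S\<close>, and it contains \<open>w\<close>.\<close>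

lemma slack_small:
  assumes "S \<subseteq> V" "card S < 4" "w \<in> V - S" "sur S f w"
  shows "slack_on E (V - S) (\<lambda>v. L v - f ` nb E S v)"
  using slack_conn[OF assms(1)] conn[OF assms(1,2)] assms(3,4) by metis

lemma ex_col:
  assumes "S \<subseteq> V" "card S < 4" "w \<in> V - S" "sur S f w" "proper_on E S L f"
  shows "\<exists>g. Col g \<and> (\<forall>v \<in> S. g v = f v)"
  using extend_coloring[OF assms(1,5) slack_small[OF assms(1-4)]] .

lemma eqv_small:
  assumes "S \<subseteq> V" "card S < 4" "w \<in> V - S" "sur S f w" "Col f" "Col g" "\<And>v. v \<in> S \<Longrightarrow> f v = g v"
  shows "f \<approx> g"
  using kempe_eq_if_agree[OF assms(1,5,6,7) slack_small[OF assms(1-4)]] .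

text \<open>Vacuous for an empty class, so the middle class of every chain has to be shown
  nonempty.\<close>

definition lk :: "('a \<Rightarrow> 'c) set \<Rightarrow> ('a \<Rightarrow> 'c) set \<Rightarrow> bool" where
  "lk P Q \<longleftrightarrow> (\<forall>f \<in> P. \<forall>g \<in> Q. f \<approx> g)"

lemma lk_sym: "lk P Q \<Longrightarrow> lk Q P"
  unfolding lk_def using kempe_eq_sym by blast

lemma lk_trans: "lk P Q \<Longrightarrow> Q \<noteq> {} \<Longrightarrow> lk Q R \<Longrightarrow> lk P R"
  unfolding lk_def using kempe_eq_trans by blast

lemma lk_common: "lk P P \<Longrightarrow> lk Q Q \<Longrightarrow> f \<in> P \<Longrightarrow> f \<in> Q \<Longrightarrow> lk P Q"
  unfolding lk_def using kempe_eq_trans by blast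

text \<open>\<open>SA\<close> and \<open>SB\<close> are the classes of the two kinds:
  \<open>SA x c\<close> is used when a neighbor of \<open>x\<close> lacks the color
  \<open>c\<close>, \<open>SB x y d\<close> when \<open>x\<close> and \<open>y\<close> have a common
  neighbor.\<close>

definition SA :: "'a \<Rightarrow> 'c \<Rightarrow> ('a \<Rightarrow> 'c) set" where
  "SA x c = {f. Col f \<and> f x = c}"

definition SB :: "'a \<Rightarrow> 'a \<Rightarrow> 'c \<Rightarrow> ('a \<Rightarrow> 'c) set" where
  "SB x y d = {f. Col f \<and> f x = d \<and> f y = d}"

lemma SB_sym: "SB x y d = SB y x d"
  unfolding SB_def by auto

lemma lk_SA:
  assumes "E x w" "c \<notin> L w"
  shows "lk (SA x c) (SA x c)"
  unfolding lk_def
proof (intro ballI)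
  fix f g assume "f \<in> SA x c" "g \<in> SA x c"
  then show "f \<approx> g"
    using assms E_V[of x w] E_V2[of x w] E_sym[OF assms(1)] E_irr
    by (intro eqv_small[of "{x}" w] surA[of _ x]) (auto simp: SA_def)
qed

lemma SA_ne:
  assumes "E x w" "c \<notin> L w" "c \<in> L x"
  shows "SA x c \<noteq> {}"
proof -
  have "\<exists>g. Col g \<and> (\<forall>v \<in> {x}. g v = (\<lambda>_. c) v)"
    using assms E_V[of x w] E_V2[of x w] E_sym[OF assms(1)] E_irr
    by (intro ex_col[of _ w] surA[of _ x]) (auto simp: proper_on_def)
  then show ?thesis unfolding SA_def by auto
qed

lemma lk_SB:
  assumes "E w x" "E w y" "x \<noteq> y"
  shows "lk (SB x y d) (SB x y d)"
  unfolding lk_def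
proof (intro ballI)
  fix f g assume "f \<in> SB x y d" "g \<in> SB x y d"
  then show "f \<approx> g"
    using assms E_V[of w x] E_V2[of w x] E_V2[of w y] E_irr
    by (intro eqv_small[of "{x, y}" w] surB[of _ x y]) (auto simp: SB_def card_insert_if)
qed

text \<open>Both colors are prescribed at once. The witnesses \<open>p\<close> and \<open>q\<close>
  of the two foreign colors cannot both be fixed vertices, since \<open>pq\<close> rules out that
  \<open>u\<close> and \<open>v\<close> witness each other; a free one provides the slack for a
  common coloring.\<close>

lemma lk_AA:
  assumes uv: "u \<noteq> v" "\<not> E u v \<or> c \<noteq> d" and c: "c \<in> L u" "d \<in> L v"
    and p: "E u p" "c \<notin> L p" and q: "E v q" "d \<notin> L q" and pq: "p \<noteq> v \<or> q \<noteq> u"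
  shows "lk (SA u c) (SA v d)"
proof -
  let ?f = "\<lambda>z. if z = u then c else d"
  have V: "u \<in> V" "v \<in> V" "p \<in> V" "q \<in> V" using p q E_V E_V2 by blast+
  have ne: "p \<noteq> u" "q \<noteq> v" using p q E_irr by auto
  have pr: "proper_on E {u, v} L ?f"
    using uv c E_irr E_sym unfolding proper_on_def by auto
  obtain w where w: "w \<in> V - {u, v}" "sur {u, v} ?f w"
  proof (cases "p \<noteq> v")
    case True
    then show ?thesis using that[of p] surA[of "{u, v}" u p ?f] p E_sym[OF p(1)] V ne by auto
  next
    case False
    then show ?thesis using that[of q] surA[of "{u, v}" v q ?f] q E_sym[OF q(1)] V ne pq uv by auto
  qed
  have "\<exists>g. Col g \<and> (\<forall>z \<in> {u, v}. g z = ?f z)"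
    using ex_col[OF _ _ w pr] V by (auto simp: card_insert_if)
  then obtain g where "Col g" "g u = c" "g v = d" using uv by auto
  then show ?thesis using lk_common[OF lk_SA[OF p] lk_SA[OF q]] unfolding SA_def by auto
qed

text \<open>Three vertices are fixed. The slack comes from \<open>p\<close> or from
  \<open>w\<close>, and \<open>pw\<close> says that one of them is still free.\<close>

lemma lk_AB:
  assumes u: "u \<noteq> x" "u \<noteq> y" and xy: "x \<noteq> y" "\<not> E x y"
    and c: "c \<in> L u" "d \<in> L x" "d \<in> L y"
    and pr: "c \<noteq> d \<or> (\<not> E u x \<and> \<not> E u y)"
    and p: "E u p" "c \<notin> L p" and w: "E w x" "E w y"
    and pw: "(p \<noteq> x \<and> p \<noteq> y) \<or> w \<noteq> u"
  shows "lk (SA u c) (SB x y d)"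
proof -
  let ?f = "\<lambda>z. if z = u then c else d"
  have V: "u \<in> V" "x \<in> V" "y \<in> V" "p \<in> V" "w \<in> V" using p w E_V E_V2 by blast+
  have ne: "p \<noteq> u" "w \<noteq> x" "w \<noteq> y" using p w E_irr by auto
  have pr: "proper_on E {u, x, y} L ?f"
    using u xy c pr E_irr E_sym unfolding proper_on_def by auto
  obtain z where z: "z \<in> V - {u, x, y}" "sur {u, x, y} ?f z"
  proof (cases "p \<noteq> x \<and> p \<noteq> y")
    case True
    then show ?thesis using that[of p] surA[of "{u, x, y}" u p ?f] p E_sym[OF p(1)] V ne by auto
  next
    case False
    then show ?thesis using that[of w] surB[of "{u, x, y}" x y w ?f] w V ne pw u xy by auto
  qed
  have "\<exists>g. Col g \<and> (\<forall>z \<in> {u, x, y}. g z = ?f z)"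
    using ex_col[OF _ _ z pr] V by (auto simp: card_insert_if)
  then obtain g where "Col g" "g u = c" "g x = d" "g y = d" using u by auto
  then show ?thesis using lk_common[OF lk_SA[OF p] lk_SB[OF w xy(1)]] unfolding SA_def SB_def by auto
qed

text \<open>The slack comes from \<open>w\<close>, which sees \<open>d\<close> at \<open>x\<close>
  and at \<open>y\<close>; the third vertex \<open>z\<close> may be at any distance from
  \<open>w\<close>.\<close>

lemma triple_col:
  assumes "x \<noteq> y" "x \<noteq> z" "y \<noteq> z" "\<not> E x y" "\<not> E x z" "\<not> E y z"
    and d: "d \<in> L x" "d \<in> L y" "d \<in> L z"
    and w: "E w x" "E w y" and z: "z \<in> V"
  shows "\<exists>g. Col g \<and> g x = d \<and> g y = d \<and> g z = d"
proof -
  let ?f = "\<lambda>z. d"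
  have V: "x \<in> V" "y \<in> V" "w \<in> V" using w E_V E_V2 by blast+
  have ne: "w \<noteq> x" "w \<noteq> y" "w \<noteq> z" using w E_irr E_sym assms(4-6) by auto
  have pr: "proper_on E {x, y, z} L ?f"
    using assms E_irr E_sym unfolding proper_on_def by auto
  have "sur {x, y, z} ?f w" using surB[of "{x, y, z}" x y w ?f] w assms(1) by auto
  then have "\<exists>g. Col g \<and> (\<forall>v \<in> {x, y, z}. g v = ?f v)"
    using ex_col[OF _ _ _ _ pr, of w] V z ne by (auto simp: card_insert_if)
  then show ?thesis by auto
qed

lemma lk_BB:
  assumes "x \<noteq> y" "x \<noteq> z" "y \<noteq> z" "\<not> E x y" "\<not> E x z" "\<not> E y z"
    and d: "d \<in> L x" "d \<in> L y" "d \<in> L z"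
    and w: "E w x" "E w y" and w': "E w' x" "E w' z"
  shows "lk (SB x y d) (SB x z d)"
proof -
  obtain g where "Col g" "g x = d" "g y = d" "g z = d"
    using triple_col[OF assms(1-11) E_V2[OF w'(2)]] by auto
  then show ?thesis using lk_common[OF lk_SB[OF w assms(1)] lk_SB[OF w' assms(2)]]
    unfolding SB_def by auto
qed

lemma SB_ne:
  assumes "x \<noteq> y" "\<not> E x y" "d \<in> L x" "d \<in> L y" "E w x" "E w y"
  shows "SB x y d \<noteq> {}"
proof -
  have V: "x \<in> V" "y \<in> V" "w \<in> V" using assms E_V E_V2 by blast+
  have ne: "w \<noteq> x" "w \<noteq> y" using assms E_irr by auto
  have pr: "proper_on E {x, y} L (\<lambda>_. d)"
    using assms E_irr E_sym unfolding proper_on_def by auto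
  have "sur {x, y} (\<lambda>_. d) w" using surB[of "{x, y}" x y w "\<lambda>_. d"] assms by auto
  then have "\<exists>g. Col g \<and> (\<forall>v \<in> {x, y}. g v = d)"
    using ex_col[OF _ _ _ _ pr, of w] V ne by (auto simp: card_insert_if)
  then show ?thesis unfolding SB_def by auto
qed

text \<open>Otherwise the \<open>k\<close> neighbors of \<open>w\<close> have distinct colors in
  \<open>L w\<close> without the color of \<open>w\<close> itself, which are only
  \<open>k - 1\<close> colors.\<close>

lemma cover:
  assumes f: "Col f" and w: "w \<in> V"
  shows "(\<exists>x. E w x \<and> f x \<notin> L w) \<or> (\<exists>x y. E w x \<and> E w y \<and> x \<noteq> y \<and> \<not> E x y \<and> f x = f y \<and> f x \<in> L w)"
proof (rule ccontr)
  assume neg: "\<not> ?thesis"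
  have inj: "inj_on f (N w)"
  proof (rule inj_onI)
    fix x y assume xy: "x \<in> N w" "y \<in> N w" "f x = f y"
    show "x = y"
    proof (rule ccontr)
      assume "x \<noteq> y"
      moreover have "\<not> E x y" using proper_onD[OF f, of x y] xy mem_N E_V2 by auto
      ultimately show False using neg xy mem_N by blast
    qed
  qed
  have "f ` N w \<subseteq> L w - {f w}"
  proof
    fix c assume "c \<in> f ` N w"
    then obtain x where x: "E w x" "c = f x" using mem_N by auto
    then show "c \<in> L w - {f w}" using neg proper_onD[OF f w, of x] E_V2 by auto
  qed
  then have "card (f ` N w) \<le> card (L w - {f w})" using finL[OF w] card_mono by blast
  moreover have "card (f ` N w) = k" using card_image[OF inj] reg[OF w] by simp
  moreover have "card (L w - {f w}) < k"
    using proper_on_inL[OF f w] finL[OF w] cardL[OF w] by (metis card_Diff1_less)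
  ultimately show False by simp
qed

text \<open>By \<open>cover\<close> the classes around a single vertex exhaust all colorings, so it
  suffices to link each of them to one reference \<open>R\<close>.\<close>

lemma finish_at:
  assumes w: "w \<in> V" and R: "R \<noteq> {}" "\<And>f. f \<in> R \<Longrightarrow> Col f"
    and A: "\<And>x c. E w x \<Longrightarrow> c \<in> L x \<Longrightarrow> c \<notin> L w \<Longrightarrow> lk (SA x c) R"
    and B: "\<And>x y d. E w x \<Longrightarrow> E w y \<Longrightarrow> x \<noteq> y \<Longrightarrow> \<not> E x y \<Longrightarrow> d \<in> L x \<Longrightarrow> d \<in> L y \<Longrightarrow> d \<in> L w \<Longrightarrow>
      lk (SB x y d) R"
  shows swap_conn
proof -
  obtain r where r: "r \<in> R" using R by blast
  have "f \<approx> r" if f: "Col f" for f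
    using cover[OF f w]
  proof (elim disjE exE conjE)
    fix x assume "E w x" "f x \<notin> L w"
    then show ?thesis using A[of x "f x"] f r proper_on_inL[OF f, of x] E_V2 unfolding lk_def SA_def by auto
  next
    fix x y assume *: "E w x" "E w y" "x \<noteq> y" "\<not> E x y" "f x = f y" "f x \<in> L w"
    moreover have "f x \<in> L x" "f x \<in> L y"
      using * proper_on_inL[OF f, of x] proper_on_inL[OF f, of y] E_V2 by auto
    ultimately show ?thesis using B[of x y "f x"] f r unfolding lk_def SB_def by auto
  qed
  then show ?thesis unfolding swap_conn_def using R r kempe_eq_trans kempe_eq_sym by metis
qed

section \<open>Vertices with neighbors that have other lists\<close>

lemma diff_ex:
  assumes "u \<in> V" "v \<in> V" "L u \<noteq> L v"
  obtains c where "c \<in> L u" "c \<notin> L v"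
proof -
  have "\<not> L u \<subseteq> L v" using card_subset_eq[OF finL[OF assms(2)]] cardL assms by metis
  then show ?thesis using that by blast
qed

text \<open>A foreign color at a neighbor \<open>x\<close> of \<open>w\<close> is linked to a color
  at \<open>w\<close> that another neighbor \<open>xi\<close> lacks. Two neighbors give two such
  reference classes at \<open>w\<close>, and \<open>x3\<close> connects them. A nonadjacent pair
  misses one of the three neighbors, which links the pair to the rest.\<close>

lemma lists_differ_three:
  assumes x: "E w x1" "E w x2" "E w x3" "x1 \<noteq> x2" "x1 \<noteq> x3" "x2 \<noteq> x3"
    and d: "L x1 \<noteq> L w" "L x2 \<noteq> L w" "L x3 \<noteq> L w"
  shows swap_conn
proof -
  have V: "w \<in> V" "x1 \<in> V" "x2 \<in> V" "x3 \<in> V" using x E_V E_V2 by blast+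
  obtain e1 where e1: "e1 \<in> L w" "e1 \<notin> L x1" using diff_ex[OF V(1,2)] d by metis
  obtain e2 where e2: "e2 \<in> L w" "e2 \<notin> L x2" using diff_ex[OF V(1,3)] d by metis
  obtain c1 where c1: "c1 \<in> L x1" "c1 \<notin> L w" using diff_ex[OF V(2,1)] d by metis
  obtain c2 where c2: "c2 \<in> L x2" "c2 \<notin> L w" using diff_ex[OF V(3,1)] d by metis
  obtain c3 where c3: "c3 \<in> L x3" "c3 \<notin> L w" using diff_ex[OF V(4,1)] d by metis
  have *: "lk (SA x c) (SA w e)"
    if "E w x" "c \<in> L x" "c \<notin> L w" "E w xi" "e \<in> L w" "e \<notin> L xi" "x \<noteq> xi" for x c xi e
    using that E_sym[OF that(1)] E_irr by (intro lk_AA[where p = w and q = xi]) auto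
  have "lk (SA w e1) (SA w e2)"
    using lk_trans[OF lk_sym[OF *[OF x(3) c3 x(1) e1]] SA_ne[OF E_sym[OF x(3)] c3(2,1)] *[OF x(3) c3 x(2) e2]] x
    by auto
  then have e21: "lk (SA w e2) (SA w e1)" by (rule lk_sym)
  have ne: "SA w e1 \<noteq> {}" "SA w e2 \<noteq> {}" using SA_ne[OF x(1) e1(2,1)] SA_ne[OF x(2) e2(2,1)] by auto
  have A: "lk (SA y c) (SA w e1)" if y: "E w y" "c \<in> L y" "c \<notin> L w" for y c
  proof (cases "y = x1")
    case True
    then show ?thesis using lk_trans[OF *[OF y x(2) e2] ne(2) e21] x by auto
  qed (use *[OF y x(1) e1] in auto)
  show ?thesis
  proof (rule finish_at[OF V(1) ne(1)])
    show "Col f" if "f \<in> SA w e1" for f using that unfolding SA_def by auto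
    fix y z d assume yz: "E w y" "E w z" "y \<noteq> z" "\<not> E y z" "d \<in> L y" "d \<in> L z" "d \<in> L w"
    obtain u c where u: "E w u" "u \<noteq> y" "u \<noteq> z" "c \<in> L u" "c \<notin> L w"
      using x c1 c2 c3 by metis
    have "lk (SA u c) (SB y z d)"
      using u yz E_sym[OF u(1)] E_irr by (intro lk_AB[where p = w and w = w]) auto
    from lk_trans[OF lk_sym[OF this] SA_ne[OF E_sym[OF u(1)] u(5,4)] A[OF u(1,4,5)]]
    show "lk (SB y z d) (SA w e1)" .
  qed (use A in auto)
qed

text \<open>Most links go through a color at \<open>w\<close>, but the classes at \<open>x\<close>
  and at \<open>y\<close> must still be joined to each other. As these two vertices are adjacent,
  prescribing both needs different foreign colors; the difficult case is a single foreign color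
  common to both.\<close>

lemma lists_differ_two_adjacent:
  assumes F: "\<And>w x1 x2 x3. E w x1 \<Longrightarrow> E w x2 \<Longrightarrow> E w x3 \<Longrightarrow> x1 \<noteq> x2 \<Longrightarrow> x1 \<noteq> x3 \<Longrightarrow> x2 \<noteq> x3 \<Longrightarrow>
      L x1 \<noteq> L w \<Longrightarrow> L x2 \<noteq> L w \<Longrightarrow> L x3 = L w"
    and x: "E w x" "E w y" "x \<noteq> y" "L x \<noteq> L w" "L y \<noteq> L w" "E x y"
  shows swap_conn
proof -
  have V: "w \<in> V" "x \<in> V" "y \<in> V" using x E_V E_V2 by blast+
  obtain e1 where e1: "e1 \<in> L w" "e1 \<notin> L x" using diff_ex[OF V(1,2)] x by metis
  obtain e2 where e2: "e2 \<in> L w" "e2 \<notin> L y" using diff_ex[OF V(1,3)] x by metis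
  obtain cx where cx: "cx \<in> L x" "cx \<notin> L w" using diff_ex[OF V(2,1)] x by metis
  obtain cy where cy: "cy \<in> L y" "cy \<notin> L w" using diff_ex[OF V(3,1)] x by metis
  have *: "lk (SA u c) (SA w e)"
    if "E w u" "c \<in> L u" "c \<notin> L w" "E w xi" "e \<in> L w" "e \<notin> L xi" "u \<noteq> xi" for u c xi e
    using that E_sym[OF that(1)] E_irr by (intro lk_AA[where p = w and q = xi]) auto
  have ne: "SA w e1 \<noteq> {}" "SA w e2 \<noteq> {}" using SA_ne[OF x(1) e1(2,1)] SA_ne[OF x(2) e2(2,1)] by auto
  have neA: "SA u c \<noteq> {}" if "E w u" "c \<in> L u" "c \<notin> L w" for u c using SA_ne[OF E_sym[OF that(1)] that(3,2)] .
  have "\<exists>c d. c \<in> L x \<and> c \<notin> L w \<and> d \<in> L y \<and> d \<notin> L w \<and> lk (SA x c) (SA y d)"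
  proof (cases "\<exists>c d. c \<in> L x \<and> c \<notin> L w \<and> d \<in> L y \<and> d \<notin> L w \<and> c \<noteq> d")
    case True
    then obtain c d where cd: "c \<in> L x" "c \<notin> L w" "d \<in> L y" "d \<notin> L w" "c \<noteq> d" by blast
    then have "lk (SA x c) (SA y d)"
      using x E_sym[OF x(1)] E_sym[OF x(2)] E_irr by (intro lk_AA[where p = w and q = w]) auto
    then show ?thesis using cd by blast
  next
    case same: False
    have cc: "cx = cy" using same cx cy by blast
    have Dx: "L x - L w = {cx}" using same cx cy by blast
    show ?thesis
    proof (cases "\<exists>e \<in> L w. e \<notin> L x \<and> e \<notin> L y")
      case True
      then obtain e where e: "e \<in> L w" "e \<notin> L x" "e \<notin> L y" by blast
      have "lk (SA x cx) (SA w e)" using *[OF x(1) cx x(2) e(1,3)] x by auto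
      moreover have "lk (SA w e) (SA y cy)" using lk_sym[OF *[OF x(2) cy x(1) e(1,2)]] x by auto
      ultimately have "lk (SA x cx) (SA y cy)" using lk_trans SA_ne[OF x(1) e(2,1)] by blast
      then show ?thesis using cx cy by blast
    next
      case False
      then have e2x: "e2 \<in> L x" and e1y: "e1 \<in> L y" using e1 e2 by blast+
      \<comment> \<open>This further neighbor of \<open>w\<close> has the list \<open>L w\<close>.
        It is adjacent to neither \<open>x\<close> nor \<open>y\<close>, since otherwise that vertex
        would have three neighbors with other lists.\<close>
      obtain r where r: "E w r" "r \<notin> {x, y}"
        using other_neighbor3[OF V(1), of x y x] by blast
      have Lr: "L r = L w" using F[OF x(1,2) r(1)] r x by auto
      have rx: "\<not> E x r"
      proof
        assume "E x r"
        then have "L r = L x"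
          using F[OF E_sym[OF x(1)] x(6) _ _ _ _ x(4)[symmetric], of r] r x e2 e2x E_irr by auto
        then show False using Lr x by auto
      qed
      have ry: "\<not> E y r"
      proof
        assume "E y r"
        then have "L r = L y"
          using F[OF E_sym[OF x(2)] E_sym[OF x(6)] _ _ _ _ x(5)[symmetric], of r] r x e2 e2x E_irr by auto
        then show False using Lr x by auto
      qed
      \<comment> \<open>The lists of \<open>x\<close> and \<open>w\<close> differ in one color only,
        so they share at least three; \<open>d\<close> must avoid \<open>e2\<close>, the color of
        \<open>w\<close> in the second link below.\<close>
      have "card (L x - L w) = 1" using Dx by simp
      then have "card (L x \<inter> L w) = k - 1" using card_list_minus[OF V(2), of "L w"] by linarith
      then have "\<not> L x \<inter> L w \<subseteq> {e2}" using k_ge_4 card_mono[of "{e2}" "L x \<inter> L w"] by fastforce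
      then obtain d where d: "d \<in> L x" "d \<in> L w" "d \<noteq> e2" by blast
      have 1: "lk (SA y cx) (SB x r d)"
        using x r d cx cy cc rx ry Lr E_sym[OF x(2)] E_irr by (intro lk_AB[where p = w and w = w]) auto
      have 2: "lk (SA w e2) (SB x r d)"
        using x r d e2 rx ry Lr E_irr by (intro lk_AB[where p = y and w = w]) auto
      have 3: "lk (SA x cx) (SA w e2)" using *[OF x(1) cx x(2) e2] x by auto
      have "SB x r d \<noteq> {}" using SB_ne[of x r d w] x r d rx Lr by auto
      then have "lk (SA w e2) (SA y cx)" using lk_trans[OF 2 _ lk_sym[OF 1]] by blast
      then have "lk (SA x cx) (SA y cy)" using lk_trans[OF 3 ne(2)] cc by blast
      then show ?thesis using cx cy by blast
    qed
  qed
  then obtain c d where cd: "c \<in> L x" "c \<notin> L w" "d \<in> L y" "d \<notin> L w" "lk (SA x c) (SA y d)" by blast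
  have A: "lk (SA u c') (SA w e2)" if u: "E w u" "c' \<in> L u" "c' \<notin> L w" for u c'
  proof (cases "u = y")
    case True
    have "lk (SA u c') (SA w e1)" using *[OF u x(1) e1] True x by auto
    moreover have "lk (SA w e1) (SA y d)" using lk_sym[OF *[OF x(2) cd(3,4) x(1) e1]] x by auto
    moreover have "lk (SA x c) (SA w e2)" using *[OF x(1) cd(1,2) x(2) e2] x by auto
    ultimately show ?thesis
      using lk_trans ne neA[OF x(2) cd(3,4)] neA[OF x(1) cd(1,2)] lk_sym[OF cd(5)] by metis
  qed (use *[OF u x(2) e2] in auto)
  show ?thesis
  proof (rule finish_at[OF V(1) ne(2)])
    show "Col f" if "f \<in> SA w e2" for f using that unfolding SA_def by auto
    fix p z d' assume yz: "E w p" "E w z" "p \<noteq> z" "\<not> E p z" "d' \<in> L p" "d' \<in> L z" "d' \<in> L w"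
    obtain u c' where u: "E w u" "u \<noteq> p" "u \<noteq> z" "c' \<in> L u" "c' \<notin> L w"
      using x cx cy yz(4) E_sym[OF x(6)] by metis
    have "lk (SA u c') (SB p z d')"
      using u yz E_sym[OF u(1)] E_irr by (intro lk_AB[where p = w and w = w]) auto
    from lk_trans[OF lk_sym[OF this] SA_ne[OF E_sym[OF u(1)] u(5,4)] A[OF u(1,4,5)]]
    show "lk (SB p z d') (SA w e2)" .
  qed (use A in auto)
qed

text \<open>If \<open>x\<close> has a neighbor in the neighborhood of \<open>w\<close>, the adjacent
  case applies at \<open>w\<close> or at \<open>x\<close>. Otherwise foreign colors of
  \<open>x\<close> and \<open>y\<close> are directly compatible, and only the pair \<open>x\<close>,
  \<open>y\<close> itself needs a detour through a third neighbor \<open>r\<close>.\<close>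

lemma lists_differ_two:
  assumes F: "\<And>w x1 x2 x3. E w x1 \<Longrightarrow> E w x2 \<Longrightarrow> E w x3 \<Longrightarrow> x1 \<noteq> x2 \<Longrightarrow> x1 \<noteq> x3 \<Longrightarrow> x2 \<noteq> x3 \<Longrightarrow>
      L x1 \<noteq> L w \<Longrightarrow> L x2 \<noteq> L w \<Longrightarrow> L x3 = L w"
    and x: "E w x" "E w y" "x \<noteq> y" "L x \<noteq> L w" "L y \<noteq> L w"
  shows swap_conn
proof (cases "E x y \<or> (\<exists>r. E w r \<and> r \<noteq> y \<and> E x r)")
  case True
  then show ?thesis
  proof (elim disjE exE conjE)
    assume "E x y"
    show ?thesis by (rule lists_differ_two_adjacent[OF _ x \<open>E x y\<close>]) (rule F; assumption)
  next
    fix r assume r: "E w r" "r \<noteq> y" "E x r"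
    then have "L r = L w" using F[OF x(1,2) r(1)] x E_irr by auto
    then have r': "w \<noteq> r" "L w \<noteq> L x" "L r \<noteq> L x" using x E_neq[OF r(1)] by auto
    show ?thesis
      by (rule lists_differ_two_adjacent[OF _ E_sym[OF x(1)] r(3) r' r(1)]) (rule F; assumption)
  qed
next
  case False
  have V: "w \<in> V" "x \<in> V" "y \<in> V" using x E_V E_V2 by blast+
  obtain cx where cx: "cx \<in> L x" "cx \<notin> L w" using diff_ex[OF V(2,1)] x by metis
  obtain cy where cy: "cy \<in> L y" "cy \<notin> L w" using diff_ex[OF V(3,1)] x by metis
  have Lr: "L r = L w" if "E w r" "r \<noteq> x" "r \<noteq> y" for r using F[OF x(1,2) that(1)] that x by auto
  have xy: "lk (SA x c) (SA y d)" if "c \<in> L x" "c \<notin> L w" "d \<in> L y" "d \<notin> L w" for c d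
    using that x False E_sym[OF x(1)] E_sym[OF x(2)] E_irr by (intro lk_AA[where p = w and q = w]) auto
  have ne: "SA x cx \<noteq> {}" "SA y cy \<noteq> {}" using SA_ne[OF E_sym[OF x(1)] cx(2,1)] SA_ne[OF E_sym[OF x(2)] cy(2,1)] by auto
  have A: "lk (SA u c) (SA x cx)" if u: "E w u" "c \<in> L u" "c \<notin> L w" for u c
  proof -
    have "u = x \<or> u = y" using Lr u by auto
    then show ?thesis
    proof
      assume "u = y" then show ?thesis using lk_sym[OF xy[OF cx]] u by auto
    next
      assume "u = x"
      then show ?thesis using lk_trans[OF xy ne(2) lk_sym[OF xy[OF cx cy]]] u cy by auto
    qed
  qed
  have B0: "lk (SB p z d) (SA x cx)"
    if yz: "E w p" "E w z" "p \<noteq> z" "\<not> E p z" "d \<in> L p" "d \<in> L z" "d \<in> L w"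
      and u: "E w u" "u \<noteq> p" "u \<noteq> z" "c \<in> L u" "c \<notin> L w" for p z d u c
  proof -
    have "lk (SA u c) (SB p z d)"
      using u yz E_sym[OF u(1)] E_irr by (intro lk_AB[where p = w and w = w]) auto
    from lk_trans[OF lk_sym[OF this] SA_ne[OF E_sym[OF u(1)] u(5,4)] A[OF u(1,4,5)]]
    show ?thesis .
  qed
  \<comment> \<open>Of two further neighbors of \<open>w\<close>, \<open>y\<close> is adjacent to at
    most one, for with both and \<open>w\<close> it would have three neighbors with other
    lists.\<close>
  obtain r where r: "E w r" "r \<notin> {x, y}" "\<not> E x r" "\<not> E y r"
  proof -
    obtain r1 where r1: "E w r1" "r1 \<notin> {x, y}"
      using other_neighbor3[OF V(1), of x y x] by blast
    obtain r2 where r2: "E w r2" "r2 \<notin> {x, y, r1}"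
      using other_neighbor3[OF V(1), of x y r1] by blast
    have "\<not> E x r1" "\<not> E x r2" using False r1 r2 by auto
    moreover have "\<not> (E y r1 \<and> E y r2)"
    proof
      assume yr: "E y r1 \<and> E y r2"
      then have "L r2 = L y" using F[of y w r1 r2] E_sym[OF x(2)] r1 r2 x Lr[of r1] E_irr by auto
      then show False using Lr[of r2] r2 x by auto
    qed
    ultimately show ?thesis using that r1 r2 by blast
  qed
  show ?thesis
  proof (rule finish_at[OF V(1) ne(1)])
    show "Col f" if "f \<in> SA x cx" for f using that unfolding SA_def by auto
    fix p z d assume yz: "E w p" "E w z" "p \<noteq> z" "\<not> E p z" "d \<in> L p" "d \<in> L z" "d \<in> L w"
    show "lk (SB p z d) (SA x cx)"
    proof (cases "x \<in> {p, z} \<and> y \<in> {p, z}")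
      case False
      then show ?thesis using B0[OF yz x(1) _ _ cx] B0[OF yz x(2) _ _ cy] by auto
    next
      case True
      then have d: "d \<in> L x" "d \<in> L y" and eq: "SB p z d = SB x y d" using yz x SB_sym by auto
      have "\<not> E x y" using False by blast
      have 1: "lk (SB x y d) (SB x r d)"
        using x r d yz(7) \<open>\<not> E x y\<close> Lr[OF r(1)] by (intro lk_BB[where w = w and w' = w]) auto
      have 2: "lk (SB x r d) (SA x cx)"
        using B0[of x r d y cy] x r d yz(7) Lr[OF r(1)] cy by auto
      have "SB x r d \<noteq> {}" using SB_ne[of x r d w] x r d yz(7) Lr[OF r(1)] by auto
      then show ?thesis using lk_trans[OF 1 _ 2] eq by simp
    qed
  qed (use A in auto)
qed

text \<open>The edges between different lists form a matching, and \<open>w x\<close> is one of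
  them, lying in no triangle. Colorings are inspected around a vertex \<open>z\<close> remote from
  this edge, if there is one: a class at \<open>z\<close> can be fixed together with the color
  \<open>c\<close> at \<open>x\<close> or \<open>e\<close> at \<open>w\<close>, where the other end
  of the edge keeps slack.\<close>

lemma lists_differ_matching:
  assumes F: "\<And>w x1 x2. E w x1 \<Longrightarrow> E w x2 \<Longrightarrow> x1 \<noteq> x2 \<Longrightarrow> L x1 \<noteq> L w \<Longrightarrow> L x2 = L w"
    and x: "E w x" "L x \<noteq> L w"
  shows swap_conn
proof -
  have V: "w \<in> V" "x \<in> V" using x E_V E_V2 by blast+
  have xw: "E x w" using E_sym[OF x(1)] .
  obtain c where c: "c \<in> L x" "c \<notin> L w" using diff_ex[OF V(2,1)] x by metis
  obtain e where e: "e \<in> L w" "e \<notin> L x" using diff_ex[OF V(1,2)] x by metis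
  have ne: "SA x c \<noteq> {}" "SA w e \<noteq> {}" using SA_ne[OF xw c(2,1)] SA_ne[OF x(1) e(2,1)] by auto
  have Lw: "L r = L w" if "E w r" "r \<noteq> x" for r using F[OF x(1) that(1)] that x by auto
  have Lx: "L r = L x" if "E x r" "r \<noteq> w" for r using F[OF xw that(1)] that x by auto
  have nocommon: "\<not> E x r" if "E w r" "r \<noteq> x" for r
  proof
    assume "E x r"
    then have "L r = L x" using Lx[of r] E_neq[OF that(1)] by auto
    then show False using Lw[OF that] x by auto
  qed
  show ?thesis
  proof (cases "\<exists>z \<in> V. z \<noteq> x \<and> z \<noteq> w \<and> \<not> E z x \<and> \<not> E z w")
    case True
    then obtain z where z: "z \<in> V" "z \<noteq> x" "z \<noteq> w" "\<not> E z x" "\<not> E z w" by blast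
    have A1: "lk (SA y d) (SA x c)" if "E z y" "d \<in> L y" "d \<notin> L z" "d \<noteq> c" for y d
      using that z x xw c E_sym[OF that(1)] E_irr by (intro lk_AA[where p = z and q = w]) auto
    have A2: "lk (SA y d) (SA w e)" if "E z y" "d \<in> L y" "d \<notin> L z" "d \<noteq> e" for y d
      using that z x xw e E_sym[OF that(1)] E_irr by (intro lk_AA[where p = z and q = x]) auto
    have B1: "lk (SB y y' d) (SA x c)"
      if "E z y" "E z y'" "y \<noteq> y'" "\<not> E y y'" "d \<in> L y" "d \<in> L y'" "d \<noteq> c" for y y' d
    proof (rule lk_sym)
      show "lk (SA x c) (SB y y' d)"
        using that z x xw c E_irr by (intro lk_AB[where p = w and w = z]) auto
    qed
    have B2: "lk (SB y y' d) (SA w e)"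
      if "E z y" "E z y'" "y \<noteq> y'" "\<not> E y y'" "d \<in> L y" "d \<in> L y'" "d \<noteq> e" for y y' d
    proof (rule lk_sym)
      show "lk (SA w e) (SB y y' d)"
        using that z x xw e E_irr by (intro lk_AB[where p = x and w = z]) auto
    qed
    \<comment> \<open>A color different from \<open>c\<close> and \<open>e\<close> avoids conflicts
      with both ends of the edge, so that its class is linked to both references.\<close>
    have pick: "\<exists>d. d \<in> L v \<and> d \<noteq> c \<and> d \<noteq> e" if "v \<in> V" for v
    proof -
      have "\<not> L v \<subseteq> {c, e}"
      proof
        assume "L v \<subseteq> {c, e}"
        then have "card (L v) \<le> card {c, e}" by (intro card_mono) auto
        also have "\<dots> \<le> 2" by (auto simp: card_insert_if)
        finally show False using cardL[OF that] k_ge_4 by simp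
      qed
      then show ?thesis by blast
    qed
    have "\<exists>P. P \<noteq> {} \<and> lk P (SA x c) \<and> lk P (SA w e)"
    proof (cases "\<exists>y. E z y \<and> L y \<noteq> L z")
      case True
      then obtain y where y: "E z y" "L y \<noteq> L z" by blast
      obtain d where d: "d \<in> L y" "d \<noteq> c" "d \<noteq> e" using pick[OF E_V2[OF y(1)]] by blast
      show ?thesis
      proof (cases "d \<in> L z")
        case False
        then show ?thesis using A1[OF y(1) d(1)] A2[OF y(1) d(1)] d SA_ne[OF E_sym[OF y(1)] False d(1)] by blast
      next
        case True
        obtain r where r: "E z r" "r \<notin> {y}"
          using other_neighbor3[OF z(1), of y y y] by blast
        have Lr: "L r = L z" using F[OF y(1) r(1)] r y by auto
        have yr: "\<not> E y r"
        proof
          assume "E y r"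
          then have "L r = L y" using F[OF E_sym[OF y(1)], of r] E_neq[OF r(1)] y by auto
          then show False using Lr y by auto
        qed
        have "SB y r d \<noteq> {}" using SB_ne[of y r d z] y r d yr Lr True by auto
        then show ?thesis using B1[of y r d] B2[of y r d] y r d yr Lr True by auto
      qed
    next
      case False
      have "\<exists>y y'. E z y \<and> E z y' \<and> y \<noteq> y' \<and> \<not> E y y'"
      proof (rule ccontr)
        assume neg: "\<not> ?thesis"
        have "V = insert z (N z)" by (rule clique_neighborhood[OF z(1)]) (use neg in blast)
        then have "x \<in> insert z (N z)" using V by blast
        then show False using z mem_N by auto
      qed
      then obtain y y' where y: "E z y" "E z y'" "y \<noteq> y'" "\<not> E y y'" by blast
      obtain d where d: "d \<in> L z" "d \<noteq> c" "d \<noteq> e" using pick[OF z(1)] by blast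
      have "L y = L z" "L y' = L z" using False y by auto
      then show ?thesis using SB_ne[of y y' d z] B1[OF y, of d] B2[OF y, of d] d y by auto
    qed
    then obtain P where P: "P \<noteq> {}" "lk P (SA x c)" "lk P (SA w e)" by blast
    have we: "lk (SA w e) (SA x c)" using lk_trans[OF lk_sym[OF P(3)] P(1,2)] .
    show ?thesis
    proof (rule finish_at[OF z(1) ne(1)])
      show "Col f" if "f \<in> SA x c" for f using that unfolding SA_def by auto
      show "lk (SA y d) (SA x c)" if "E z y" "d \<in> L y" "d \<notin> L z" for y d
      proof (cases "d = c")
        case False then show ?thesis using A1[OF that] by auto
      next
        case True
        then have "d \<noteq> e" using c e by auto
        then show ?thesis using lk_trans[OF A2[OF that] ne(2) we] by auto
      qed
      show "lk (SB y y' d) (SA x c)"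
        if y: "E z y" "E z y'" "y \<noteq> y'" "\<not> E y y'" "d \<in> L y" "d \<in> L y'" for y y' d
      proof (cases "d = c")
        case False then show ?thesis using B1[OF y] by auto
      next
        case True
        then have "d \<noteq> e" using c e by auto
        then show ?thesis using lk_trans[OF B2[OF y] ne(2) we] by auto
      qed
    qed
  next
    case False
    text \<open>Now the graph is the Cartesian product of two complete graphs on \<open>k\<close> and \<open>2\<close> vertices, with
      one list on each of the two cliques \<open>A\<close> and \<open>B\<close>.\<close>
    define A where "A = insert w (N w - {x})"
    define B where "B = insert x (N x - {w})"
    have LA: "L a = L w" if "a \<in> A" for a using that Lw mem_N unfolding A_def by auto
    have LB: "L b = L x" if "b \<in> B" for b using that Lx mem_N unfolding B_def by auto
    have VAB: "V = A \<union> B"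
    proof
      show "A \<union> B \<subseteq> V" using V E_V2 mem_N unfolding A_def B_def by auto
      show "V \<subseteq> A \<union> B"
      proof
        fix z assume "z \<in> V"
        then have "z = x \<or> z = w \<or> E x z \<or> E w z" using False E_sym by blast
        then show "z \<in> A \<union> B" using mem_N unfolding A_def B_def by auto
      qed
    qed
    have cA: "card A = k" and cB: "card B = k"
    proof -
      have "w \<notin> N w" "x \<in> N w" "x \<notin> N x" "w \<in> N x" using mem_N E_irr x xw by auto
      then show "card A = k" "card B = k" using reg[OF V(1)] reg[OF V(2)] k_ge_4 unfolding A_def B_def by auto
    qed
    have fin: "finite A" "finite B" unfolding A_def B_def by auto
    have partner: "\<exists>q. E p q \<and> q \<in> Q" if "V = P \<union> Q" "p \<in> P" "p \<in> V" "card P = k" "finite P" for P Q p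
    proof (rule ccontr)
      assume "\<not> ?thesis"
      then have "N p \<subseteq> P - {p}" using that(1) E_irr E_V2 mem_N by blast
      then have "card (N p) \<le> card (P - {p})" using that(5) by (intro card_mono) auto
      also have "\<dots> < card P" using that by (intro card_Diff1_less) auto
      finally show False using reg[OF that(3)] that(4) by simp
    qed
    have pA: "\<exists>b \<in> B. E a b" if "a \<in> A" for a using partner[OF VAB that _ cA fin(1)] that VAB by auto
    have pB: "\<exists>a \<in> A. E b a" if "b \<in> B" for b
      using partner[of B A b] VAB that cB fin(2) by auto
    have uniq: "a = a'" if "b \<in> B" "a \<in> A" "a' \<in> A" "E b a" "E b a'" for a a' b
      using F[OF that(4,5)] LA that LB x by metis
    \<comment> \<open>A missing edge inside \<open>B\<close> would leave \<open>b\<close> at most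
      \<open>k - 2\<close> neighbors in \<open>B\<close> and, by \<open>uniq\<close>, one in
      \<open>A\<close>.\<close>
    have cl: "E b b'" if b: "b \<in> B" "b' \<in> B" "b \<noteq> b'" for b b'
    proof (rule ccontr)
      assume nb: "\<not> E b b'"
      obtain a where a: "a \<in> A" "E b a" using pB[OF b(1)] by blast
      have "N b \<subseteq> insert a (B - {b, b'})"
      proof
        fix y assume "y \<in> N b"
        then have y: "E b y" using mem_N by auto
        show "y \<in> insert a (B - {b, b'})"
        proof (cases "y \<in> A")
          case True then show ?thesis using uniq[OF b(1) a(1) True a(2) y] by simp
        next
          case False then show ?thesis using y nb VAB E_V2[OF y] E_irr by auto
        qed
      qed
      then have "card (N b) \<le> card (insert a (B - {b, b'}))" using fin by (intro card_mono) auto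
      also have "\<dots> \<le> Suc (card (B - {b, b'}))" by (rule card_insert_le_m1[rotated]) auto
      also have "card (B - {b, b'}) = k - 2" using b cB fin by (simp add: card_Diff_subset)
      finally show False using reg[of b] b VAB k_ge_4 by auto
    qed
    \<comment> \<open>\<open>B\<close> is a clique on \<open>k\<close> vertices with a common list
      of \<open>k\<close> colors, so every coloring uses all of them on \<open>B\<close>.\<close>
    have hit: "\<exists>b \<in> B. f b = c" if f: "Col f" for f
    proof -
      have inj: "inj_on f B"
      proof (rule inj_onI, rule ccontr)
        fix b b' assume "b \<in> B" "b' \<in> B" "f b = f b'" "b \<noteq> b'"
        then show False using proper_onD[OF f _ _ cl] VAB by auto
      qed
      have "f ` B \<subseteq> L x" using proper_on_inL[OF f] LB VAB by auto
      moreover have "card (f ` B) = card (L x)" using card_image[OF inj] cB cardL[OF V(2)] by simp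
      ultimately have "f ` B = L x" using card_subset_eq finL[OF V(2)] by metis
      then show ?thesis using c by (metis imageE)
    qed
    have link: "lk (SA b c) (SA a e)" if b: "b \<in> B" and a: "a \<in> A" "\<not> E b a" for a b
    proof -
      obtain a' where a': "a' \<in> A" "E b a'" using pB[OF b] by blast
      obtain b' where b': "b' \<in> B" "E a b'" using pA[OF a(1)] by blast
      have "b \<noteq> a" using LA[OF a(1)] LB[OF b] x by auto
      then show ?thesis
        using a b a' b' LA[OF a(1)] LA[OF a'(1)] LB[OF b] LB[OF b'(1)] c e
        by (intro lk_AA[where p = a' and q = b']) auto
    qed
    have neA: "SA a e \<noteq> {}" if a: "a \<in> A" for a
    proof -
      obtain b' where b': "b' \<in> B" "E a b'" using pA[OF a(1)] by blast
      then show ?thesis using SA_ne[OF b'(2), of e] LA[OF a] LB[OF b'(1)] e by auto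
    qed
    have neB: "SA b c \<noteq> {}" if b: "b \<in> B" for b
    proof -
      obtain a' where b': "a' \<in> A" "E b a'" using pB[OF b] by blast
      then show ?thesis using SA_ne[OF b'(2), of c] LB[OF b] LA[OF b'(1)] c by auto
    qed
    have all: "lk (SA b c) (SA w e)" if b: "b \<in> B" for b
    proof (cases "E b w")
      case False then show ?thesis using link[OF b] unfolding A_def by blast
    next
      case True
      have wA: "w \<in> A" unfolding A_def by simp
      \<comment> \<open>A vertex \<open>b\<close> adjacent to \<open>w\<close> reaches it through a
        second vertex \<open>a\<close> of \<open>A\<close> and a partner \<open>b'\<close> of a
        third one.\<close>
      have "\<not> A \<subseteq> {w}" using card_mono[of "{w}" A] cA k_ge_4 by auto
      then obtain a where a: "a \<in> A" "a \<noteq> w" by blast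
      have "\<not> A \<subseteq> {w, a}" using card_mono[of "{w, a}" A] cA k_ge_4 a by auto
      then obtain a' where a': "a' \<in> A" "a' \<noteq> w" "a' \<noteq> a" by blast
      obtain b' where b': "b' \<in> B" "E a' b'" using pA[OF a'(1)] by blast
      have 1: "\<not> E b a" using uniq[OF b wA a(1) True] a by auto
      have 2: "\<not> E b' a" "\<not> E b' w" using uniq[OF b'(1) a'(1) _ E_sym[OF b'(2)]] a a' wA by auto
      have "lk (SA a e) (SA w e)"
        using lk_trans[OF lk_sym[OF link[OF b'(1) a(1) 2(1)]] neB[OF b'(1)] link[OF b'(1) wA 2(2)]] .
      then show ?thesis using lk_trans[OF link[OF b a(1) 1] neA[OF a(1)]] by blast
    qed
    obtain r where r: "r \<in> SA w e" using ne(2) by blast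
    have "f \<approx> r" if f: "Col f" for f
    proof -
      obtain b where "b \<in> B" "f b = c" using hit[OF f] by blast
      then show ?thesis using all r f unfolding lk_def SA_def by auto
    qed
    moreover have "Col r" using r unfolding SA_def by auto
    ultimately show ?thesis unfolding swap_conn_def using kempe_eq_trans kempe_eq_sym by metis
  qed
qed

text \<open>An edge with different lists at its ends exists by connectivity. The cases are the
  largest number of neighbors with another list that a vertex has: at least three, two, or
  one.\<close>

theorem swap_conn_nonconstant:
  assumes "u \<in> V" "v \<in> V" "L u \<noteq> L v"
  shows swap_conn
proof -
  have "\<exists>w x. E w x \<and> L x \<noteq> L w"
  proof (rule ccontr)
    assume neg: "\<not> ?thesis"
    have "closed_in E (V - {}) {x \<in> V. L x = L u}"
      using neg unfolding closed_in_def by auto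
    from conn[OF _ _ _ this] assms(1) have "{x \<in> V. L x = L u} = V" by auto
    then show False using assms by blast
  qed
  then obtain w x where wx: "E w x" "L x \<noteq> L w" by blast
  show ?thesis
  proof (cases "\<exists>w x1 x2 x3. E w x1 \<and> E w x2 \<and> E w x3 \<and> x1 \<noteq> x2 \<and> x1 \<noteq> x3 \<and> x2 \<noteq> x3 \<and>
      L x1 \<noteq> L w \<and> L x2 \<noteq> L w \<and> L x3 \<noteq> L w")
    case True
    then show ?thesis using lists_differ_three by blast
  next
    case F: False
    show ?thesis
    proof (cases "\<exists>w x1 x2. E w x1 \<and> E w x2 \<and> x1 \<noteq> x2 \<and> L x1 \<noteq> L w \<and> L x2 \<noteq> L w")
      case True
      then obtain w x1 x2 where "E w x1" "E w x2" "x1 \<noteq> x2" "L x1 \<noteq> L w" "L x2 \<noteq> L w" by blast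
      then show ?thesis by (rule lists_differ_two[rotated]) (use F in blast)
    next
      case False
      show ?thesis by (rule lists_differ_matching[OF _ wx]) (use False in blast)
    qed
  qed
qed

end

section \<open>Equal lists\<close>

lemma proper_on_subset: "proper_on E U L f \<Longrightarrow> U' \<subseteq> U \<Longrightarrow> proper_on E U' L f"
  unfolding proper_on_def by blast

locale conn4const = conn4reg +
  fixes C :: "'c set"
  assumes finC: "finite C" and cardC: "card C = k"
    and noncomplete: "\<exists>u \<in> V. \<exists>v \<in> V. u \<noteq> v \<and> \<not> E u v"
begin

sublocale conn4lists V E k "\<lambda>_. C"
  by unfold_locales (use finC cardC in auto)

notation eqv (infix "\<approx>" 50)

lemma proper_on_insert:
  assumes g: "proper_on E P (\<lambda>_. C) g" and c: "c \<in> C"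
    and n: "\<And>u. u \<in> P \<Longrightarrow> u \<noteq> v \<Longrightarrow> E v u \<Longrightarrow> g u \<noteq> c"
  shows "proper_on E (insert v P) (\<lambda>_. C) (g(v := c))"
proof (rule proper_on_upd[where L = "\<lambda>_. C"])
  show "proper_on E (insert v P - {v}) (\<lambda>_. C) g" by (rule proper_on_subset[OF g]) blast
  show "g u \<noteq> c" if "u \<in> insert v P" "u \<noteq> v" "E v u" for u using n that by blast
  show "E y x" if "E x y" for x y using E_sym[OF that] .
qed (use c E_irr in auto)

definition Same :: "'a \<Rightarrow> 'a \<Rightarrow> ('a \<Rightarrow> 'c) set" where
  "Same x y = {f. Col f \<and> f x = f y}"

text \<open>Distance exactly two: the common neighbor sees the shared color twice, which makes
  \<open>Same x y\<close> a single class.\<close>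

definition dist2 :: "'a \<Rightarrow> 'a \<Rightarrow> bool" where
  "dist2 x y \<longleftrightarrow> x \<noteq> y \<and> \<not> E x y \<and> (\<exists>w. E w x \<and> E w y)"

lemma Same_sym: "Same x y = Same y x"
  unfolding Same_def by auto

lemma dist2I: "E w x \<Longrightarrow> E w y \<Longrightarrow> x \<noteq> y \<Longrightarrow> \<not> E x y \<Longrightarrow> dist2 x y"
  unfolding dist2_def by blast

lemma dist2_sym: "dist2 x y \<Longrightarrow> dist2 y x"
  unfolding dist2_def using E_sym by blast

lemma dist2_V: "dist2 x y \<Longrightarrow> x \<in> V \<and> y \<in> V"
  unfolding dist2_def using E_V2 by blast

lemma four_colors:
  obtains c1 c2 c3 c4 where "c1 \<in> C" "c2 \<in> C" "c3 \<in> C" "c4 \<in> C"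
    "c1 \<noteq> c2" "c1 \<noteq> c3" "c1 \<noteq> c4" "c2 \<noteq> c3" "c2 \<noteq> c4" "c3 \<noteq> c4"
proof -
  obtain X where X: "X \<subseteq> C" "card X = 4" using obtain_subset_with_card_n[of 4 C] k_ge_4 cardC by auto
  obtain c1 X1 where 1: "X = insert c1 X1" "c1 \<notin> X1" "card X1 = 3" using X(2) card_Suc_eq[of X 3] by auto
  obtain c2 X2 where 2: "X1 = insert c2 X2" "c2 \<notin> X2" "card X2 = 2" using 1(3) card_Suc_eq[of X1 2] by auto
  obtain c3 X3 where 3: "X2 = insert c3 X3" "c3 \<notin> X3" "card X3 = 1" using 2(3) card_Suc_eq[of X2 1] by auto
  obtain c4 where 4: "X3 = {c4}" using 3(3) card_1_singletonE by auto
  show ?thesis using that[of c1 c2 c3 c4] X 1 2 3 4 by auto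
qed

text \<open>Exchanging two colors on the whole graph is one step, allowed because all lists are
  equal. It adjusts the common color of the pair, after which both colorings lie in one
  \<open>SB\<close> class.\<close>

lemma lk_Same:
  assumes "dist2 x y"
  shows "lk (Same x y) (Same x y)"
  unfolding lk_def
proof (intro ballI)
  obtain w where w: "E w x" "E w y" and xy: "x \<noteq> y" using assms unfolding dist2_def by auto
  have V: "x \<in> V" "y \<in> V" using dist2_V[OF assms] by auto
  fix f g assume f: "f \<in> Same x y" and g: "g \<in> Same x y"
  let ?t = "Transposition.transpose (f x) (g x)"
  have fC: "Col f" and gC: "Col g" using f g unfolding Same_def by auto
  have in_C: "f x \<in> C" "g x \<in> C" using proper_on_inL[OF fC V(1)] proper_on_inL[OF gC V(1)] by auto
  have h: "Col (?t \<circ> f)"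
    unfolding proper_on_def
  proof (intro conjI ballI impI)
    fix v assume "v \<in> V" then show "(?t \<circ> f) v \<in> C"
      using in_C proper_on_inL[OF fC] by (auto simp: Transposition.transpose_def)
  next
    fix u v assume "u \<in> V" "v \<in> V" "E u v"
    then show "(?t \<circ> f) u \<noteq> (?t \<circ> f) v" using proper_onD[OF fC] by (metis comp_apply transpose_involutory)
  qed
  have "kempe_step E V (\<lambda>_. C) f (?t \<circ> f)"
  proof (rule kempe_stepI[where \<alpha> = "f x" and \<beta> = "g x" and K = "{v \<in> V. f v \<in> {f x, g x}}", OF fC h])
    show "closed_in E {v \<in> V. f v \<in> {f x, g x}} {v \<in> V. f v \<in> {f x, g x}}"
      unfolding closed_in_def by blast
  qed (auto simp: Transposition.transpose_def)
  then have 1: "f \<approx> ?t \<circ> f" unfolding kempe_eq_def by blast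
  have "?t \<circ> f \<in> SB x y (g x)" "g \<in> SB x y (g x)"
    using h f g unfolding SB_def Same_def by auto
  then have "?t \<circ> f \<approx> g" using lk_SB[OF w xy] unfolding lk_def by blast
  with 1 show "f \<approx> g" by (rule kempe_eq_trans)
qed

lemma Same_ne: "dist2 x y \<Longrightarrow> Same x y \<noteq> {}"
proof -
  assume d: "dist2 x y"
  obtain c where "c \<in> C" using four_colors by blast
  then have "SB x y c \<noteq> {}" using d SB_ne unfolding dist2_def by blast
  then show ?thesis unfolding SB_def Same_def by auto
qed

lemma lk_if_common:
  "dist2 x y \<Longrightarrow> dist2 a b \<Longrightarrow> Col f \<Longrightarrow> f x = f y \<Longrightarrow> f a = f b \<Longrightarrow> lk (Same x y) (Same a b)"
  by (rule lk_common[OF lk_Same lk_Same, of x y a b f]) (auto simp: Same_def)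

text \<open>A third nonadjacent vertex can receive the color of the pair; \<open>y\<close> and
  \<open>z\<close> themselves may be far apart.\<close>

lemma lk_triple:
  assumes "dist2 x y" "dist2 x z" "y \<noteq> z" "\<not> E y z"
  shows "lk (Same x y) (Same x z)"
proof -
  obtain c where c: "c \<in> C" using four_colors by blast
  obtain w where "E w x" "E w y" "x \<noteq> y" "\<not> E x y" using assms unfolding dist2_def by auto
  moreover have "x \<noteq> z" "\<not> E x z" "z \<in> V" using assms dist2_V unfolding dist2_def by auto
  ultimately obtain g where "Col g" "g x = c" "g y = c" "g z = c"
    using triple_col[of x y z c w] assms c by auto
  then show ?thesis using lk_if_common[OF assms(1,2)] by auto
qed

lemma lk_trans2: "lk (Same x y) (Same a b) \<Longrightarrow> dist2 a b \<Longrightarrow> lk (Same a b) R \<Longrightarrow> lk (Same x y) R"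
  using lk_trans Same_ne by blast

lemma nonadjacent_neighbors:
  assumes "w \<in> V"
  obtains x y where "E w x" "E w y" "x \<noteq> y" "\<not> E x y"
proof -
  have "\<exists>x y. E w x \<and> E w y \<and> x \<noteq> y \<and> \<not> E x y"
  proof (rule ccontr)
    assume neg: "\<not> ?thesis"
    have "V = insert w (N w)" by (rule clique_neighborhood[OF assms]) (use neg in blast)
    then have "u = w \<or> E w u" if "u \<in> V" for u using that mem_N by blast
    then show False using noncomplete neg E_sym by metis
  qed
  then show ?thesis using that by blast
qed

text \<open>With equal lists no color is foreign, so only pairs of nonadjacent neighbors of
  \<open>w\<close> matter.\<close>

lemma finish_pairs:
  assumes w: "w \<in> V"
    and all: "\<And>x y a b. E w x \<Longrightarrow> E w y \<Longrightarrow> x \<noteq> y \<Longrightarrow> \<not> E x y \<Longrightarrow>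
      E w a \<Longrightarrow> E w b \<Longrightarrow> a \<noteq> b \<Longrightarrow> \<not> E a b \<Longrightarrow> lk (Same x y) (Same a b)"
  shows swap_conn
proof -
  obtain a b where ab: "E w a" "E w b" "a \<noteq> b" "\<not> E a b" using nonadjacent_neighbors[OF w] .
  show ?thesis
  proof (rule finish_at[OF w Same_ne[OF dist2I[OF ab]]])
    show "Col f" if "f \<in> Same a b" for f using that unfolding Same_def by auto
    fix x y d assume "E w x" "E w y" "x \<noteq> y" "\<not> E x y"
    then have "lk (Same x y) (Same a b)" using all ab by blast
    moreover have "SB x y d \<subseteq> Same x y" unfolding SB_def Same_def by auto
    ultimately show "lk (SB x y d) (Same a b)" unfolding lk_def by blast
  qed auto
qed

text \<open>The vertices of \<open>Y\<close> stay uncolored and need not be colored properly by \<open>f\<close>: their colors are only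
  reserved, that is, forbidden on the neighbors in \<open>W - X\<close>.\<close>

lemma extend_partial:
  assumes W: "W \<subseteq> V" "X \<subseteq> W" "Y \<subseteq> V - W"
    and f: "proper_on E X (\<lambda>_. C) f"
    and D: "\<And>D. D \<noteq> {} \<Longrightarrow> closed_in E (W - X) D \<Longrightarrow>
      \<exists>v \<in> D. sur (X \<union> Y) f v \<or> (\<exists>r \<in> V - W - Y. E v r)"
  shows "\<exists>g. proper_on E W (\<lambda>_. C) g \<and> (\<forall>v \<in> X. g v = f v) \<and>
    (\<forall>v \<in> W - X. \<forall>y \<in> Y. E v y \<longrightarrow> g v \<noteq> f y)"
proof -
  let ?L = "\<lambda>v. if v \<in> X then C else C - f ` nb E Y v"
  let ?S = "X \<union> Y"
  have SV: "?S \<subseteq> V" using W by blast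
  have finS: "finite ?S" using SV finV finite_subset by blast
  have f': "proper_on E X ?L f" using f unfolding proper_on_def by auto
  have Leq: "?L v - f ` nb E X v = C - f ` nb E ?S v" if "v \<in> W - X" for v
    using that unfolding nb_def by auto
  have le: "card (C \<inter> f ` nb E ?S v) \<le> card (nb E ?S v)" for v
    by (meson card_image_le card_mono finS finite_imageI finite_nb inf_le2 le_trans)
  have sub: "nb E (W - X) v \<subseteq> nb E (V - ?S) v" for v using W unfolding nb_def by auto
  have finn: "finite (nb E (V - ?S) v)" for v using finV finite_nb by blast
  have 1: "card (nb E (W - X) v) \<le> card (C - f ` nb E ?S v)" if "v \<in> W - X" for v
    using card_mono[OF finn sub[of v]] card_nb_split[OF SV, of v] card_list_minus[of v "f ` nb E ?S v"]
      le[of v] that W by auto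
  have 2: "card (nb E (W - X) v) < card (C - f ` nb E ?S v)" if "v \<in> W - X" "sur ?S f v" for v
    using card_mono[OF finn sub[of v]] card_nb_split[OF SV, of v] card_list_minus[of v "f ` nb E ?S v"]
      le[of v] that W unfolding sur_def by auto
  have 3: "card (nb E (W - X) v) < card (C - f ` nb E ?S v)"
    if "v \<in> W - X" "r \<in> V - W - Y" "E v r" for v r
  proof -
    have "r \<in> nb E (V - ?S) v" "r \<notin> nb E (W - X) v" using that W unfolding nb_def by auto
    then have "nb E (W - X) v \<subset> nb E (V - ?S) v" using sub[of v] by blast
    then have "card (nb E (W - X) v) < card (nb E (V - ?S) v)" by (rule psubset_card_mono[OF finn])
    then show ?thesis using card_nb_split[OF SV, of v] card_list_minus[of v "f ` nb E ?S v"]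
      le[of v] that W by auto
  qed
  have "slack_on E (W - X) (\<lambda>v. ?L v - f ` nb E X v)"
    unfolding slack_on_def
  proof (intro conjI ballI allI impI)
    show "finite (W - X)" using W finV finite_subset by blast
    show "finite (?L v - f ` nb E X v)" if "v \<in> W - X" for v using finC by auto
    show "card (nb E (W - X) v) \<le> card (?L v - f ` nb E X v)" if "v \<in> W - X" for v
      using 1[OF that] Leq[OF that] by simp
    fix D' assume D': "D' \<noteq> {} \<and> closed_in E (W - X) D'"
    then obtain v where v: "v \<in> D'" "sur ?S f v \<or> (\<exists>r \<in> V - W - Y. E v r)" using D by blast
    have vW: "v \<in> W - X" using v D' unfolding closed_in_def by auto
    have "card (nb E (W - X) v) < card (C - f ` nb E ?S v)" using v(2) 2[OF vW] 3[OF vW] by blast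
    then show "\<exists>v \<in> D'. card (nb E (W - X) v) < card (?L v - f ` nb E X v)"
      using v(1) Leq[OF vW] by (intro bexI[of _ v]) simp_all
  qed
  from extend_coloring[OF W(2) f' this] obtain g
    where g: "proper_on E W ?L g" "\<forall>v \<in> X. g v = f v" by blast
  have "proper_on E W (\<lambda>_. C) g" using g(1) unfolding proper_on_def by (auto split: if_splits)
  moreover have "g v \<noteq> f y" if "v \<in> W - X" "y \<in> Y" "E v y" for v y
    using proper_on_inL[OF g(1), of v] that unfolding nb_def by auto
  ultimately show ?thesis using g(2) by blast
qed

text \<open>If no vertex of a closed set has an uncolored neighbor outside \<open>Y\<close>, the set
  stays closed when only the at most three vertices of \<open>X\<close> and \<open>Y\<close> are
  removed. Then it is everything else, including the uncolored \<open>r\<close>.\<close>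

lemma extend_partial_small:
  assumes W: "W \<subseteq> V" "X \<subseteq> W" "Y \<subseteq> V - W"
    and f: "proper_on E X (\<lambda>_. C) f" and c: "card (X \<union> Y) < 4" and r: "r \<in> V - W - Y"
  shows "\<exists>g. proper_on E W (\<lambda>_. C) g \<and> (\<forall>v \<in> X. g v = f v) \<and>
    (\<forall>v \<in> W - X. \<forall>y \<in> Y. E v y \<longrightarrow> g v \<noteq> f y)"
proof (rule extend_partial[OF W f])
  fix D assume D: "D \<noteq> {}" "closed_in E (W - X) D"
  show "\<exists>v \<in> D. sur (X \<union> Y) f v \<or> (\<exists>r \<in> V - W - Y. E v r)"
  proof (rule ccontr)
    assume neg: "\<not> ?thesis"
    have "closed_in E (V - (X \<union> Y)) D" using D(2) neg W unfolding closed_in_def by blast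
    then have "D = V - (X \<union> Y)" using conn[OF _ c D(1)] W by blast
    then have "r \<in> D" using r W by blast
    then show False using r D(2) unfolding closed_in_def by blast
  qed
qed

text \<open>The uncolored rest is a clique, hence connected, so one vertex with a repeated color
  suffices however many vertices are fixed.\<close>

lemma extend_clique:
  assumes P: "P \<subseteq> V" and f: "proper_on E P (\<lambda>_. C) f"
    and cl: "\<And>u v. u \<in> V - P \<Longrightarrow> v \<in> V - P \<Longrightarrow> u \<noteq> v \<Longrightarrow> E u v"
    and w: "w \<in> V - P" and x: "x \<in> P" "y \<in> P" "x \<noteq> y" "E w x" "E w y" "f x = f y"
  shows "\<exists>g. Col g \<and> (\<forall>v \<in> P. g v = f v)"
proof -
  have finP: "finite P" using P finV finite_subset by blast
  have s: "sur P f w" using surB[OF finP x] .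
  have "\<exists>g. proper_on E V (\<lambda>_. C) g \<and> (\<forall>v \<in> P. g v = f v) \<and>
    (\<forall>v \<in> V - P. \<forall>y \<in> {}. E v y \<longrightarrow> g v \<noteq> f y)"
  proof (rule extend_partial[OF _ P _ f])
    fix D assume D: "D \<noteq> {}" "closed_in E (V - P) D"
    then have "w \<in> D" using cl w unfolding closed_in_def by blast
    then show "\<exists>v \<in> D. sur (P \<union> {}) f v \<or> (\<exists>r \<in> V - V - {}. E v r)" using s by auto
  qed auto
  then show ?thesis by auto
qed

text \<open>The hypotheses make \<open>{q, q'}\<close> a whole component for the colors of its two
  vertices.\<close>

lemma swap_edge:
  assumes F: "Col F" and q: "E q q'"
    and n: "\<And>u. E q u \<Longrightarrow> u \<noteq> q' \<Longrightarrow> F u \<noteq> F q'" "\<And>u. E q' u \<Longrightarrow> u \<noteq> q \<Longrightarrow> F u \<noteq> F q"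
  shows "Col (F(q := F q', q' := F q))" "F \<approx> F(q := F q', q' := F q)"
proof -
  let ?G = "F(q := F q', q' := F q)"
  have V: "q \<in> V" "q' \<in> V" using q E_V E_V2 by auto
  have ne: "q \<noteq> q'" using E_neq[OF q] .
  have q1: "F u \<noteq> F q" if "E q u" for u using proper_onD[OF F V(1) E_V2[OF that] that] by auto
  have q2: "F u \<noteq> F q'" if "E q' u" for u using proper_onD[OF F V(2) E_V2[OF that] that] by auto
  show G: "Col ?G"
    unfolding proper_on_def
  proof (intro conjI ballI impI)
    fix v assume "v \<in> V" then show "?G v \<in> C" using proper_on_inL[OF F] V by auto
  next
    fix u v assume uv: "u \<in> V" "v \<in> V" "E u v"
    show "?G u \<noteq> ?G v"
      using proper_onD[OF F uv] n(1)[of u] n(1)[of v] n(2)[of u] n(2)[of v] uv(3) E_sym[OF uv(3)] ne E_irr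
        q1[OF q] by auto
  qed
  have "kempe_step E V (\<lambda>_. C) F ?G"
  proof (rule kempe_stepI[where \<alpha> = "F q" and \<beta> = "F q'" and K = "{q, q'}", OF F G])
    show "closed_in E {v \<in> V. F v \<in> {F q, F q'}} {q, q'}"
      using V n q1 q2 unfolding closed_in_def by auto
  qed (use ne in auto)
  then show "F \<approx> ?G" unfolding kempe_eq_def by blast
qed

lemma lk_if_eqv:
  assumes "dist2 x y" "dist2 a b" "Col f" "Col g" "f \<approx> g" "f x = f y" "g a = g b"
  shows "lk (Same x y) (Same a b)"
proof -
  have fg: "f \<in> Same x y" "g \<in> Same a b" using assms unfolding Same_def by auto
  show ?thesis
    unfolding lk_def
  proof (intro ballI)
    fix f' g' assume "f' \<in> Same x y" "g' \<in> Same a b"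
    then have "f' \<approx> f" "g \<approx> g'" using fg lk_Same assms unfolding lk_def by blast+
    then show "f' \<approx> g'" using assms(5) kempe_eq_trans by blast
  qed
qed

section \<open>A clique on k vertices\<close>

lemma card_outside_clique:
  assumes Q: "Q \<subseteq> V" and cl: "\<And>u v. u \<in> Q \<Longrightarrow> v \<in> Q \<Longrightarrow> u \<noteq> v \<Longrightarrow> E u v" and q: "q \<in> Q"
  shows "card (N q - Q) + card Q = Suc k"
proof -
  have finQ: "finite Q" using Q finV finite_subset by blast
  have "N q \<inter> Q = Q - {q}" using cl[OF q] mem_N E_irr by auto
  then have "card (N q \<inter> Q) = card Q - 1" using q finQ by simp
  moreover have "card (N q \<inter> Q) + card (N q - Q) = k"
    using card_Int_Diff[OF finite_N, of q Q] reg[of q] q Q by auto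
  moreover have "0 < card Q" using q finQ card_gt_0_iff by blast
  ultimately show ?thesis by linarith
qed

text \<open>Each vertex of \<open>Q\<close> has a single outer neighbor, so the pairs around
  \<open>w\<close> consist of \<open>x = out w\<close> and some \<open>q\<close> in
  \<open>Q\<close>. Two such pairs are linked by a coloring in which \<open>q\<close> and
  \<open>q'\<close> form a component with the colors \<open>c1\<close> of \<open>x\<close> and
  \<open>c2\<close>: its swap moves \<open>c1\<close> from \<open>q\<close> to
  \<open>q'\<close>.\<close>

lemma swap_conn_clique_k:
  assumes Q: "Q \<subseteq> V" "card Q = k" and cl: "\<And>u v. u \<in> Q \<Longrightarrow> v \<in> Q \<Longrightarrow> u \<noteq> v \<Longrightarrow> E u v"
  shows swap_conn
proof -
  have finQ: "finite Q" using Q finV finite_subset by blast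
  have "\<exists>y. N q - Q = {y}" if q: "q \<in> Q" for q
  proof -
    have "card (N q - Q) = 1" using card_outside_clique[OF Q(1) cl q] Q(2) by simp
    then show ?thesis by (rule card_1_singletonE) blast
  qed
  then obtain out where out: "\<And>q. q \<in> Q \<Longrightarrow> N q - Q = {out q}" by metis
  have nbq: "u \<in> Q \<or> u = out q" if "q \<in> Q" "E q u" for q u
    using out[OF that(1)] mem_N that(2) by blast
  have outE: "E q (out q)" "out q \<notin> Q" "out q \<in> V" if "q \<in> Q" for q
    using out[OF that] mem_N E_V2 by blast+
  obtain w where w: "w \<in> Q" using Q k_ge_4 by fastforce
  have wV: "w \<in> V" using w Q by auto
  define x where "x = out w"
  have x: "E w x" "x \<notin> Q" "x \<in> V" using outE[OF w] unfolding x_def by auto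
  obtain c1 c2 c3 c4 where c: "c1 \<in> C" "c2 \<in> C" "c3 \<in> C" "c4 \<in> C"
    "c1 \<noteq> c2" "c1 \<noteq> c3" "c1 \<noteq> c4" "c2 \<noteq> c3" "c2 \<noteq> c4" "c3 \<noteq> c4" using four_colors .
  have d2: "dist2 x q" if "q \<in> Q" "\<not> E x q" for q
  proof -
    have "q \<noteq> w" using that E_sym[OF x(1)] by auto
    then show ?thesis using dist2I[OF x(1) cl[OF w that(1)]] that x by auto
  qed
  have main: "lk (Same x q) (Same x q')" if q: "q \<in> Q" "\<not> E x q" "q' \<in> Q" "\<not> E x q'" for q q'
  proof (cases "q = q'")
    case True then show ?thesis using lk_Same[OF d2[OF q(1,2)]] by simp
  next
    case False
    \<comment> \<open>\<open>c3\<close> and \<open>c4\<close> keep \<open>c1\<close> and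
      \<open>c2\<close> away from the outer neighbors of \<open>q\<close> and \<open>q'\<close>,
      which may coincide or be adjacent.\<close>
    let ?f = "\<lambda>z. if z = x then c1 else if z = out q then c3 else c4"
    let ?X = "{x, out q, out q'}"
    have qw: "q \<noteq> w" "q' \<noteq> w" using q E_sym[OF x(1)] by auto
    have ox: "out q \<noteq> x" "out q' \<noteq> x" using q outE E_sym by metis+
    have "\<exists>g. proper_on E (V - Q) (\<lambda>_. C) g \<and> (\<forall>v \<in> ?X. g v = ?f v) \<and>
        (\<forall>v \<in> V - Q - ?X. \<forall>y \<in> {}. E v y \<longrightarrow> g v \<noteq> ?f y)"
    proof (rule extend_partial_small[where r = w])
      show "?X \<subseteq> V - Q" using x outE[OF q(1)] outE[OF q(3)] by auto
      show "proper_on E ?X (\<lambda>_. C) ?f" using c ox E_irr unfolding proper_on_def by auto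
      show "card (?X \<union> {}) < 4" by (auto simp: card_insert_if)
    qed (use w Q in auto)
    then obtain g where g: "proper_on E (V - Q) (\<lambda>_. C) g" "g x = c1" "g (out q) = c3" "g (out q') \<in> {c3, c4}"
      using ox by auto
    let ?P = "(V - Q) \<union> {q, q'}"
    let ?h = "g(q := c1, q' := c2)"
    have xq: "x \<noteq> q" "x \<noteq> q'" using x q by auto
    have h: "proper_on E ?P (\<lambda>_. C) ?h"
    proof -
      have 1: "proper_on E (insert q (V - Q)) (\<lambda>_. C) (g(q := c1))"
      proof (rule proper_on_insert[OF g(1) c(1)])
        show "g u \<noteq> c1" if "u \<in> V - Q" "E q u" for u using nbq[OF q(1) that(2)] that g c by auto
      qed
      have "proper_on E (insert q' (insert q (V - Q))) (\<lambda>_. C) ?h"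
      proof (rule proper_on_insert[OF 1 c(2)])
        show "(g(q := c1)) u \<noteq> c2" if "u \<in> insert q (V - Q)" "E q' u" for u
          using nbq[OF q(3) that(2)] that g c by auto
      qed
      then show ?thesis by (simp add: insert_commute)
    qed
    \<comment> \<open>The slack is at \<open>w\<close>, which sees \<open>c1\<close> at
      \<open>x\<close> and at \<open>q\<close>.\<close>
    have "\<exists>F. Col F \<and> (\<forall>v \<in> ?P. F v = ?h v)"
    proof (rule extend_clique[OF _ h, where w = w and x = x and y = q])
      show "E u v" if "u \<in> V - ?P" "v \<in> V - ?P" "u \<noteq> v" for u v using cl that by auto
      show "E w q" using cl[OF w q(1)] qw by auto
    qed (use Q q w x qw xq wV g False in auto)
    then obtain F where F: "Col F" "\<forall>v \<in> ?P. F v = ?h v" by blast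
    have Fv: "F q = c1" "F q' = c2" "F x = c1" using F(2) x xq g False by auto
    have Fo: "F (out q) \<noteq> c2" "F (out q') \<noteq> c1"
    proof -
      have "out q \<noteq> q" "out q \<noteq> q'" "out q' \<noteq> q" "out q' \<noteq> q'" using outE q by metis+
      then show "F (out q) \<noteq> c2" "F (out q') \<noteq> c1" using F(2) outE[OF q(1)] outE[OF q(3)] g c by auto
    qed
    have eq: "E q q'" using cl q False by auto
    have Fq1: "F u \<noteq> F q'" if u: "E q u" "u \<noteq> q'" for u
    proof (cases "u \<in> Q")
      case True then show ?thesis using proper_onD[OF F(1) _ _ cl[OF True q(3) u(2)]] Q True q by auto
    next
      case False then show ?thesis using nbq[OF q(1) u(1)] Fo Fv by auto
    qed
    have Fq2: "F u \<noteq> F q" if u: "E q' u" "u \<noteq> q" for u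
    proof (cases "u \<in> Q")
      case True then show ?thesis using proper_onD[OF F(1) _ _ cl[OF True q(1) u(2)]] Q True q by auto
    next
      case False then show ?thesis using nbq[OF q(3) u(1)] Fo Fv by auto
    qed
    show ?thesis
      by (rule lk_if_eqv[OF d2[OF q(1,2)] d2[OF q(3,4)] F(1) swap_edge[OF F(1) eq Fq1 Fq2]])
        (use Fv xq in auto)
  qed
  show ?thesis
  proof (rule finish_pairs[OF wV])
    fix y z a b
    assume yz: "E w y" "E w z" "y \<noteq> z" "\<not> E y z" and ab: "E w a" "E w b" "a \<noteq> b" "\<not> E a b"
    have *: "\<exists>q \<in> Q. \<not> E x q \<and> Same y z = Same x q"
      if "E w y" "E w z" "y \<noteq> z" "\<not> E y z" for y z
    proof -
      have "(y \<in> Q \<or> y = x) \<and> (z \<in> Q \<or> z = x)" using nbq[OF w] that unfolding x_def by blast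
      then show ?thesis using cl that Same_sym E_sym by blast
    qed
    obtain q where "q \<in> Q" "\<not> E x q" "Same y z = Same x q" using *[OF yz] by blast
    moreover obtain q' where "q' \<in> Q" "\<not> E x q'" "Same a b = Same x q'" using *[OF ab] by blast
    ultimately show "lk (Same y z) (Same a b)" using main by simp
  qed
qed

end

section \<open>No clique on k - 1 vertices\<close>

context conn4const
begin

text \<open>Four fixed vertices exceed what connectivity guarantees, so the hypothesis
  \<open>D\<close> asks that \<open>w\<close>, which sees a color twice, lie in every component of
  the rest.\<close>

lemma lk_disjoint_pairs:
  assumes w: "E w x" "E w y" "E w a" "E w b" and xy: "x \<noteq> y" "\<not> E x y" and ab: "a \<noteq> b" "\<not> E a b"
    and dj: "x \<noteq> a" "x \<noteq> b" "y \<noteq> a" "y \<noteq> b"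
    and D: "\<And>D. D \<noteq> {} \<Longrightarrow> closed_in E (V - {x, y, a, b}) D \<Longrightarrow> w \<in> D"
  shows "lk (Same x y) (Same a b)"
proof -
  obtain c1 c2 c3 c4 where c: "c1 \<in> C" "c2 \<in> C" "c1 \<noteq> c2" using four_colors by metis
  let ?S = "{x, y, a, b}"
  let ?f = "\<lambda>z. if z = x \<or> z = y then c1 else c2"
  have "\<exists>g. proper_on E V (\<lambda>_. C) g \<and> (\<forall>v \<in> ?S. g v = ?f v) \<and>
      (\<forall>v \<in> V - ?S. \<forall>y \<in> {}. E v y \<longrightarrow> g v \<noteq> ?f y)"
  proof (rule extend_partial)
    show "?S \<subseteq> V" using w E_V2 by auto
    show "proper_on E ?S (\<lambda>_. C) ?f" using c xy ab dj E_irr E_sym unfolding proper_on_def by auto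
    fix D assume "D \<noteq> {}" "closed_in E (V - ?S) D"
    then have "w \<in> D" using D by blast
    moreover have "sur ?S ?f w" using surB[of ?S x y w ?f] w xy by auto
    ultimately show "\<exists>v \<in> D. sur (?S \<union> {}) ?f v \<or> (\<exists>r \<in> V - V - {}. E v r)" by auto
  qed auto
  then obtain g where "Col g" "g x = c1" "g y = c1" "g a = c2" "g b = c2" using dj by auto
  then show ?thesis using lk_if_common[OF dist2I[OF w(1,2) xy] dist2I[OF w(3,4) ab]] by auto
qed

section \<open>Smallest fragments\<close>

definition nbhd :: "'a set \<Rightarrow> 'a set" where
  "nbhd A = {v \<in> V - A. \<exists>a \<in> A. E a v}"

text \<open>One side of a cut of the least possible size four; the last condition demands a vertex
  beyond the cut.\<close>

definition fragment :: "'a set \<Rightarrow> bool" where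
  "fragment A \<longleftrightarrow> A \<noteq> {} \<and> A \<subseteq> V \<and> card (nbhd A) = 4 \<and> V - A - nbhd A \<noteq> {}"

lemma finite_nbhd: "finite (nbhd A)"
  using finV unfolding nbhd_def by auto

lemma nbhd_ge_4:
  assumes "A \<noteq> {}" "A \<subseteq> V" "V - A - nbhd A \<noteq> {}"
  shows "4 \<le> card (nbhd A)"
proof (rule ccontr)
  assume "\<not> ?thesis"
  moreover have "closed_in E (V - nbhd A) A" using assms unfolding closed_in_def nbhd_def by auto
  moreover have "nbhd A \<subseteq> V" unfolding nbhd_def by auto
  ultimately have "A = V - nbhd A" using conn[OF _ _ assms(1)] by auto
  then show False using assms(3) by blast
qed

text \<open>The size of the neighborhood is submodular, which uncrosses the cut \<open>S\<close> and the cut around \<open>A\<close>.\<close>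

lemma smallest_fragment_uncross:
  assumes A: "fragment A" and min: "\<And>B. fragment B \<Longrightarrow> card A \<le> card B"
    and S: "S \<subseteq> V" "card S = 4" "S \<inter> A \<noteq> {}" "\<not> A \<subseteq> S"
    and D: "closed_in E (V - S) D" "D \<noteq> {}"
  shows "D = V - S"
proof (rule ccontr)
  assume neq: "D \<noteq> V - S"
  have D': "closed_in E (V - S) (V - S - D)" using D(1) E_sym unfolding closed_in_def by blast
  \<comment> \<open>One of the two sides of the cut \<open>S\<close> meets \<open>A\<close>; it is
    called \<open>F\<close> and the other one \<open>F'\<close>.\<close>
  have "\<exists>F F'. closed_in E (V - S) F \<and> closed_in E (V - S) F' \<and> F' = V - S - F \<and> F' \<noteq> {} \<and> A \<inter> F \<noteq> {}"
  proof (cases "A \<inter> D = {}")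
    case False then show ?thesis using D D' neq unfolding closed_in_def by blast
  next
    case True
    have "V - S - (V - S - D) = D" using D unfolding closed_in_def by blast
    moreover have "A \<inter> (V - S - D) \<noteq> {}" using True S(4) A unfolding fragment_def by blast
    ultimately show ?thesis using D D' by blast
  qed
  then obtain F F' where F: "closed_in E (V - S) F" "closed_in E (V - S) F'" "F' = V - S - F" "F' \<noteq> {}" "A \<inter> F \<noteq> {}"
    by blast
  define T where "T = nbhd A"
  define A' where "A' = V - A - T"
  have AV: "A \<subseteq> V" "A' \<noteq> {}" "card T = 4" using A unfolding fragment_def T_def A'_def by auto
  have TV: "T \<subseteq> V" "A \<inter> T = {}" unfolding T_def nbhd_def by auto
  have EA: "v \<in> A \<or> v \<in> T" if "E u v" "u \<in> A" for u v
    using that E_V2[OF that(1)] unfolding T_def nbhd_def by auto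
  have EF: "v \<in> F \<or> v \<in> S" if "E u v" "u \<in> F" for u v
    using that E_V2[OF that(1)] F(1) unfolding closed_in_def by auto
  have EF': "v \<in> F' \<or> v \<in> S" if "E u v" "u \<in> F'" for u v
    using that E_V2[OF that(1)] F(2) unfolding closed_in_def by auto
  have FV: "F \<subseteq> V - S" "F' \<subseteq> V - S" using F unfolding closed_in_def by auto
  have fin: "finite X" if "X \<subseteq> V" for X using that finV finite_subset by blast
  note finS = fin[OF S(1)] and finT = fin[OF TV(1)] and finA = fin[OF AV(1)]
  have cT: "card T = card (T \<inter> F) + card (T \<inter> S) + card (T \<inter> F')"
  proof -
    have "T = (T \<inter> F) \<union> (T \<inter> S) \<union> (T \<inter> F')" using TV F(3) by blast
    moreover have "(T \<inter> F) \<inter> (T \<inter> S) = {}" "((T \<inter> F) \<union> (T \<inter> S)) \<inter> (T \<inter> F') = {}" using FV F(3) by blast+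
    ultimately show ?thesis using finT by (metis card_Un_disjoint finite_Int finite_Un)
  qed
  have cS: "card S = card (S \<inter> A) + card (T \<inter> S) + card (S \<inter> A')"
  proof -
    have "S = (S \<inter> A) \<union> (T \<inter> S) \<union> (S \<inter> A')" using S(1) unfolding A'_def by blast
    moreover have "(S \<inter> A) \<inter> (T \<inter> S) = {}" "((S \<inter> A) \<union> (T \<inter> S)) \<inter> (S \<inter> A') = {}"
      using TV unfolding A'_def by blast+
    ultimately show ?thesis using finS by (metis card_Un_disjoint finite_Int finite_Un)
  qed
  have un3: "card (X \<union> Y \<union> Z) \<le> card X + card Y + card Z" for X Y Z :: "'a set"
    using card_Un_le[of "X \<union> Y" Z] card_Un_le[of X Y] by linarith
  let ?X = "A \<inter> F"
  have nX: "nbhd ?X \<subseteq> (T \<inter> F) \<union> (T \<inter> S) \<union> (S \<inter> A)"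
    using EA EF FV unfolding nbhd_def by blast
  \<comment> \<open>The corner \<open>A \<inter> F\<close> is smaller than \<open>A\<close>, since
    \<open>S\<close> meets \<open>A\<close>, so by minimality it is no fragment and has more than
    four neighbors.\<close>
  have X5: "5 \<le> card (nbhd ?X)"
  proof (rule ccontr)
    assume neg: "\<not> ?thesis"
    have ne: "V - ?X - nbhd ?X \<noteq> {}"
    proof -
      obtain a where a: "a \<in> A'" using AV by blast
      then have "a \<notin> nbhd ?X" using nX TV(2) unfolding A'_def by blast
      then show ?thesis using a unfolding A'_def by blast
    qed
    have "4 \<le> card (nbhd ?X)" by (rule nbhd_ge_4[OF F(5) _ ne]) (use AV in blast)
    then have "fragment ?X" using neg F(5) AV ne unfolding fragment_def by auto
    then have "card A \<le> card ?X" by (rule min)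
    moreover have "?X \<subset> A" using S(3) FV by blast
    ultimately show False using psubset_card_mono[OF finA, of ?X] by linarith
  qed
  have "card (nbhd ?X) \<le> card (T \<inter> F) + card (T \<inter> S) + card (S \<inter> A)"
    by (rule order_trans[OF card_mono[OF _ nX] un3]) (use finT finS in auto)
  then have i1: "card (T \<inter> F') < card (S \<inter> A)" using X5 cT AV(3) by linarith
  \<comment> \<open>If the opposite corner is nonempty, the bound on its neighborhood now falls
    below four. If it is empty, \<open>F'\<close> is a fragment smaller than
    \<open>A\<close>.\<close>
  show False
  proof (cases "A' \<inter> F' = {}")
    case False
    let ?Y = "A' \<inter> F'"
    have nY: "nbhd ?Y \<subseteq> (T \<inter> F') \<union> (T \<inter> S) \<union> (S \<inter> A')"
    proof
      fix v assume "v \<in> nbhd ?Y"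
      then obtain u where u: "u \<in> A'" "u \<in> F'" "E u v" "v \<in> V" "v \<notin> ?Y" unfolding nbhd_def by blast
      have "v \<in> F' \<or> v \<in> S" using EF' u by blast
      moreover have "v \<notin> A" using EA[OF E_sym[OF u(3)]] u(1) unfolding A'_def by blast
      ultimately show "v \<in> (T \<inter> F') \<union> (T \<inter> S) \<union> (S \<inter> A')" using u unfolding A'_def by blast
    qed
    have ne: "V - ?Y - nbhd ?Y \<noteq> {}"
    proof -
      obtain a where a: "a \<in> ?X" using F(5) by blast
      then have "a \<notin> nbhd ?Y" "a \<notin> ?Y" "a \<in> V" using nY TV(2) FV F(3) AV unfolding A'_def by blast+
      then show ?thesis by blast
    qed
    have "4 \<le> card (nbhd ?Y)" by (rule nbhd_ge_4[OF False _ ne]) (use FV in blast)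
    also have "\<dots> \<le> card (T \<inter> F') + card (T \<inter> S) + card (S \<inter> A')"
      by (rule order_trans[OF card_mono[OF _ nY] un3]) (use finT finS in auto)
    finally show False using i1 cS S(2) by linarith
  next
    case True
    have sub: "F' \<subseteq> (A \<inter> F') \<union> (T \<inter> F')" using True FV unfolding A'_def by blast
    have "card F' \<le> card (A \<inter> F') + card (T \<inter> F')"
      by (rule order_trans[OF card_mono[OF _ sub] card_Un_le]) (use finA finT in auto)
    also have "\<dots> < card (A \<inter> F') + card (S \<inter> A)" using i1 by simp
    also have "\<dots> = card ((A \<inter> F') \<union> (S \<inter> A))"
      by (rule card_Un_disjoint[symmetric]) (use finA finS FV in auto)
    also have "\<dots> \<le> card A" by (rule card_mono[OF finA]) auto
    finally have less: "card F' < card A" .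
    have nF: "nbhd F' \<subseteq> S" using EF' unfolding nbhd_def by blast
    have ne: "V - F' - nbhd F' \<noteq> {}"
    proof -
      obtain a where "a \<in> F" using F(5) by blast
      then have "a \<in> V" "a \<notin> F'" "a \<notin> nbhd F'" using FV nF F(3) by blast+
      then show ?thesis by blast
    qed
    have "4 \<le> card (nbhd F')" by (rule nbhd_ge_4[OF F(4) _ ne]) (use FV in blast)
    moreover have "card (nbhd F') \<le> 4" using card_mono[OF finS nF] S(2) by simp
    ultimately have "fragment F'" using F(4) FV ne unfolding fragment_def by auto
    then show False using min[of F'] less by linarith
  qed
qed

text \<open>Without fragments any \<open>w\<close> does. For \<open>w\<close> in a smallest fragment
  \<open>A\<close>, four neighbors of \<open>w\<close> can separate the graph only if they avoid
  \<open>A\<close>, that is, if they are the neighborhood \<open>T\<close> of \<open>A\<close>. So a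
  vertex of \<open>A\<close> not adjacent to all of \<open>T\<close> serves; otherwise all of
  \<open>A\<close> is joined to all of \<open>T\<close>.\<close>

lemma vertex_with_linked_disjoint_pairs:
  assumes nocl: "\<And>Q. Q \<subseteq> V \<Longrightarrow> card Q = k - 1 \<Longrightarrow> \<exists>u \<in> Q. \<exists>v \<in> Q. u \<noteq> v \<and> \<not> E u v"
  shows "\<exists>w \<in> V. \<forall>x y a b. E w x \<longrightarrow> E w y \<longrightarrow> E w a \<longrightarrow> E w b \<longrightarrow> x \<noteq> y \<longrightarrow> \<not> E x y \<longrightarrow> a \<noteq> b \<longrightarrow> \<not> E a b \<longrightarrow>
    x \<noteq> a \<longrightarrow> x \<noteq> b \<longrightarrow> y \<noteq> a \<longrightarrow> y \<noteq> b \<longrightarrow> lk (Same x y) (Same a b)"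
proof (cases "\<exists>A. fragment A")
  case False
  have D: "D = V - S" if "S \<subseteq> V" "card S = 4" "D \<noteq> {}" "closed_in E (V - S) D" for S D
  proof (rule ccontr)
    assume neq: "D \<noteq> V - S"
    have sub: "nbhd D \<subseteq> S" using that unfolding nbhd_def closed_in_def by blast
    have ne: "V - D - nbhd D \<noteq> {}" using neq sub that unfolding closed_in_def by blast
    have DV: "D \<subseteq> V" using that unfolding closed_in_def by blast
    have "4 \<le> card (nbhd D)" by (rule nbhd_ge_4[OF that(3) DV ne])
    moreover have "card (nbhd D) \<le> 4" using card_mono[OF _ sub] that finV finite_subset by metis
    ultimately have "fragment D" using that DV ne unfolding fragment_def by auto
    then show False using False by blast
  qed
  have "V \<noteq> {}" using big by auto
  then obtain w where w: "w \<in> V" by blast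
  show ?thesis
  proof (intro bexI[OF _ w] allI impI)
    fix x y a b assume *: "E w x" "E w y" "E w a" "E w b" "x \<noteq> y" "\<not> E x y" "a \<noteq> b" "\<not> E a b"
      "x \<noteq> a" "x \<noteq> b" "y \<noteq> a" "y \<noteq> b"
    have "{x, y, a, b} \<subseteq> V" "card {x, y, a, b} = 4" "w \<notin> {x, y, a, b}" using * E_V2 E_irr by auto
    then show "lk (Same x y) (Same a b)" using D w * by (intro lk_disjoint_pairs[of w]) blast+
  qed
next
  case True
  then obtain A where A: "fragment A" and min: "\<And>B. fragment B \<Longrightarrow> card A \<le> card B"
    using exists_least_iff[of "\<lambda>n. \<exists>A. fragment A \<and> card A = n"] by (metis not_le)
  define T where "T = nbhd A"
  have AV: "A \<subseteq> V" "A \<noteq> {}" "card T = 4" using A unfolding fragment_def T_def by auto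
  have finT: "finite T" unfolding T_def by (rule finite_nbhd)
  have nbA: "u \<in> A \<or> u \<in> T" if "E w u" "w \<in> A" for u w
    using that E_V2[OF that(1)] unfolding T_def nbhd_def by auto
  have link: "lk (Same x y) (Same a b)"
    if w: "w \<in> A" and *: "E w x" "E w y" "E w a" "E w b" "x \<noteq> y" "\<not> E x y" "a \<noteq> b" "\<not> E a b"
      "x \<noteq> a" "x \<noteq> b" "y \<noteq> a" "y \<noteq> b" and neT: "{x, y, a, b} \<noteq> T" for w x y a b
  proof (rule lk_disjoint_pairs[OF *])
    let ?S = "{x, y, a, b}"
    fix D assume D: "D \<noteq> {}" "closed_in E (V - ?S) D"
    have S: "?S \<subseteq> V" "card ?S = 4" "w \<notin> ?S" using * E_V2 E_irr by auto
    have "?S \<inter> A \<noteq> {}"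
    proof
      assume "?S \<inter> A = {}"
      then have "?S \<subseteq> T" using nbA[OF _ w] * by blast
      then show False using card_subset_eq[OF finT] S AV neT by metis
    qed
    moreover have "\<not> A \<subseteq> ?S" using w S by blast
    ultimately have "D = V - ?S" using smallest_fragment_uncross[OF A min S(1,2) _ _ D(2,1)] by blast
    then show "w \<in> D" using w S AV by blast
  qed
  show ?thesis
  proof (cases "\<exists>w \<in> A. \<not> T \<subseteq> N w")
    case True
    then obtain w where w: "w \<in> A" "\<not> T \<subseteq> N w" by blast
    show ?thesis
    proof (intro bexI[of _ w] allI impI)
      fix x y a b assume *: "E w x" "E w y" "E w a" "E w b" "x \<noteq> y" "\<not> E x y" "a \<noteq> b" "\<not> E a b"
        "x \<noteq> a" "x \<noteq> b" "y \<noteq> a" "y \<noteq> b"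
      have "{x, y, a, b} \<noteq> T" using w(2) * mem_N by blast
      then show "lk (Same x y) (Same a b)" using link[OF w(1) *] by blast
    qed (use w AV in auto)
  next
    case allT: False
    obtain w where w: "w \<in> A" using AV by blast
    have wV: "w \<in> V" using w AV by blast
    have TN: "E u t" if "u \<in> A" "t \<in> T" for u t using allT that mem_N by blast
    show ?thesis
    proof (intro bexI[OF _ wV] allI impI)
      fix x y a b assume *: "E w x" "E w y" "E w a" "E w b" "x \<noteq> y" "\<not> E x y" "a \<noteq> b" "\<not> E a b"
        "x \<noteq> a" "x \<noteq> b" "y \<noteq> a" "y \<noteq> b"
      show "lk (Same x y) (Same a b)"
      proof (cases "{x, y, a, b} = T")
        case False then show ?thesis using link[OF w *] by blast
      next
        case eqT: True
        have disj: "A \<inter> T = {}" unfolding T_def nbhd_def by auto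
        show ?thesis
        proof (cases "\<exists>g h. g \<in> A \<and> h \<in> A \<and> E w g \<and> E w h \<and> g \<noteq> h \<and> \<not> E g h")
          \<comment> \<open>A nonadjacent pair of neighbors in \<open>A\<close> is disjoint from
            both pairs in \<open>T\<close> and forms with either of them a set other than
            \<open>T\<close>.\<close>
          case True
          then obtain g h where g: "g \<in> A" "h \<in> A" "E w g" "E w h" "g \<noteq> h" "\<not> E g h" by blast
          have "g \<notin> T" "h \<notin> T" using g disj by auto
          then have n: "x \<noteq> g" "x \<noteq> h" "y \<noteq> g" "y \<noteq> h" "a \<noteq> g" "a \<noteq> h" "b \<noteq> g" "b \<noteq> h" using eqT by blast+
          have "{x, y, g, h} \<noteq> T" "{a, b, g, h} \<noteq> T" using \<open>g \<notin> T\<close> by blast+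
          then have 1: "lk (Same x y) (Same g h)" and 2: "lk (Same a b) (Same g h)"
            using link[OF w *(1,2) g(3,4) *(5,6) g(5,6)] link[OF w *(3,4) g(3,4) *(7,8) g(5,6)] n by auto
          show ?thesis using lk_trans2[OF 1 dist2I[OF g(3-6)] lk_sym[OF 2]] .
        next
          case False
          \<comment> \<open>Now \<open>w\<close> and its \<open>k - 4\<close> neighbors in
            \<open>A\<close> form a clique joined to \<open>T\<close>. An edge inside
            \<open>T\<close> would enlarge it to \<open>k - 1\<close> vertices, so \<open>T\<close>
            is independent and triples link the two pairs.\<close>
          have Nw: "N w = T \<union> (N w \<inter> A)" using nbA[OF _ w] TN[OF w] mem_N by blast
          have "card (N w) = card T + card (N w \<inter> A)"
            by (subst Nw, rule card_Un_disjoint) (use finT disj in auto)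
          then have c: "card (N w \<inter> A) = k - 4" using reg[OF wV] AV(3) by simp
          have indep: "\<not> E u v" if uv: "u \<in> T" "v \<in> T" "u \<noteq> v" for u v
          proof
            assume e: "E u v"
            let ?Q = "insert u (insert v (insert w (N w \<inter> A)))"
            have nin: "w \<notin> N w \<inter> A" "v \<notin> insert w (N w \<inter> A)" "u \<notin> insert v (insert w (N w \<inter> A))"
              using disj uv w mem_N E_irr by auto
            then have cQ: "card ?Q = k - 1" using c k_ge_4 by simp
            have QV: "?Q \<subseteq> V" using wV E_V[OF e] E_V2[OF e] AV(1) by auto
            from nocl[OF QV cQ] obtain p q where pq: "p \<in> ?Q" "q \<in> ?Q" "p \<noteq> q" "\<not> E p q" by blast
            have "E p q" if pqA: "p \<in> insert w (N w \<inter> A)" "q \<in> insert w (N w \<inter> A)"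
            proof -
              consider "p = w" "E w q" | "q = w" "E w p" | "p \<in> A" "q \<in> A" "E w p" "E w q"
                using pqA pq(3) mem_N by blast
              then show ?thesis using False pq(3) E_sym by cases blast+
            qed
            then have "p \<in> {u, v} \<or> q \<in> {u, v}" using pq by blast
            moreover have "insert w (N w \<inter> A) \<subseteq> A" using w by auto
            ultimately show False using pq TN uv e E_sym by blast
          qed
          have T: "x \<in> T" "y \<in> T" "a \<in> T" "b \<in> T" using eqT by auto
          have xa: "\<not> E x a" "\<not> E y a" "\<not> E x b" using indep T * by auto
          have 1: "lk (Same x y) (Same x a)"
            using lk_triple[OF dist2I[OF *(1,2)] dist2I[OF *(1,3)]] * xa by auto
          have 2: "lk (Same a x) (Same a b)"
            using lk_triple[OF dist2I[OF *(3,1)] dist2I[OF *(3,4)]] * xa E_sym by blast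
          show ?thesis
            using lk_trans2[OF 1 dist2I[OF *(1,3)]] 2 * xa Same_sym[of a x] by auto
        qed
      qed
    qed
  qed
qed

text \<open>Disjoint pairs are linked already. The obstacle is two pairs \<open>x\<close>,
  \<open>y\<close> and \<open>x\<close>, \<open>z\<close> with \<open>y\<close> adjacent to
  \<open>z\<close>, which are never monochromatic together.\<close>

lemma swap_conn_no_large_clique:
  assumes nocl: "\<And>Q. Q \<subseteq> V \<Longrightarrow> card Q = k - 1 \<Longrightarrow> \<exists>u \<in> Q. \<exists>v \<in> Q. u \<noteq> v \<and> \<not> E u v"
  shows swap_conn
proof -
  obtain w where w: "w \<in> V" and DJ: "\<And>x y a b. E w x \<Longrightarrow> E w y \<Longrightarrow> E w a \<Longrightarrow> E w b \<Longrightarrow> x \<noteq> y \<Longrightarrow> \<not> E x y \<Longrightarrow>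
    a \<noteq> b \<Longrightarrow> \<not> E a b \<Longrightarrow> x \<noteq> a \<Longrightarrow> x \<noteq> b \<Longrightarrow> y \<noteq> a \<Longrightarrow> y \<noteq> b \<Longrightarrow> lk (Same x y) (Same a b)"
    using vertex_with_linked_disjoint_pairs[OF nocl] by blast
  \<comment> \<open>\<open>w\<close> with all but two of its neighbors has \<open>k - 1\<close>
    vertices, so it is no clique.\<close>
  have avoid: "\<exists>g h. E w g \<and> E w h \<and> g \<noteq> h \<and> \<not> E g h \<and> g \<noteq> u \<and> g \<noteq> v \<and> h \<noteq> u \<and> h \<noteq> v"
    if uv: "E w u" "E w v" "u \<noteq> v" for u v
  proof -
    let ?Q = "insert w (N w - {u, v})"
    have "card (N w - {u, v}) = k - 2" using uv mem_N reg[OF w] by (simp add: card_Diff_subset)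
    moreover have "w \<notin> N w - {u, v}" using mem_N E_irr by auto
    ultimately have cQ: "card ?Q = k - 1" using k_ge_4 by simp
    have QV: "?Q \<subseteq> V" using w unfolding nb_def by auto
    from nocl[OF QV cQ] obtain p q where pq: "p \<in> ?Q" "q \<in> ?Q" "p \<noteq> q" "\<not> E p q" by blast
    then have "p \<noteq> w" "q \<noteq> w" using mem_N E_sym by auto
    then show ?thesis using pq mem_N by blast
  qed
  have share: "lk (Same x y) (Same x z)"
    if *: "E w x" "E w y" "E w z" "x \<noteq> y" "\<not> E x y" "x \<noteq> z" "\<not> E x z" for x y z
  proof (cases "y = z \<or> \<not> E y z")
    case True
    then show ?thesis using lk_Same lk_triple dist2I[OF *(1,2,4,5)] dist2I[OF *(1,3,6,7)] by blast
  next
    case False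
    have yz: "y \<noteq> z" "E y z" using False by auto
    have via: "lk (Same x y) (Same x z)"
      if g: "E w g" "E w h" "g \<noteq> h" "\<not> E g h" "g \<notin> {x, y, z}" "h \<notin> {x, y, z}" for g h
    proof -
      have "lk (Same x y) (Same g h)" "lk (Same x z) (Same g h)" using DJ g * by auto
      then show ?thesis using lk_trans2[OF _ dist2I[OF g(1-4)]] lk_sym by blast
    qed
    show ?thesis
    proof (rule ccontr)
      assume no: "\<not> ?thesis"
      \<comment> \<open>Every nonadjacent pair now meets \<open>{x, y, z}\<close>. Avoiding two of
        these vertices yields a partner for the third: \<open>u\<close> for \<open>z\<close>,
        \<open>v\<close> for \<open>y\<close>, \<open>s\<close> for \<open>x\<close>. Chains of
        disjoint pairs then exist unless all three partners coincide, where triples help.\<close>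
      obtain u where u: "E w u" "u \<noteq> x" "u \<noteq> y" "u \<noteq> z" "\<not> E z u"
        using avoid[OF *(1,2,4)] via no E_sym by blast
      obtain v where v: "E w v" "v \<noteq> x" "v \<noteq> y" "v \<noteq> z" "\<not> E y v"
        using avoid[OF *(1,3,6)] via no E_sym by blast
      obtain s where s: "E w s" "s \<noteq> x" "s \<noteq> y" "s \<noteq> z" "\<not> E x s"
        using avoid[OF *(2,3) yz(1)] via no E_sym by blast
      have d: "dist2 z u" "dist2 y v" "dist2 x s" using dist2I * u v s by auto
      have 1: "lk (Same x y) (Same z u)" using DJ[OF *(1,2,3) u(1)] * u yz by auto
      have 2: "lk (Same y v) (Same x z)" using DJ[OF *(2) v(1) *(1,3)] * v yz by auto
      show False
      proof (cases "u = v")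
        case False
        have "lk (Same z u) (Same y v)" using DJ[OF *(3) u(1) *(2) v(1)] * u v yz False by auto
        then show False using no lk_trans2[OF 1 d(1)] lk_trans2[OF _ d(2) 2] by blast
      next
        case uv: True
        show False
        proof (cases "s = u")
          case False
          have "lk (Same z u) (Same x s)" using DJ[OF *(3) u(1) *(1) s(1)] * u s False by auto
          moreover have "lk (Same x s) (Same y v)" using DJ[OF *(1) s(1) *(2) v(1)] * v s False uv by auto
          ultimately show False using no lk_trans2[OF 1 d(1)] lk_trans2[OF _ d(2) 2] lk_trans2[OF _ d(3)] by blast
        next
          case True
          have "lk (Same x y) (Same x s)" using lk_triple[OF dist2I[OF *(1,2,4,5)] d(3)] v uv True by auto
          moreover have "lk (Same x s) (Same x z)" using lk_triple[OF d(3) dist2I[OF *(1,3,6,7)]] u True E_sym by blast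
          ultimately show False using no lk_trans2[OF _ d(3)] by blast
        qed
      qed
    qed
  qed
  show ?thesis
  proof (rule finish_pairs[OF w])
    fix x y a b assume *: "E w x" "E w y" "x \<noteq> y" "\<not> E x y" "E w a" "E w b" "a \<noteq> b" "\<not> E a b"
    have r: "\<not> E y x" "\<not> E b a" using * E_sym by blast+
    consider "x = a" | "x = b" | "y = a" | "y = b" | "x \<noteq> a" "x \<noteq> b" "y \<noteq> a" "y \<noteq> b" by blast
    then show "lk (Same x y) (Same a b)"
    proof cases
      case 1 then show ?thesis using share[of x y b] * by auto
    next
      case 2 then show ?thesis using share[of x y a] * r Same_sym[of a b] by auto
    next
      case 3 then show ?thesis using share[of y x b] * r Same_sym[of x y] by auto
    next
      case 4 then show ?thesis using share[of y x a] * r Same_sym[of x y] Same_sym[of a b] by auto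
    next
      case 5 then show ?thesis using DJ * by auto
    qed
  qed
qed

end

section \<open>A clique on k - 1 vertices for k at least 5\<close>

locale near_clique = conn4const +
  fixes Q :: "'a set"
  assumes k5: "5 \<le> k"
    and QV: "Q \<subseteq> V" and cardQ: "card Q = k - 1"
    and clQ: "u \<in> Q \<Longrightarrow> v \<in> Q \<Longrightarrow> u \<noteq> v \<Longrightarrow> E u v"
    and no_clique_k: "Q' \<subseteq> V \<Longrightarrow> card Q' = k \<Longrightarrow> \<exists>u \<in> Q'. \<exists>v \<in> Q'. u \<noteq> v \<and> \<not> E u v"
begin

lemma finQ: "finite Q"
  using QV finV finite_subset by blast

lemma card_out: "q \<in> Q \<Longrightarrow> card (N q - Q) = 2"
  using card_outside_clique[OF QV clQ, of q] cardQ k5 by simp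

lemma nonneighbor_in_Q:
  assumes "t \<in> V - Q"
  shows "\<exists>p \<in> Q. \<not> E t p"
proof (rule ccontr)
  assume neg: "\<not> ?thesis"
  have Q': "insert t Q \<subseteq> V" "card (insert t Q) = k" using assms QV finQ cardQ k5 by auto
  from no_clique_k[OF Q'] obtain u v where "u \<in> insert t Q" "v \<in> insert t Q" "u \<noteq> v" "\<not> E u v" by blast
  then show False using neg clQ E_sym by blast
qed

lemma dist2Q:
  assumes "t \<in> V - Q" "q0 \<in> Q" "E q0 t" "p \<in> Q" "\<not> E t p"
  shows "dist2 t p"
proof -
  have "p \<noteq> q0" using assms E_sym by blast
  then show ?thesis using dist2I[OF assms(3) clQ[OF assms(2,4)]] assms by auto
qed

text \<open>\<open>w\<close> sees \<open>\<alpha>\<close> at its outer neighbor \<open>x\<close> and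
  at \<open>q\<close>, which suffices since the uncolored rest of \<open>Q\<close> is a
  clique.\<close>

lemma complete_on_Q:
  assumes g: "proper_on E (V - Q) (\<lambda>_. C) g"
    and q: "q \<in> Q" "r \<in> Q" "q \<noteq> r" and c: "\<alpha> \<in> C" "\<beta> \<in> C" "\<alpha> \<noteq> \<beta>"
    and a: "\<And>u. E q u \<Longrightarrow> u \<notin> Q \<Longrightarrow> g u \<noteq> \<alpha>" and b: "\<And>u. E r u \<Longrightarrow> u \<notin> Q \<Longrightarrow> g u \<noteq> \<beta>"
    and w: "w \<in> Q" "w \<noteq> q" "w \<noteq> r" "E w x" "x \<notin> Q" "g x = \<alpha>"
  shows "\<exists>F. Col F \<and> (\<forall>v \<in> V - Q. F v = g v) \<and> F q = \<alpha> \<and> F r = \<beta>"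
proof -
  let ?P = "insert r (insert q (V - Q))"
  let ?h = "g(q := \<alpha>, r := \<beta>)"
  have xV: "x \<in> V" using E_V2[OF w(4)] .
  have 1: "proper_on E (insert q (V - Q)) (\<lambda>_. C) (g(q := \<alpha>))"
  proof (rule proper_on_insert[OF g c(1)])
    show "g u \<noteq> \<alpha>" if "u \<in> V - Q" "E q u" for u using a that by auto
  qed
  have 2: "proper_on E ?P (\<lambda>_. C) ?h"
  proof (rule proper_on_insert[OF 1 c(2)])
    show "(g(q := \<alpha>)) u \<noteq> \<beta>" if "u \<in> insert q (V - Q)" "E r u" for u using b that c by auto
  qed
  have "\<exists>F. Col F \<and> (\<forall>v \<in> ?P. F v = ?h v)"
  proof (rule extend_clique[OF _ 2, where w = w and x = x and y = q])
    show "E u v" if "u \<in> V - ?P" "v \<in> V - ?P" "u \<noteq> v" for u v using clQ that by auto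
    show "E w q" using clQ[OF w(1) q(1) w(2)] .
    show "?h x = ?h q" using w q by auto
  qed (use QV q w xV in auto)
  then obtain F where F: "Col F" "\<forall>v \<in> ?P. F v = ?h v" by blast
  have "F v = g v" if "v \<in> V - Q" for v
  proof -
    have "v \<noteq> q" "v \<noteq> r" using that q by auto
    then show ?thesis using F(2) that by auto
  qed
  moreover have "F q = \<alpha>" "F r = \<beta>" using F(2) q(3) by auto
  ultimately show ?thesis using F(1) by blast
qed

text \<open>This is where \<open>5 \<le> k\<close> matters: for \<open>k = 4\<close> the clique is a
  triangle and might consist of the three given vertices.\<close>

lemma fourth_in_Q: "\<exists>p \<in> Q. p \<noteq> a \<and> p \<noteq> b \<and> p \<noteq> c"
proof -
  have "card {a, b, c} \<le> 3" by (auto simp: card_insert_if)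
  then have "\<not> Q \<subseteq> {a, b, c}" using card_mono[of "{a, b, c}" Q] cardQ k5 by auto
  then show ?thesis by blast
qed

text \<open>The color \<open>c1\<close> of \<open>x\<close> is reserved for \<open>q\<close> and
  \<open>q'\<close>. If a second color is free at both, \<open>q\<close> and \<open>q'\<close> get
  these two colors and an edge swap exchanges them. Otherwise all other colors appear on outer
  neighbors of \<open>q\<close> and \<open>q'\<close>, so a color \<open>c\<close> free at a further
  clique vertex \<open>r\<close> occurs at such a neighbor \<open>t\<close> not adjacent to
  \<open>r\<close>. The pair \<open>t\<close>, \<open>r\<close> is then monochromatic both in a
  coloring with \<open>c1\<close> at \<open>q\<close> and in one with \<open>c1\<close> at
  \<open>q'\<close>.\<close>

lemma lk_same_outer_vertex:
  assumes x: "x \<notin> Q" "w \<in> Q" "E w x" and q: "q \<in> Q" "\<not> E x q" "q' \<in> Q" "\<not> E x q'"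
  shows "lk (Same x q) (Same x q')"
proof (cases "q = q'")
  case True
  then show ?thesis using lk_Same[OF dist2Q[OF _ x(2,3) q(1,2)]] x E_V2 by auto
next
  case qq: False
  have xV: "x \<in> V - Q" using x E_V2 by auto
  have qw: "w \<noteq> q" "w \<noteq> q'" using q E_sym[OF x(3)] by auto
  have d: "dist2 x q" "dist2 x q'" using dist2Q[OF xV x(2,3)] q by auto
  obtain c1 where c1: "c1 \<in> C" using four_colors by blast
  have "\<exists>g. proper_on E (V - Q) (\<lambda>_. C) g \<and> (\<forall>v \<in> {x}. g v = (\<lambda>_. c1) v) \<and>
      (\<forall>v \<in> V - Q - {x}. \<forall>y \<in> {q, q'}. E v y \<longrightarrow> g v \<noteq> (\<lambda>_. c1) y)"
  proof (rule extend_partial_small[where r = w])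
    show "proper_on E {x} (\<lambda>_. C) (\<lambda>_. c1)" using c1 E_irr unfolding proper_on_def by auto
    show "card ({x} \<union> {q, q'}) < 4" by (auto simp: card_insert_if)
  qed (use x xV q QV qw in auto)
  then obtain g where g: "proper_on E (V - Q) (\<lambda>_. C) g" "g x = c1"
    and av: "\<And>v y. v \<in> V - Q - {x} \<Longrightarrow> y \<in> {q, q'} \<Longrightarrow> E v y \<Longrightarrow> g v \<noteq> c1" by auto
  have a: "g u \<noteq> c1" if "E q u" "u \<notin> Q" for u using av[of u q] that E_V2[OF that(1)] E_sym[OF that(1)] q(2) by auto
  have a': "g u \<noteq> c1" if "E q' u" "u \<notin> Q" for u using av[of u q'] that E_V2[OF that(1)] E_sym[OF that(1)] q(4) by auto
  show ?thesis
  proof (cases "\<exists>\<beta> \<in> C. \<beta> \<noteq> c1 \<and> \<beta> \<notin> g ` ((N q - Q) \<union> (N q' - Q))")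
    case True
    then obtain \<beta> where b: "\<beta> \<in> C" "\<beta> \<noteq> c1" "\<beta> \<notin> g ` ((N q - Q) \<union> (N q' - Q))" by blast
    have bq: "g u \<noteq> \<beta>" if "E q u" "u \<notin> Q" for u using b(3) that mem_N by blast
    have bq': "g u \<noteq> \<beta>" if "E q' u" "u \<notin> Q" for u using b(3) that mem_N by blast
    obtain F where F: "Col F" "\<forall>v \<in> V - Q. F v = g v" "F q = c1" "F q' = \<beta>"
      using complete_on_Q[OF g(1) q(1,3) qq c1 b(1) _ a bq' x(2) qw x(3,1) g(2)] b(2) by blast
    have eq: "E q q'" using clQ q qq by auto
    have n1: "F u \<noteq> F q'" if u: "E q u" "u \<noteq> q'" for u
    proof (cases "u \<in> Q")
      case True then show ?thesis using proper_onD[OF F(1) _ _ clQ[OF True q(3) u(2)]] QV q by auto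
    next
      case False then show ?thesis using F(2,4) bq[OF u(1)] E_V2[OF u(1)] by auto
    qed
    have n2: "F u \<noteq> F q" if u: "E q' u" "u \<noteq> q" for u
    proof (cases "u \<in> Q")
      case True then show ?thesis using proper_onD[OF F(1) _ _ clQ[OF True q(1) u(2)]] QV q by auto
    next
      case False then show ?thesis using F(2,3) a'[OF u(1)] E_V2[OF u(1)] by auto
    qed
    have "x \<noteq> q" "x \<noteq> q'" using x q by auto
    then show ?thesis
      by (intro lk_if_eqv[OF d F(1) swap_edge[OF F(1) eq n1 n2]]) (use F xV g in auto)
  next
    case False
    obtain r where r: "r \<in> Q" "r \<noteq> q" "r \<noteq> q'" "r \<noteq> w" using fourth_in_Q by blast
    \<comment> \<open>The two outer neighbors of \<open>r\<close> cannot carry all the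
      \<open>k - 1\<close> colors other than \<open>c1\<close>.\<close>
    have "\<not> C - {c1} \<subseteq> g ` (N r - Q)"
    proof
      assume "C - {c1} \<subseteq> g ` (N r - Q)"
      then have "card (C - {c1}) \<le> card (g ` (N r - Q))" by (intro card_mono) auto
      also have "\<dots> \<le> 2" using card_image_le[of "N r - Q" g] card_out[OF r(1)] by simp
      finally show False using c1 finC cardC k5 by simp
    qed
    then obtain c where c: "c \<in> C" "c \<noteq> c1" "c \<notin> g ` (N r - Q)" by blast
    then obtain t where t: "t \<in> (N q - Q) \<union> (N q' - Q)" "g t = c" using False by blast
    have tV: "t \<in> V - Q" using t unfolding nb_def by auto
    have tr: "\<not> E t r" using c(3) t(2) tV mem_N E_sym by blast
    obtain q0 where "q0 \<in> Q" "E q0 t" using t q mem_N by blast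
    then have dt: "dist2 t r" using dist2Q[OF tV _ _ r(1) tr] by blast
    have cr: "g u \<noteq> c" if "E r u" "u \<notin> Q" for u using c(3) that mem_N by blast
    have rw: "w \<noteq> r" using r by auto
    obtain F where F: "Col F" "\<forall>v \<in> V - Q. F v = g v" "F q = c1" "F r = c"
      using complete_on_Q[OF g(1) q(1) r(1) _ c1 c(1) _ a cr x(2) qw(1) rw x(3,1) g(2)] r c(2) by metis
    obtain F' where F': "Col F'" "\<forall>v \<in> V - Q. F' v = g v" "F' q' = c1" "F' r = c"
      using complete_on_Q[OF g(1) q(3) r(1) _ c1 c(1) _ a' cr x(2) qw(2) rw x(3,1) g(2)] r c(2) by metis
    have "lk (Same x q) (Same t r)" using lk_if_common[OF d(1) dt F(1)] F xV tV t g by auto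
    moreover have "lk (Same t r) (Same x q')" using lk_if_common[OF dt d(2) F'(1)] F' xV tV t g by auto
    ultimately show ?thesis using lk_trans2 dt by blast
  qed
qed

text \<open>Coloring the outside of \<open>Q\<close> first, with colors only reserved at
  \<open>q\<close> and \<open>p\<close>, gives slack to every component that has another neighbor in
  \<open>Q\<close>. The hypothesis \<open>D\<close> excludes all other components.\<close>

lemma lk_two_outer_vertices:
  assumes x: "x \<in> V - Q" "w \<in> Q" "E w x" and t: "t \<in> V - Q" "q0 \<in> Q" "E q0 t" "x \<noteq> t"
    and q: "q \<in> Q" "\<not> E x q" "p \<in> Q" "\<not> E t p" "q \<noteq> p" "w \<noteq> p"
    and D: "\<And>D. D \<noteq> {} \<Longrightarrow> D \<subseteq> V - Q \<Longrightarrow> closed_in E (V - {x, t, q, p}) D \<Longrightarrow> False"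
  shows "lk (Same x q) (Same t p)"
proof -
  obtain c1 c2 c3 c4 where c: "c1 \<in> C" "c2 \<in> C" "c1 \<noteq> c2" using four_colors by metis
  have qw: "w \<noteq> q" using q E_sym[OF x(3)] by auto
  let ?f = "\<lambda>z. if z = x \<or> z = q then c1 else c2"
  have ne: "x \<noteq> q" "x \<noteq> p" "t \<noteq> q" "t \<noteq> p" using x t q by auto
  have "\<exists>g. proper_on E (V - Q) (\<lambda>_. C) g \<and> (\<forall>v \<in> {x, t}. g v = ?f v) \<and>
      (\<forall>v \<in> V - Q - {x, t}. \<forall>y \<in> {q, p}. E v y \<longrightarrow> g v \<noteq> ?f y)"
  proof (rule extend_partial)
    show "proper_on E {x, t} (\<lambda>_. C) ?f" using c t ne E_irr unfolding proper_on_def by auto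
    fix D' assume D': "D' \<noteq> {}" "closed_in E (V - Q - {x, t}) D'"
    show "\<exists>v \<in> D'. sur ({x, t} \<union> {q, p}) ?f v \<or> (\<exists>r \<in> V - (V - Q) - {q, p}. E v r)"
    proof (rule ccontr)
      assume neg: "\<not> ?thesis"
      have "closed_in E (V - {x, t, q, p}) D'"
        using D'(2) neg q QV unfolding closed_in_def by blast
      moreover have "D' \<subseteq> V - Q" using D'(2) unfolding closed_in_def by blast
      ultimately show False using D D'(1) by blast
    qed
  qed (use x t q QV in auto)
  then obtain g where g0: "proper_on E (V - Q) (\<lambda>_. C) g" "\<forall>v \<in> {x, t}. g v = ?f v"
    and av0: "\<forall>v \<in> V - Q - {x, t}. \<forall>y \<in> {q, p}. E v y \<longrightarrow> g v \<noteq> ?f y" by blast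
  have g: "proper_on E (V - Q) (\<lambda>_. C) g" "g x = c1" "g t = c2" using g0 t ne by auto
  have av: "g v \<noteq> ?f y" if "v \<in> V - Q - {x, t}" "y \<in> {q, p}" "E v y" for v y using av0 that by blast
  have a: "g u \<noteq> c1" if "E q u" "u \<notin> Q" for u
    using av[of u q] that E_V2[OF that(1)] E_sym[OF that(1)] q g c by (cases "u = t") auto
  have b: "g u \<noteq> c2" if "E p u" "u \<notin> Q" for u
    using av[of u p] that E_V2[OF that(1)] E_sym[OF that(1)] q g c ne by (cases "u = x") auto
  obtain F where F: "Col F" "\<forall>v \<in> V - Q. F v = g v" "F q = c1" "F p = c2"
    using complete_on_Q[OF g(1) q(1,3,5) c a b x(2) qw q(6) x(3) _ g(2)] x by blast
  show ?thesis
    using lk_if_common[OF dist2Q[OF x q(1,2)] dist2Q[OF t(1-3) q(3,4)] F(1)] F x t g by auto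
qed

text \<open>A component that obstructs the pairs \<open>{x, q}\<close> and \<open>{a, q'}\<close> contains a vertex \<open>t\<close> whose pairs
  with a further clique vertex \<open>p\<close> are not obstructed.\<close>

lemma no_second_obstruction:
  assumes wQ: "w \<in> Q" "E w a" "w \<noteq> q" "w \<noteq> q'"
    and q: "q \<in> Q" "q' \<in> Q" and p: "p \<in> Q" "p \<noteq> q" "p \<noteq> q'" "p \<noteq> w"
    and out: "x \<in> V - Q" "a \<in> V - Q"
    and D: "D \<subseteq> V - Q" "closed_in E (V - {x, a, q, q'}) D" "t \<in> D"
    and D': "D' \<noteq> {}" "D' \<subseteq> V - Q" "closed_in E (V - {x, t, q, p}) D'"
  shows False
proof -
  have V: "x \<in> V" "t \<in> V" "q \<in> V" "p \<in> V" "w \<in> V" "a \<in> V" using out D q p wQ QV by auto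
  have wD: "w \<notin> D'" using D' wQ by blast
  have tx: "t \<noteq> x" "t \<noteq> a" using D unfolding closed_in_def by auto
  have wne: "w \<noteq> x" "w \<noteq> t" using wQ out D by auto
  have aD: "a \<notin> D'"
  proof
    assume "a \<in> D'"
    moreover have "E a w" using E_sym[OF wQ(2)] .
    moreover have "w \<in> V - {x, t, q, p}" using V wne wQ p by auto
    ultimately show False using D'(3) wD unfolding closed_in_def by blast
  qed
  have c3: "card {u, v, z} < 4" for u v z :: 'a by (auto simp: card_insert_if)
  \<comment> \<open>Otherwise the three vertices \<open>x\<close>, \<open>q\<close>,
    \<open>p\<close> would cut off \<open>D'\<close>.\<close>
  have "\<exists>u \<in> D'. E u t"
  proof (rule ccontr)
    assume neg: "\<not> ?thesis"
    then have "closed_in E (V - {x, q, p}) D'" using D'(3) unfolding closed_in_def by blast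
    then have "D' = V - {x, q, p}" using conn[OF _ c3 D'(1)] V by blast
    then show False using wD V wne wQ p by blast
  qed
  then obtain u where u: "u \<in> D'" "E u t" by blast
  have "u \<in> D"
  proof -
    have "u \<noteq> x" "u \<noteq> a" "u \<notin> Q" "u \<in> V" using u D' aD unfolding closed_in_def by auto
    then have "u \<in> V - {x, a, q, q'}" using q by auto
    then show ?thesis using D(2,3) E_sym[OF u(2)] unfolding closed_in_def by blast
  qed
  then have ne: "D \<inter> D' \<noteq> {}" using u by blast
  \<comment> \<open>A neighbor of the intersection other than \<open>x\<close>, \<open>t\<close>,
    \<open>q\<close> is neither \<open>p\<close>, which would then lie in \<open>D\<close>, nor
    \<open>a\<close> or \<open>q'\<close>, which would then lie in \<open>D'\<close>. So three
    vertices would cut off the intersection.\<close>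
  have "closed_in E (V - {x, t, q}) (D \<inter> D')"
    unfolding closed_in_def
  proof (intro conjI ballI impI)
    show "D \<inter> D' \<subseteq> V - {x, t, q}" using D'(3) unfolding closed_in_def by blast
    fix v z assume v: "v \<in> D \<inter> D'" and z: "z \<in> V - {x, t, q}" and e: "E v z"
    have zp: "z \<noteq> p"
    proof
      assume "z = p"
      then have "p \<in> D" using D(2) v e V p out unfolding closed_in_def by blast
      then show False using D p by blast
    qed
    then have zD': "z \<in> D'" using D'(3) v z e unfolding closed_in_def by blast
    then have "z \<noteq> a" "z \<noteq> q'" using aD D' q by auto
    then have "z \<in> D" using D(2) v z e unfolding closed_in_def by blast
    then show "z \<in> D \<inter> D'" using zD' by blast
  qed
  then have "D \<inter> D' = V - {x, t, q}" using conn[OF _ c3 ne] V by blast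
  then show False using wD V wne wQ by blast
qed

text \<open>By \<open>lk_same_outer_vertex\<close> one link between the classes of \<open>x\<close>
  and of \<open>a\<close> is enough. Distinct clique vertices \<open>r\<close>, \<open>r'\<close>
  are taken if possible, with a detour through an obstructing component. If instead \<open>q\<close>
  is the only nonneighbor in \<open>Q\<close> of both \<open>x\<close> and \<open>a\<close>, then
  \<open>x\<close>, \<open>a\<close> and \<open>q\<close> are independent.\<close>

lemma lk_outer_neighbors:
  assumes w: "w \<in> Q" and xa: "N w - Q = {x, a}" "x \<noteq> a"
    and q: "q \<in> Q" "\<not> E x q" "q' \<in> Q" "\<not> E a q'"
  shows "lk (Same x q) (Same a q')"
proof -
  have wx: "E w x" "E w a" and xV: "x \<in> V - Q" "a \<in> V - Q"
    using xa mem_N E_V2 by blast+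
  have d: "dist2 x r" if "r \<in> Q" "\<not> E x r" for r using dist2Q[OF xV(1) w wx(1) that] .
  have d': "dist2 a r" if "r \<in> Q" "\<not> E a r" for r using dist2Q[OF xV(2) w wx(2) that] .
  have "\<exists>r \<in> Q. \<exists>r' \<in> Q. \<not> E x r \<and> \<not> E a r' \<and> lk (Same x r) (Same a r')"
  proof (cases "\<exists>r \<in> Q. \<exists>r' \<in> Q. r \<noteq> r' \<and> \<not> E x r \<and> \<not> E a r'")
    case True
    then obtain r r' where r: "r \<in> Q" "r' \<in> Q" "r \<noteq> r'" "\<not> E x r" "\<not> E a r'" by blast
    have wr: "w \<noteq> r" "w \<noteq> r'" using r wx E_sym by blast+
    have "lk (Same x r) (Same a r')"
    proof (cases "\<exists>D. D \<noteq> {} \<and> D \<subseteq> V - Q \<and> closed_in E (V - {x, a, r, r'}) D")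
      case False
      show ?thesis
        by (rule lk_two_outer_vertices[OF xV(1) w wx(1) xV(2) w wx(2) xa(2) r(1,4,2,5,3) wr(2)])
          (use False in blast)
    next
      case True
      then obtain D where D: "D \<noteq> {}" "D \<subseteq> V - Q" "closed_in E (V - {x, a, r, r'}) D" by blast
      \<comment> \<open>Without such a \<open>t\<close> the three vertices \<open>x\<close>,
        \<open>a\<close>, \<open>r'\<close> would cut off \<open>D\<close>.\<close>
      have "\<exists>t \<in> D. E t r"
      proof (rule ccontr)
        assume neg: "\<not> ?thesis"
        then have cl: "closed_in E (V - {x, a, r'}) D" using D(3) unfolding closed_in_def by blast
        have "card {x, a, r'} < 4" by (auto simp: card_insert_if)
        then have "D = V - {x, a, r'}" using conn[OF _ _ D(1) cl] xV r QV by blast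
        then show False using D(2) w wr QV xV by blast
      qed
      then obtain t where t: "t \<in> D" "E t r" by blast
      have tV: "t \<in> V - Q" "x \<noteq> t" "a \<noteq> t" using t D unfolding closed_in_def by auto
      obtain p where p: "p \<in> Q" "p \<noteq> r" "p \<noteq> r'" "p \<noteq> w" using fourth_in_Q by blast
      have tp: "\<not> E t p"
      proof
        assume "E t p"
        then have "p \<in> D" using D(3) t(1) p xV QV unfolding closed_in_def by blast
        then show False using D(2) p by blast
      qed
      have D2: "closed_in E (V - {a, x, r', r}) D" using D(3) by (simp add: insert_commute)
      have 1: "lk (Same x r) (Same t p)"
        by (rule lk_two_outer_vertices[OF xV(1) w wx(1) tV(1) r(1) E_sym[OF t(2)] tV(2) r(1,4) p(1) tp p(2)[symmetric] p(4)[symmetric]])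
          (rule no_second_obstruction[OF w wx(2) wr r(1,2) p xV D(2,3) t(1)])
      have 2: "lk (Same a r') (Same t p)"
        by (rule lk_two_outer_vertices[OF xV(2) w wx(2) tV(1) r(1) E_sym[OF t(2)] tV(3) r(2,5) p(1) tp p(3)[symmetric] p(4)[symmetric]])
          (rule no_second_obstruction[OF w wx(1) wr(2,1) r(2,1) p(1,3,2,4) xV(2,1) D(2) D2 t(1)])
      have "dist2 t p" using dist2Q[OF tV(1) r(1) E_sym[OF t(2)] p(1) tp] .
      then show ?thesis using lk_trans2[OF 1] lk_sym[OF 2] by blast
    qed
    then show ?thesis using r by blast
  next
    case False
    have eq: "q = q'" using False q by blast
    have xQ: "E x r \<and> E a r" if r: "r \<in> Q" "r \<noteq> q" for r
    proof (rule conjI)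
      show "E x r" using False r q(3,4) eq by metis
      show "E a r" using False r q(1,2) by metis
    qed
    have nxa: "\<not> E x a"
    proof
      assume e: "E x a"
      let ?Q = "insert x (insert a (Q - {q}))"
      have "?Q \<subseteq> V" using xV QV by auto
      moreover have "card ?Q = k" using xV xa q finQ cardQ k5 by auto
      ultimately obtain u v where "u \<in> ?Q" "v \<in> ?Q" "u \<noteq> v" "\<not> E u v" using no_clique_k by metis
      then show False using e xQ clQ E_sym by blast
    qed
    have "dist2 q x" "dist2 q a" using dist2_sym[OF d[OF q(1,2)]] dist2_sym[OF d'[OF q(3,4)]] eq by auto
    then have "lk (Same q x) (Same q a)" using lk_triple nxa xa by blast
    then show ?thesis using q eq Same_sym by metis
  qed
  then obtain r r' where r: "r \<in> Q" "r' \<in> Q" "\<not> E x r" "\<not> E a r'" "lk (Same x r) (Same a r')" by blast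
  have 1: "lk (Same x q) (Same x r)" using lk_same_outer_vertex[OF _ w wx(1) q(1,2) r(1,3)] xV by auto
  have 2: "lk (Same a r') (Same a q')" using lk_same_outer_vertex[OF _ w wx(2) r(2,4) q(3,4)] xV by auto
  show ?thesis using lk_trans2[OF 1 d[OF r(1,3)] lk_trans2[OF r(5) d'[OF r(2,4)] 2]] .
qed

text \<open>If \<open>a\<close> is adjacent to \<open>q\<close>, let \<open>t\<close> be the other
  outer neighbor of \<open>q\<close>. A coloring with one color on \<open>x\<close>,
  \<open>a\<close> and another on \<open>t\<close>, \<open>w\<close> leads from the pair
  \<open>x\<close>, \<open>a\<close> to \<open>t\<close>, \<open>w\<close>; the known links at
  \<open>q\<close> and then at \<open>w\<close> lead on to \<open>a\<close>, \<open>p\<close> and to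
  \<open>x\<close>, \<open>q\<close>.\<close>

lemma lk_outer_pair:
  assumes w: "w \<in> Q" and xa: "N w - Q = {x, a}" "x \<noteq> a" "\<not> E x a" and q: "q \<in> Q" "\<not> E x q"
  shows "lk (Same x a) (Same x q)"
proof -
  have wx: "E w x" "E w a" and xV: "x \<in> V - Q" "a \<in> V - Q"
    using xa mem_N E_V2 by blast+
  have d: "dist2 x a" "dist2 x q" using dist2I[OF wx xa(2,3)] dist2Q[OF xV(1) w wx(1) q] by auto
  show ?thesis
  proof (cases "E a q")
    case False
    then have "a \<noteq> q" using q xV by auto
    then show ?thesis using lk_triple[OF d] False by auto
  next
    case True
    have aN: "a \<in> N q - Q" using True mem_N E_sym xV by auto
    obtain u v where uv: "N q - Q = {u, v}" "u \<noteq> v" using card_out[OF q(1)] card_2_iff[of "N q - Q"] by auto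
    obtain t where t: "N q - Q = {a, t}" "a \<noteq> t"
    proof (cases "a = u")
      case True then show ?thesis using that[of v] uv by simp
    next
      case False
      then have "a = v" using aN uv by blast
      then show ?thesis using that[of u] uv by (simp add: insert_commute)
    qed
    have qt: "E q t" and tV: "t \<in> V - Q" using t mem_N E_V2 by blast+
    have tx: "t \<noteq> x" using qt E_sym q by auto
    have tw: "\<not> E t w"
    proof
      assume "E t w"
      then have "t \<in> N w - Q" using mem_N E_sym tV by auto
      then show False using xa t tx by auto
    qed
    have qw: "q \<noteq> w" using q E_sym[OF wx(1)] by auto
    obtain c1 c2 c3 c4 where c: "c1 \<in> C" "c2 \<in> C" "c1 \<noteq> c2" using four_colors by metis
    let ?f = "\<lambda>z. if z = t then c2 else c1"
    have "\<exists>g. proper_on E (V - Q) (\<lambda>_. C) g \<and> (\<forall>v \<in> {x, a, t}. g v = ?f v) \<and>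
        (\<forall>v \<in> V - Q - {x, a, t}. \<forall>y \<in> {}. E v y \<longrightarrow> g v \<noteq> ?f y)"
    proof (rule extend_partial_small[where r = w])
      show "proper_on E {x, a, t} (\<lambda>_. C) ?f" using c xa t tx E_irr E_sym unfolding proper_on_def by auto
      show "card ({x, a, t} \<union> {}) < 4" by (auto simp: card_insert_if)
    qed (use xV tV w QV in auto)
    then obtain g where g: "proper_on E (V - Q) (\<lambda>_. C) g" "g x = c1" "g a = c1" "g t = c2"
      using tx t by auto
    have h: "proper_on E (insert w (V - Q)) (\<lambda>_. C) (g(w := c2))"
    proof (rule proper_on_insert[OF g(1) c(2)])
      fix u assume "u \<in> V - Q" "E w u"
      then have "u \<in> N w - Q" using mem_N by auto
      then show "g u \<noteq> c2" using xa g c by auto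
    qed
    have "\<exists>F. Col F \<and> (\<forall>v \<in> insert w (V - Q). F v = (g(w := c2)) v)"
    proof (rule extend_clique[OF _ h, where w = q and x = t and y = w])
      show "E u v" if "u \<in> V - insert w (V - Q)" "v \<in> V - insert w (V - Q)" "u \<noteq> v" for u v
        using clQ that by auto
      show "E q w" using clQ[OF q(1) w qw] .
      show "E q t" using qt .
      show "(g(w := c2)) t = (g(w := c2)) w" using g tV w by auto
    qed (use w q QV qw tV in auto)
    then obtain F where F: "Col F" "\<forall>v \<in> insert w (V - Q). F v = (g(w := c2)) v" by blast
    have Fv: "F x = c1" "F a = c1" "F t = c2" "F w = c2" using F(2) xV tV w g by auto
    have dt: "dist2 t w" using dist2Q[OF tV q(1) qt w tw] .
    have 1: "lk (Same x a) (Same t w)" using lk_if_common[OF d(1) dt F(1)] Fv by auto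
    obtain p where p: "p \<in> Q" "\<not> E a p" using nonneighbor_in_Q[OF xV(2)] by blast
    have 2: "lk (Same a p) (Same t w)" using lk_outer_neighbors[OF q(1) t p w tw] .
    have 3: "lk (Same x q) (Same a p)" using lk_outer_neighbors[OF w xa(1,2) q p] .
    have da: "dist2 a p" using dist2Q[OF xV(2) w wx(2) p] .
    show ?thesis using lk_trans2[OF 1 dt lk_trans[OF lk_sym[OF 2] Same_ne[OF da] lk_sym[OF 3]]] .
  qed
qed

lemma swap_conn_near_clique: swap_conn
proof -
  obtain w where w: "w \<in> Q" using fourth_in_Q by blast
  have wV: "w \<in> V" using w QV by blast
  obtain x a where xa: "N w - Q = {x, a}" "x \<noteq> a" using card_out[OF w] card_2_iff[of "N w - Q"] by blast
  have wx: "E w x" "E w a" and xV: "x \<in> V - Q" "a \<in> V - Q"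
    using xa mem_N E_V2 by blast+
  obtain q where q: "q \<in> Q" "\<not> E x q" using nonneighbor_in_Q[OF xV(1)] by blast
  have d: "dist2 x q" using dist2Q[OF xV(1) w wx(1) q] .
  have xq: "lk (Same x r) (Same x q)" if "r \<in> Q" "\<not> E x r" for r
    using lk_same_outer_vertex[OF _ w wx(1) that q] xV by auto
  have aq: "lk (Same a r) (Same x q)" if "r \<in> Q" "\<not> E a r" for r
    using lk_sym[OF lk_outer_neighbors[OF w xa q that]] .
  have all: "lk (Same y z) (Same x q)" if yz: "E w y" "E w z" "y \<noteq> z" "\<not> E y z" for y z
  proof -
    have yz2: "y \<in> Q \<or> y = x \<or> y = a" "z \<in> Q \<or> z = x \<or> z = a" using xa mem_N yz by blast+
    have s: "\<not> E z y" using yz E_sym by blast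
    have nQ: "\<not> (y \<in> Q \<and> z \<in> Q)" using clQ yz by blast
    consider "y = x" "z = a" | "y = a" "z = x" | "y = x" "z \<in> Q" | "y = a" "z \<in> Q" | "z = x" "y \<in> Q" | "z = a" "y \<in> Q"
      using yz2 yz(3) nQ by blast
    then show ?thesis
    proof cases
      case 1 then show ?thesis using lk_outer_pair[OF w xa _ q] yz by auto
    next
      case 2 then show ?thesis using lk_outer_pair[OF w xa _ q] s Same_sym[of a x] by auto
    next
      case 3 then show ?thesis using xq yz by auto
    next
      case 4 then show ?thesis using aq yz by auto
    next
      case 5 then show ?thesis using xq s Same_sym[of y x] by auto
    next
      case 6 then show ?thesis using aq s Same_sym[of y a] by auto
    qed
  qed
  show ?thesis
  proof (rule finish_pairs[OF wV])
    fix y z b c assume 1: "E w y" "E w z" "y \<noteq> z" "\<not> E y z" and 2: "E w b" "E w c" "b \<noteq> c" "\<not> E b c"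
    show "lk (Same y z) (Same b c)" using lk_trans2[OF all[OF 1] d lk_sym[OF all[OF 2]]] .
  qed
qed

end

section \<open>4-regular graphs\<close>

context conn4const
begin

text \<open>Pairs that share a vertex are linked by a triple, and disjoint ones through a mixed
  pair.\<close>

lemma lk_independent:
  assumes I: "\<And>u. u \<in> I \<Longrightarrow> E w u" "\<And>u v. u \<in> I \<Longrightarrow> v \<in> I \<Longrightarrow> \<not> E u v"
    and x: "x \<in> I" "y \<in> I" "x \<noteq> y" "a \<in> I" "b \<in> I" "a \<noteq> b"
  shows "lk (Same x y) (Same a b)"
proof -
  have d: "dist2 u v" if "u \<in> I" "v \<in> I" "u \<noteq> v" for u v using dist2I[of w u v] I that by auto
  have sh: "lk (Same u v) (Same u z)" if "u \<in> I" "v \<in> I" "z \<in> I" "u \<noteq> v" "u \<noteq> z" for u v z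
    using lk_triple[of u v z] lk_Same[of u v] d I that by (cases "v = z") auto
  show ?thesis
  proof (cases "x = a")
    case True then show ?thesis using sh[of x y b] x by auto
  next
    case False
    have 1: "lk (Same x y) (Same x a)" using sh[of x y a] x False by auto
    have 2: "lk (Same a x) (Same a b)" using sh[of a x b] x False by auto
    show ?thesis using lk_trans2[OF 1] d[of x a] 2 x False Same_sym[of a x] by auto
  qed
qed

text \<open>A coloring is given by its color classes, an earlier set taking precedence where they
  overlap. This serves the small graphs in which precoloring arguments run out.\<close>

lemma coloring_by_classes:
  assumes cov: "V \<subseteq> A \<union> B \<union> A' \<union> B'"
    and ind: "\<And>u v. u \<in> A \<Longrightarrow> v \<in> A \<Longrightarrow> \<not> E u v" "\<And>u v. u \<in> B \<Longrightarrow> v \<in> B \<Longrightarrow> \<not> E u v"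
      "\<And>u v. u \<in> A' \<Longrightarrow> v \<in> A' \<Longrightarrow> \<not> E u v" "\<And>u v. u \<in> B' \<Longrightarrow> v \<in> B' \<Longrightarrow> \<not> E u v"
    and p: "x \<in> A" "y \<in> A" "dist2 x y" "u \<in> B" "v \<in> B" "u \<notin> A" "v \<notin> A" "dist2 u v"
  shows "lk (Same x y) (Same u v)"
proof -
  obtain c1 c2 c3 c4 where c: "c1 \<in> C" "c2 \<in> C" "c3 \<in> C" "c4 \<in> C"
    "c1 \<noteq> c2" "c1 \<noteq> c3" "c1 \<noteq> c4" "c2 \<noteq> c3" "c2 \<noteq> c4" "c3 \<noteq> c4" using four_colors .
  define F where "F = (\<lambda>z. if z \<in> A then c1 else if z \<in> B then c2 else if z \<in> A' then c3 else c4)"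
  have "Col F"
    unfolding proper_on_def
  proof (intro conjI ballI impI)
    show "F z \<in> C" for z unfolding F_def using c by auto
    fix y z assume yz: "y \<in> V" "z \<in> V" "E y z"
    have k1: "z \<in> A" if "F z = c1" for z using that c unfolding F_def by (auto split: if_splits)
    have k2: "z \<in> B" if "F z = c2" for z using that c unfolding F_def by (auto split: if_splits)
    have k3: "z \<in> A'" if "F z = c3" for z using that c unfolding F_def by (auto split: if_splits)
    have k4: "z \<in> B'" if "F z = c4" "z \<in> V" for z using that c cov unfolding F_def by (auto split: if_splits)
    show "F y \<noteq> F z"
    proof
      assume eq: "F y = F z"
      consider "F z = c1" | "F z = c2" | "F z = c3" | "F z = c4" unfolding F_def by metis
      then show False
      proof cases
        case 1 then show ?thesis using ind(1)[OF k1 k1] eq yz(3) by metis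
      next
        case 2 then show ?thesis using ind(2)[OF k2 k2] eq yz(3) by metis
      next
        case 3 then show ?thesis using ind(3)[OF k3 k3] eq yz(3) by metis
      next
        case 4 then show ?thesis using ind(4)[OF k4[OF _ yz(1)] k4[OF _ yz(2)]] eq yz(3) by metis
      qed
    qed
  qed
  moreover have "F x = F y" "F u = F v" using p unfolding F_def by auto
  ultimately show ?thesis using lk_if_common[OF p(3,8)] by simp
qed

end

section \<open>4-regular graphs without a clique on four vertices\<close>

locale quartic = conn4const +
  assumes k4: "k = 4"
    and noK4: "E a b \<Longrightarrow> E a c \<Longrightarrow> E a d \<Longrightarrow> E b c \<Longrightarrow> E b d \<Longrightarrow> \<not> E c d"
begin

lemma N4:
  assumes "E v a" "E v b" "E v c" "E v d" "a \<noteq> b" "a \<noteq> c" "a \<noteq> d" "b \<noteq> c" "b \<noteq> d" "c \<noteq> d"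
  shows "E v u \<longleftrightarrow> u \<in> {a, b, c, d}"
proof -
  have "{a, b, c, d} \<subseteq> N v" using assms mem_N by auto
  moreover have "card {a, b, c, d} = 4" using assms by auto
  ultimately have "{a, b, c, d} = N v" using card_subset_eq[OF finite_N] reg[OF E_V[OF assms(1)]] k4 by metis
  then have "u \<in> N v \<longleftrightarrow> u \<in> {a, b, c, d}" by (rule arg_cong[OF sym])
  then show ?thesis unfolding mem_N .
qed

lemma color_avoiding:
  obtains \<gamma> where "\<gamma> \<in> C" "\<gamma> \<noteq> a" "\<gamma> \<noteq> b" "\<gamma> \<noteq> c"
proof -
  have "card {a, b, c} \<le> 3" by (auto simp: card_insert_if)
  then have "\<not> C \<subseteq> {a, b, c}" using card_mono[of "{a, b, c}" C] cardC k4 by auto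
  then show ?thesis using that by blast
qed

lemma colors4:
  assumes "{c1, c2, c3, c4} \<subseteq> C"
    "c1 \<noteq> c2" "c1 \<noteq> c3" "c1 \<noteq> c4" "c2 \<noteq> c3" "c2 \<noteq> c4" "c3 \<noteq> c4"
  shows "C = {c1, c2, c3, c4}"
proof -
  have "card {c1, c2, c3, c4} = card C" using assms cardC k4 by auto
  then show ?thesis using card_subset_eq[OF finC assms(1)] by auto
qed

end

text \<open>Outside \<open>{q, q'}\<close> the vertices \<open>w\<close> and \<open>t\<close> have only two neighbors, so there
  they have two free colors in every coloring.\<close>

locale diamond = quartic +
  fixes q q' w t s s'
  assumes Nq: "E q v \<longleftrightarrow> v \<in> {q', w, t, s}" and Nq': "E q' v \<longleftrightarrow> v \<in> {q, w, t, s'}"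
    and ne: "w \<noteq> t" "s \<noteq> w" "s \<noteq> t" "s' \<noteq> w" "s' \<noteq> t" "s \<noteq> s'" "s \<noteq> q'" "s' \<noteq> q"
begin

lemma edges: "E q q'" "E q w" "E q t" "E q s" "E q' q" "E q' w" "E q' t" "E q' s'"
  using Nq Nq' by auto

lemma ne2: "q \<noteq> q'" "q \<noteq> w" "q \<noteq> t" "q \<noteq> s" "q' \<noteq> w" "q' \<noteq> t" "q' \<noteq> s'" 
  using edges E_neq by blast+

lemma nonadj: "\<not> E w t" "\<not> E t w" "\<not> E s q'" "\<not> E s' q" "\<not> E q s'" "\<not> E q' s"
proof -
  show 1: "\<not> E w t" using noK4[OF edges(1,2,3,6,7)] .
  then show "\<not> E t w" using E_sym by blast
  show 2: "\<not> E q' s" using Nq'[of s] ne ne2 by auto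
  then show "\<not> E s q'" using E_sym by blast
  show 3: "\<not> E q s'" using Nq[of s'] ne ne2 by auto
  then show "\<not> E s' q" using E_sym by blast
qed

lemma inV: "q \<in> V" "q' \<in> V" "w \<in> V" "t \<in> V" "s \<in> V" "s' \<in> V"
  using edges E_V E_V2 by blast+

abbreviation W where "W \<equiv> V - {q, q'}"

lemma inW: "w \<in> W" "t \<in> W" "s \<in> W" "s' \<in> W"
  using inV ne ne2 by auto

text \<open>One of the two symmetries of the configuration, the other being the exchange of
  \<open>q\<close> and \<open>q'\<close>; together they reduce the case analysis to four
  lemmas.\<close>

lemma diamond_swap_w_t: "diamond V E k C q q' t w s s'"
  by unfold_locales (use Nq Nq' ne in auto)

lemma diamond_swap_q: "diamond V E k C q' q w t s' s"
  by unfold_locales (use Nq Nq' ne in auto)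

lemma dists: "dist2 w t" "dist2 q' s" "dist2 q s'"
  "\<not> E s w \<Longrightarrow> dist2 s w" "\<not> E s t \<Longrightarrow> dist2 s t" "\<not> E s' w \<Longrightarrow> dist2 s' w" "\<not> E s' t \<Longrightarrow> dist2 s' t"
  using dist2I[OF edges(2,3)] dist2I[OF edges(1,4)] dist2I[OF edges(5,8)] dist2I[OF edges(4,2)]
    dist2I[OF edges(4,3)] dist2I[OF edges(8,6)] dist2I[OF edges(8,7)] nonadj ne by auto

lemma precolor:
  assumes "X \<subseteq> W" "card X < 4" "proper_on E X (\<lambda>_. C) f"
  shows "\<exists>g. proper_on E W (\<lambda>_. C) g \<and> (\<forall>v \<in> X. g v = f v)"
  using extend_partial_small[of W X "{}" f q] assms inV by auto

lemma precolor3: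
  assumes "x \<in> W" "y \<in> W" "z \<in> W" "x \<noteq> y" "x \<noteq> z" "y \<noteq> z" "a \<in> C" "b \<in> C" "c \<in> C"
    and "a = b \<Longrightarrow> \<not> E x y" "a = c \<Longrightarrow> \<not> E x z" "b = c \<Longrightarrow> \<not> E y z"
  shows "\<exists>g. proper_on E W (\<lambda>_. C) g \<and> g x = a \<and> g y = b \<and> g z = c"
proof -
  let ?f = "\<lambda>v. if v = x then a else if v = y then b else c"
  have "proper_on E {x, y, z} (\<lambda>_. C) ?f"
    using assms E_irr E_sym unfolding proper_on_def by auto
  then have "\<exists>g. proper_on E W (\<lambda>_. C) g \<and> (\<forall>v \<in> {x, y, z}. g v = ?f v)"
    using assms(1-3) by (intro precolor) (auto simp: card_insert_if)
  then show ?thesis using assms(4-6) by auto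
qed

lemma recolor:
  assumes g: "proper_on E W (\<lambda>_. C) g" and c: "c \<in> C" and v: "v \<in> W"
    and n: "\<And>u. u \<in> W \<Longrightarrow> E v u \<Longrightarrow> g u \<noteq> c"
  shows "proper_on E W (\<lambda>_. C) (g(v := c))"
  using proper_on_insert[OF g c, of v] n v by (simp add: insert_absorb)

lemma fill:
  assumes g: "proper_on E W (\<lambda>_. C) g" and c: "\<alpha> \<in> C" "\<beta> \<in> C" "\<alpha> \<noteq> \<beta>"
    and a: "\<alpha> \<noteq> g w" "\<alpha> \<noteq> g t" "\<alpha> \<noteq> g s" and b: "\<beta> \<noteq> g w" "\<beta> \<noteq> g t" "\<beta> \<noteq> g s'"
  shows "\<exists>F. Col F \<and> (\<forall>v \<in> W. F v = g v) \<and> F q = \<alpha> \<and> F q' = \<beta>"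
proof -
  have 1: "proper_on E (insert q W) (\<lambda>_. C) (g(q := \<alpha>))"
  proof (rule proper_on_insert[OF g c(1)])
    show "g u \<noteq> \<alpha>" if "u \<in> W" "E q u" for u using that Nq[of u] a by auto
  qed
  have 2: "proper_on E (insert q' (insert q W)) (\<lambda>_. C) (g(q := \<alpha>, q' := \<beta>))"
  proof (rule proper_on_insert[OF 1 c(2)])
    show "(g(q := \<alpha>)) u \<noteq> \<beta>" if "u \<in> insert q W" "E q' u" for u using that Nq'[of u] b c by auto
  qed
  have "insert q' (insert q W) = V" using inV by auto
  then have "Col (g(q := \<alpha>, q' := \<beta>))" using 2 by simp
  then show ?thesis using ne2 by (intro exI[of _ "g(q := \<alpha>, q' := \<beta>)"]) auto
qed

text \<open>With the color of \<open>s\<close> on \<open>q'\<close>, the four neighbors of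
  \<open>q\<close> show at most three colors and leave one for \<open>q\<close>.\<close>

lemma fill_s:
  assumes g: "proper_on E W (\<lambda>_. C) g" and a: "g s \<noteq> g w" "g s \<noteq> g t" "g s \<noteq> g s'"
  shows "\<exists>F. Col F \<and> (\<forall>v \<in> W. F v = g v) \<and> F q' = F s"
proof -
  have c: "g s \<in> C" using proper_on_inL[OF g inW(3)] .
  obtain \<gamma> where "\<gamma> \<in> C" "\<gamma> \<noteq> g w" "\<gamma> \<noteq> g t" "\<gamma> \<noteq> g s" using color_avoiding .
  then obtain F where "Col F" "\<forall>v \<in> W. F v = g v" "F q' = g s" using fill[OF g _ c] a by metis
  then show ?thesis using inW by auto
qed

lemma fill_both:
  assumes g: "proper_on E W (\<lambda>_. C) g" and a: "g s \<noteq> g w" "g s \<noteq> g t" "g s \<noteq> g s'"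
    "g s' \<noteq> g w" "g s' \<noteq> g t"
  shows "\<exists>F. Col F \<and> (\<forall>v \<in> W. F v = g v) \<and> F q' = F s \<and> F q = F s'"
proof -
  have c: "g s \<in> C" "g s' \<in> C" using proper_on_inL[OF g] inW by auto
  obtain F where "Col F" "\<forall>v \<in> W. F v = g v" "F q = g s'" "F q' = g s"
    using fill[OF g c(2,1)] a by metis
  then show ?thesis using inW by auto
qed

lemma pairs_q:
  assumes "E q x" "E q y" "x \<noteq> y" "\<not> E x y"
  shows "Same x y = Same w t \<or> Same x y = Same q' s \<or> (\<not> E s w \<and> Same x y = Same s w) \<or>
    (\<not> E s t \<and> Same x y = Same s t)"
proof -
  have "x \<in> {q', w, t, s}" "y \<in> {q', w, t, s}" using assms Nq by auto
  moreover have "\<not> E y x" using assms E_sym by blast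
  ultimately show ?thesis using assms(3,4) edges Same_sym by auto
qed

lemma finish_q:
  assumes "lk (Same w t) R" "lk (Same q' s) R" "\<not> E s w \<Longrightarrow> lk (Same s w) R" "\<not> E s t \<Longrightarrow> lk (Same s t) R"
    and R: "R \<noteq> {}"
  shows swap_conn
proof -
  have all: "lk (Same x y) R" if "E q x" "E q y" "x \<noteq> y" "\<not> E x y" for x y
    using pairs_q[OF that] assms(1-4) by auto
  show ?thesis
  proof (rule finish_pairs[OF inV(1)])
    fix x y a b assume 1: "E q x" "E q y" "x \<noteq> y" "\<not> E x y" and 2: "E q a" "E q b" "a \<noteq> b" "\<not> E a b"
    show "lk (Same x y) (Same a b)" using lk_trans[OF all[OF 1] R lk_sym[OF all[OF 2]]] .
  qed
qed

lemma fill_s':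
  assumes "proper_on E W (\<lambda>_. C) g" "g s' \<noteq> g w" "g s' \<noteq> g t" "g s' \<noteq> g s"
  shows "\<exists>F. Col F \<and> (\<forall>v \<in> W. F v = g v) \<and> F q = F s'"
proof -
  have "V - {q', q} = W" by auto
  then show ?thesis using diamond.fill_s[OF diamond_swap_q, of g] assms by simp
qed

lemma finish_q':
  assumes "lk (Same w t) R" "lk (Same q s') R" "\<not> E s' w \<Longrightarrow> lk (Same s' w) R"
    "\<not> E s' t \<Longrightarrow> lk (Same s' t) R" "R \<noteq> {}"
  shows swap_conn
  using diamond.finish_q[OF diamond_swap_q assms] .

lemma two_W_neighbors:
  assumes "x = w \<or> x = t"
  obtains a b where "\<And>u. u \<in> W \<Longrightarrow> E x u \<longleftrightarrow> u = a \<or> u = b" "a \<in> W" "b \<in> W" "a \<noteq> b"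
proof -
  have x: "E x q" "E x q'" "x \<in> V" using assms E_sym[OF edges(2)] E_sym[OF edges(3)] E_sym[OF edges(6)] E_sym[OF edges(7)] inV by auto
  obtain a where a: "E x a" "a \<noteq> q" "a \<noteq> q'" using other_neighbor3[OF x(3), of q q' q] by blast
  obtain b where b: "E x b" "b \<noteq> q" "b \<noteq> q'" "b \<noteq> a" using other_neighbor3[OF x(3), of q q' a] by blast
  have "E x u \<longleftrightarrow> u \<in> {q, q', a, b}" for u by (rule N4) (use x a b ne2 in auto)
  then show ?thesis using that[of a b] a b E_V2 by auto
qed

lemma W_neighbors_with:
  assumes "x = w \<or> x = t" "E x y" "y \<in> W"
  obtains b where "\<And>u. u \<in> W \<Longrightarrow> E x u \<longleftrightarrow> u = y \<or> u = b" "b \<in> W" "b \<noteq> y"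
proof -
  obtain a b where ab: "\<And>u. u \<in> W \<Longrightarrow> E x u \<longleftrightarrow> u = a \<or> u = b" "a \<in> W" "b \<in> W" "a \<noteq> b"
    using two_W_neighbors[OF assms(1)] by blast
  have "y = a \<or> y = b" using ab(1)[OF assms(3)] assms(2) by blast
  then show ?thesis using that[of a] that[of b] ab by blast
qed

text \<open>\<open>w\<close> and \<open>t\<close> share the neighbor \<open>s\<close> outside the
  edge \<open>q q'\<close>, so together they exclude only three colors and can get a common one,
  which links the only two pairs at \<open>q\<close>.\<close>

lemma swap_conn_both:
  assumes "E s w" "E s t"
  shows swap_conn
proof -
  obtain w2 where w2: "\<And>u. u \<in> W \<Longrightarrow> E w u \<longleftrightarrow> u = s \<or> u = w2"
    using W_neighbors_with[of w s] E_sym[OF assms(1)] inW by blast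
  obtain t2 where t2: "\<And>u. u \<in> W \<Longrightarrow> E t u \<longleftrightarrow> u = s \<or> u = t2"
    using W_neighbors_with[of t s] E_sym[OF assms(2)] inW by blast
  obtain c1 c2 c3 c4 where c: "c1 \<in> C" "c2 \<in> C" "c1 \<noteq> c2" using four_colors by metis
  let ?f = "\<lambda>v. if v = s then c1 else c2"
  have "proper_on E {s, s'} (\<lambda>_. C) ?f" using c ne E_irr unfolding proper_on_def by auto
  then have "\<exists>g. proper_on E W (\<lambda>_. C) g \<and> (\<forall>v \<in> {s, s'}. g v = ?f v)"
    using inW by (intro precolor) (auto simp: card_insert_if)
  then obtain g where g: "proper_on E W (\<lambda>_. C) g" "g s = c1" "g s' = c2" using ne by auto
  obtain \<gamma> where \<gamma>: "\<gamma> \<in> C" "\<gamma> \<noteq> c1" "\<gamma> \<noteq> g w2" "\<gamma> \<noteq> g t2" using color_avoiding .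
  have 1: "proper_on E W (\<lambda>_. C) (g(w := \<gamma>))"
  proof (rule recolor[OF g(1) \<gamma>(1) inW(1)])
    show "g u \<noteq> \<gamma>" if "u \<in> W" "E w u" for u using w2[OF that(1)] that(2) g \<gamma> by auto
  qed
  have 2: "proper_on E W (\<lambda>_. C) (g(w := \<gamma>, t := \<gamma>))"
  proof (rule recolor[OF 1 \<gamma>(1) inW(2)])
    show "(g(w := \<gamma>)) u \<noteq> \<gamma>" if "u \<in> W" "E t u" for u using t2[OF that(1)] that(2) g \<gamma> nonadj by auto
  qed
  obtain F where F: "Col F" "\<forall>v \<in> W. F v = (g(w := \<gamma>, t := \<gamma>)) v" "F q' = F s"
    using fill_s[OF 2] g \<gamma> c ne by auto
  have "F w = F t" using F(2) inW ne by auto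
  then have l: "lk (Same q' s) (Same w t)" using lk_if_common[OF dists(2,1) F(1,3)] by auto
  show ?thesis
    by (rule finish_q[OF lk_Same[OF dists(1)] l _ _ Same_ne[OF dists(1)]]) (use assms in auto)
qed

text \<open>\<open>s'\<close>, \<open>w\<close>, \<open>t\<close> are independent neighbors of
  \<open>q'\<close>, so only the pair \<open>q\<close>, \<open>s'\<close> has to be linked. After
  coloring \<open>s\<close>, \<open>s'\<close>, \<open>w\<close> with \<open>c2\<close>,
  \<open>c3\<close>, \<open>c1\<close>, the choice left at \<open>t\<close> decides how.\<close>

lemma swap_conn_none:
  assumes s': "\<not> E s' w" "\<not> E s' t" and sw: "\<not> E s w"
  shows swap_conn
proof -
  have symT: "lk (Same s' w) (Same w t)" "lk (Same s' t) (Same w t)"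
  proof -
    have n: "\<not> E w s'" "\<not> E t s'" using s' E_sym by blast+
    have i: "lk (Same x y) (Same w t)" if "x \<in> {s', w, t}" "y \<in> {s', w, t}" "x \<noteq> y" for x y
      by (rule lk_independent[where w = q' and I = "{s', w, t}"])
        (use that edges s' n nonadj E_irr ne in auto)
    show "lk (Same s' w) (Same w t)" "lk (Same s' t) (Same w t)" using i ne by auto
  qed
  obtain c1 c2 c3 c4 where c: "c1 \<in> C" "c2 \<in> C" "c3 \<in> C" "c4 \<in> C"
    "c1 \<noteq> c2" "c1 \<noteq> c3" "c1 \<noteq> c4" "c2 \<noteq> c3" "c2 \<noteq> c4" "c3 \<noteq> c4" using four_colors .
  have Ceq: "C = {c1, c2, c3, c4}" using colors4[of c1 c2 c3 c4] c by auto
  obtain g where g: "proper_on E W (\<lambda>_. C) g" "g s = c2" "g s' = c3" "g w = c1"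
    using precolor3[of s s' w c2 c3 c1] inW ne c by auto
  obtain a b where ab: "\<And>u. u \<in> W \<Longrightarrow> E t u \<longleftrightarrow> u = a \<or> u = b" using two_W_neighbors[of t] by blast
  have re: "proper_on E W (\<lambda>_. C) (g(t := \<tau>))" if "\<tau> \<in> C" "\<tau> \<noteq> g a" "\<tau> \<noteq> g b" for \<tau>
  proof (rule recolor[OF g(1) that(1) inW(2)])
    show "g u \<noteq> \<tau>" if "u \<in> W" "E t u" for u using ab[OF that(1)] that(2) \<open>\<tau> \<noteq> g a\<close> \<open>\<tau> \<noteq> g b\<close> by auto
  qed
  have "lk (Same q s') (Same w t)"
  proof -
    \<comment> \<open>If neither \<open>c1\<close> nor \<open>c2\<close> is free at
      \<open>t\<close>, its two neighbors in \<open>W\<close> use exactly these colors, and both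
      \<open>c3\<close> and \<open>c4\<close> are free.\<close>
    consider "c1 \<noteq> g a" "c1 \<noteq> g b" | "c2 \<noteq> g a" "c2 \<noteq> g b" |
      "c3 \<noteq> g a" "c3 \<noteq> g b" "c4 \<noteq> g a" "c4 \<noteq> g b"
      using c by metis
    then show ?thesis
    proof cases
      case 1
      obtain F where F: "Col F" "\<forall>v \<in> W. F v = (g(t := c1)) v" "F q = F s'"
        using fill_s'[OF re[OF c(1) 1]] g c ne by auto
      have "F w = F t" using F(2) inW g ne by auto
      then show ?thesis using lk_if_common[OF dists(3,1) F(1,3)] by auto
    next
      case 2
      obtain F where F: "Col F" "\<forall>v \<in> W. F v = (g(t := c2)) v" "F q = F s'"
        using fill_s'[OF re[OF c(2) 2]] g c ne by auto
      have st: "F s = F t" using F(2) inW g ne by auto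
      have nst: "\<not> E s t" using proper_onD[OF F(1) inV(5,4)] st by auto
      have 1: "lk (Same q s') (Same s t)" using lk_if_common[OF dists(3) dists(5)[OF nst] F(1,3) st] .
      have n: "\<not> E w s" "\<not> E t s" using sw nst E_sym by blast+
      have 2: "lk (Same s t) (Same w t)"
        by (rule lk_independent[where w = q and I = "{s, w, t}"]) (use edges sw nst n nonadj E_irr ne in auto)
      show ?thesis using lk_trans2[OF 1 dists(5)[OF nst] 2] .
    next
      case 3
      \<comment> \<open>\<open>c3\<close> at \<open>t\<close> repeats the color of
        \<open>s'\<close>, while \<open>c4\<close> allows \<open>q'\<close> to match
        \<open>s\<close> and \<open>q\<close> to match \<open>s'\<close> in one coloring.\<close>
      obtain F where F: "Col F" "\<forall>v \<in> W. F v = (g(t := c3)) v" "F q' = F s"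
        using fill_s[OF re[OF c(3) 3(1,2)]] g c ne by auto
      have "F s' = F t" using F(2) inW g ne by auto
      then have 1: "lk (Same q' s) (Same s' t)" using lk_if_common[OF dists(2) dists(7)[OF s'(2)] F(1,3)] by auto
      obtain G where G: "Col G" "\<forall>v \<in> W. G v = (g(t := c4)) v" "G q' = G s" "G q = G s'"
        using fill_both[OF re[OF c(4) 3(3,4)]] g c ne by auto
      have 2: "lk (Same q s') (Same q' s)" using lk_if_common[OF dists(3,2) G(1,4,3)] .
      show ?thesis
        using lk_trans2[OF 2 dists(2) lk_trans2[OF 1 dists(7)[OF s'(2)] symT(2)]] .
    qed
  qed
  then show ?thesis
    using finish_q'[OF lk_Same[OF dists(1)] _ symT Same_ne[OF dists(1)]] by blast
qed

text \<open>The neighbors of \<open>t\<close> are \<open>q\<close>, \<open>q'\<close>,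
  \<open>s\<close>, \<open>s'\<close>, so in \<open>W\<close> only the colors of \<open>s\<close>
  and \<open>s'\<close> restrict \<open>t\<close>. One coloring matches \<open>w\<close> with
  \<open>t\<close>, \<open>q'\<close> with \<open>s\<close> and \<open>q\<close> with
  \<open>s'\<close>; another takes care of the pair \<open>s\<close>, \<open>w\<close>.\<close>

lemma swap_conn_same_side:
  assumes a: "E s t" "E s' t" and n: "\<not> E s w" "\<not> E s' w"
  shows swap_conn
proof -
  obtain c1 c2 c3 c4 where c: "c1 \<in> C" "c2 \<in> C" "c3 \<in> C" "c4 \<in> C"
    "c1 \<noteq> c2" "c1 \<noteq> c3" "c1 \<noteq> c4" "c2 \<noteq> c3" "c2 \<noteq> c4" "c3 \<noteq> c4" using four_colors .
  have Nt: "u = s \<or> u = s'" if "u \<in> W" "E t u" for u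
  proof -
    have "E t u \<longleftrightarrow> u \<in> {q, q', s, s'}"
      by (rule N4) (use E_sym[OF edges(3)] E_sym[OF edges(7)] E_sym[OF a(1)] E_sym[OF a(2)] ne ne2 in auto)
    then show ?thesis using that by auto
  qed
  obtain g where g: "proper_on E W (\<lambda>_. C) g" "g s = c2" "g s' = c3" "g w = c1"
    using precolor3[of s s' w c2 c3 c1] inW ne c by auto
  have "proper_on E W (\<lambda>_. C) (g(t := c1))"
  proof (rule recolor[OF g(1) c(1) inW(2)])
    show "g u \<noteq> c1" if "u \<in> W" "E t u" for u using Nt[OF that] g c by auto
  qed
  then obtain F where F: "Col F" "\<forall>v \<in> W. F v = (g(t := c1)) v" "F q' = F s" "F q = F s'"
    using fill_both[of "g(t := c1)"] g c ne by auto
  have wt: "F w = F t" using F(2) inW g ne by auto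
  have 1: "lk (Same q' s) (Same w t)" "lk (Same q s') (Same w t)"
    using lk_if_common[OF dists(2,1) F(1,3) wt] lk_if_common[OF dists(3,1) F(1,4) wt] by auto
  obtain h where h: "proper_on E W (\<lambda>_. C) h" "h s = c1" "h s' = c3" "h w = c1"
    using precolor3[of s s' w c1 c3 c1] inW ne c n by auto
  have "proper_on E W (\<lambda>_. C) (h(t := c2))"
  proof (rule recolor[OF h(1) c(2) inW(2)])
    show "h u \<noteq> c2" if "u \<in> W" "E t u" for u using Nt[OF that] h c by auto
  qed
  then obtain G where G: "Col G" "\<forall>v \<in> W. G v = (h(t := c2)) v" "G q = G s'"
    using fill_s'[of "h(t := c2)"] h c ne by auto
  have "G s = G w" using G(2) inW h ne by auto
  then have 2: "lk (Same s w) (Same q s')" using lk_if_common[OF dists(4)[OF n(1)] dists(3) G(1) _ G(3)] by auto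
  show ?thesis
    by (rule finish_q[OF lk_Same[OF dists(1)] 1(1) _ _ Same_ne[OF dists(1)]])
      (use lk_trans2[OF 2 dists(3) 1(2)] a in auto)
qed

text \<open>The colors of \<open>w\<close> and \<open>t\<close> are chosen anew. The color
  \<open>\<gamma>\<close> on both of them links three pairs at once, and \<open>w\<close> can take
  the color of \<open>s\<close> unless \<open>w2\<close> has it, which links the pair
  \<open>s\<close>, \<open>w\<close>.\<close>

lemma opposite_side_colors:
  assumes a: "E s t" "E s' w" and n: "\<not> E s w" "\<not> E s' t"
    and w2: "\<And>u. u \<in> W \<Longrightarrow> E w u \<longleftrightarrow> u = s' \<or> u = w2"
    and t2: "\<And>u. u \<in> W \<Longrightarrow> E t u \<longleftrightarrow> u = s \<or> u = t2"
    and g: "proper_on E W (\<lambda>_. C) g" "g s \<noteq> g s'"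
    and \<gamma>: "\<gamma> \<in> C" "\<gamma> \<noteq> g s" "\<gamma> \<noteq> g s'" "\<gamma> \<noteq> g w2" "\<gamma> \<noteq> g t2" and ww: "g w2 \<noteq> g s"
  shows swap_conn
proof -
  have re: "proper_on E W (\<lambda>_. C) (g(w := \<delta>, t := \<gamma>))" if d: "\<delta> \<in> C" "\<delta> \<noteq> g s'" "\<delta> \<noteq> g w2" for \<delta>
  proof -
    have 1: "proper_on E W (\<lambda>_. C) (g(w := \<delta>))"
    proof (rule recolor[OF g(1) d(1) inW(1)])
      show "g u \<noteq> \<delta>" if "u \<in> W" "E w u" for u using w2[OF that(1)] that(2) d by auto
    qed
    show ?thesis
    proof (rule recolor[OF 1 \<gamma>(1) inW(2)])
      show "(g(w := \<delta>)) u \<noteq> \<gamma>" if "u \<in> W" "E t u" for u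
        using t2[OF that(1)] that(2) \<gamma> nonadj by auto
    qed
  qed
  obtain F where F: "Col F" "\<forall>v \<in> W. F v = (g(w := \<gamma>, t := \<gamma>)) v" "F q' = F s" "F q = F s'"
    using fill_both[OF re[OF \<gamma>(1,3,4)]] g(2) \<gamma> ne by auto
  have wt: "F w = F t" using F(2) inW ne by auto
  have 1: "lk (Same q' s) (Same w t)" "lk (Same q s') (Same w t)"
    using lk_if_common[OF dists(2,1) F(1,3) wt] lk_if_common[OF dists(3,1) F(1,4) wt] by auto
  have gs: "g s \<in> C" using proper_on_inL[OF g(1) inW(3)] .
  obtain G where G: "Col G" "\<forall>v \<in> W. G v = (g(w := g s, t := \<gamma>)) v" "G q = G s'"
    using fill_s'[OF re[OF gs g(2) ww[symmetric]]] g(2) \<gamma> ne by auto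
  have "G s = G w" using G(2) inW ne by auto
  then have 2: "lk (Same s w) (Same q s')" using lk_if_common[OF dists(4)[OF n(1)] dists(3) G(1) _ G(3)] by auto
  show ?thesis
    by (rule finish_q[OF lk_Same[OF dists(1)] 1(1) _ _ Same_ne[OF dists(1)]])
      (use lk_trans2[OF 2 dists(3) 1(2)] a in auto)
qed

text \<open>Here the argument can only fail if \<open>G\<close> is the square of the cycle on eight vertices.\<close>

lemma swap_conn_opposite_side:
  assumes a: "E s t" "E s' w" and n: "\<not> E s w" "\<not> E s' t"
  shows swap_conn
proof (rule ccontr)
  assume no: "\<not> swap_conn"
  have a': "E t s" "E w s'" "\<not> E w s" "\<not> E t s'" using a n E_sym by blast+
  obtain w2 where w2: "\<And>u. u \<in> W \<Longrightarrow> E w u \<longleftrightarrow> u = s' \<or> u = w2" "w2 \<in> W" "w2 \<noteq> s'"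
    using W_neighbors_with[OF _ a'(2) inW(4)] by blast
  obtain t2 where t2: "\<And>u. u \<in> W \<Longrightarrow> E t u \<longleftrightarrow> u = s \<or> u = t2" "t2 \<in> W" "t2 \<noteq> s"
    using W_neighbors_with[OF _ a'(1) inW(3)] by blast
  have ww2: "E w w2" "E t t2" using w2 t2 by auto
  have d: "w2 \<noteq> s" "w2 \<noteq> t" "w2 \<noteq> w" "w2 \<noteq> q" "w2 \<noteq> q'" "t2 \<noteq> s'" "t2 \<noteq> w" "t2 \<noteq> t" "t2 \<noteq> q" "t2 \<noteq> q'"
    using ww2 a' nonadj E_irr w2 t2 by auto
  \<comment> \<open>Failure confines every such coloring to two patterns: \<open>w2\<close> and
    \<open>t2\<close> repeat the colors of \<open>s\<close> and \<open>s'\<close>, or all four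
    colors are distinct. A precoloring that violates both patterns is impossible, which forces
    edges.\<close>
  have key: "(g w2 = g s \<and> g t2 = g s') \<or>
      (g w2 \<noteq> g s \<and> g w2 \<noteq> g s' \<and> g t2 \<noteq> g s \<and> g t2 \<noteq> g s' \<and> g w2 \<noteq> g t2)"
    if g: "proper_on E W (\<lambda>_. C) g" "g s \<noteq> g s'" for g
  proof (cases "C \<subseteq> {g s, g s', g w2, g t2}")
    case True
    then have "4 \<le> card {g s, g s', g w2, g t2}" using card_mono[OF _ True] cardC k4 by auto
    then show ?thesis by (auto simp: card_insert_if split: if_splits)
  next
    case False
    then obtain \<gamma> where \<gamma>: "\<gamma> \<in> C" "\<gamma> \<noteq> g s" "\<gamma> \<noteq> g s'" "\<gamma> \<noteq> g w2" "\<gamma> \<noteq> g t2" by blast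
    have 1: "g w2 = g s"
    proof (rule ccontr)
      assume "g w2 \<noteq> g s"
      from opposite_side_colors[OF a n w2(1) t2(1) g \<gamma> this] no show False by blast
    qed
    have W': "V - {q', q} = W" by auto
    have 2: "g t2 = g s'"
    proof (rule ccontr)
      assume x: "g t2 \<noteq> g s'"
      have dd: "diamond V E k C q' q t w s' s"
        by (rule diamond.diamond_swap_w_t[OF diamond_swap_q])
      have swap_conn
        by (rule diamond.opposite_side_colors[OF dd a(2,1) n(2,1), unfolded W', OF t2(1) w2(1) g(1) g(2)[symmetric]
              \<gamma>(1,3,2,5,4) x])
      then show False using no by blast
    qed
    show ?thesis using 1 2 by blast
  qed
  obtain c1 c2 c3 c4 where c: "c1 \<in> C" "c2 \<in> C" "c3 \<in> C" "c4 \<in> C"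
    "c1 \<noteq> c2" "c1 \<noteq> c3" "c1 \<noteq> c4" "c2 \<noteq> c3" "c2 \<noteq> c4" "c3 \<noteq> c4" using four_colors .
  have ws': "E w2 s'"
  proof (rule ccontr)
    assume x: "\<not> E w2 s'"
    then have "\<not> E s' w2" using E_sym by blast
    then obtain g where g: "proper_on E W (\<lambda>_. C) g" "g s = c2" "g s' = c3" "g w2 = c3"
      using precolor3[of s s' w2 c2 c3 c3] inW w2(2,3) d ne c by auto
    show False using key[OF g(1)] g c by auto
  qed
  have ts: "E t2 s"
  proof (rule ccontr)
    assume x: "\<not> E t2 s"
    then have "\<not> E s t2" using E_sym by blast
    then obtain g where g: "proper_on E W (\<lambda>_. C) g" "g s = c2" "g s' = c3" "g t2 = c2"
      using precolor3[of s s' t2 c2 c3 c2] inW t2(2,3) d ne c by auto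
    show False using key[OF g(1)] g c by auto
  qed
  have wt2: "w2 \<noteq> t2"
  proof
    assume x: "w2 = t2"
    obtain g where g: "proper_on E W (\<lambda>_. C) g" "g s = c2" "g s' = c3"
      using precolor3[of s s' w c2 c3 c1] inW ne c by auto
    show False using key[OF g(1)] g c x by auto
  qed
  obtain s1 where s1: "E s s1" "s1 \<noteq> q" "s1 \<noteq> t" "s1 \<noteq> t2" using other_neighbor3[OF inV(5)] by blast
  have Ns: "E s u \<longleftrightarrow> u \<in> {q, t, t2, s1}" for u
    by (rule N4) (use E_sym[OF edges(4)] a E_sym[OF ts] s1 ne2 d in auto)
  have key2: "g w2 \<noteq> g s \<and> g w2 \<noteq> g s' \<and> g t2 \<noteq> g s \<and> g t2 \<noteq> g s' \<and> g w2 \<noteq> g t2"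
    if g: "proper_on E W (\<lambda>_. C) g" "g s \<noteq> g s'" for g
  proof (rule ccontr)
    assume "\<not> ?thesis"
    then have II: "g w2 = g s" "g t2 = g s'" using key[OF g] by blast+
    \<comment> \<open>The first pattern is destroyed by recoloring \<open>s\<close> with
      \<open>\<nu>\<close>, after \<open>t\<close> has made room.\<close>
    obtain \<nu> where \<nu>: "\<nu> \<in> C" "\<nu> \<noteq> g s" "\<nu> \<noteq> g s'" "\<nu> \<noteq> g s1" using color_avoiding .
    obtain \<tau> where \<tau>: "\<tau> \<in> C" "\<tau> \<noteq> g s" "\<tau> \<noteq> g t2" "\<tau> \<noteq> \<nu>" using color_avoiding .
    have 1: "proper_on E W (\<lambda>_. C) (g(t := \<tau>))"
    proof (rule recolor[OF g(1) \<tau>(1) inW(2)])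
      show "g u \<noteq> \<tau>" if "u \<in> W" "E t u" for u using t2(1)[OF that(1)] that(2) \<tau> by auto
    qed
    have 2: "proper_on E W (\<lambda>_. C) (g(t := \<tau>, s := \<nu>))"
    proof (rule recolor[OF 1 \<nu>(1) inW(3)])
      show "(g(t := \<tau>)) u \<noteq> \<nu>" if "u \<in> W" "E s u" for u using Ns[of u] that \<tau> \<nu> II by auto
    qed
    show False using key[OF 2] II \<nu> g(2) d ne t2(3) by auto
  qed
  have w2s: "E w2 s"
  proof (rule ccontr)
    assume x: "\<not> E w2 s"
    then have "\<not> E s w2" using E_sym by blast
    then obtain g where g: "proper_on E W (\<lambda>_. C) g" "g s = c2" "g s' = c3" "g w2 = c2"
      using precolor3[of s s' w2 c2 c3 c2] inW w2(2,3) d ne c by auto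
    show False using key2[OF g(1)] g c by auto
  qed
  have t2s: "E t2 s'"
  proof (rule ccontr)
    assume x: "\<not> E t2 s'"
    then have "\<not> E s' t2" using E_sym by blast
    then obtain g where g: "proper_on E W (\<lambda>_. C) g" "g s = c2" "g s' = c3" "g t2 = c3"
      using precolor3[of s s' t2 c2 c3 c3] inW t2(2,3) d ne c by auto
    show False using key2[OF g(1)] g c by auto
  qed
  have Ns: "E s u \<longleftrightarrow> u \<in> {q, t, t2, w2}" for u
    by (rule N4) (use E_sym[OF edges(4)] a E_sym[OF ts] E_sym[OF w2s] ne2 d wt2 in auto)
  have Ns': "E s' u \<longleftrightarrow> u \<in> {q', w, t2, w2}" for u
    by (rule N4) (use E_sym[OF edges(8)] a E_sym[OF t2s] E_sym[OF ws'] ne2 d wt2 in auto)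
  have Nw: "E w u \<longleftrightarrow> u \<in> {q, q', s', w2}" for u
    by (rule N4) (use E_sym[OF edges(2)] E_sym[OF edges(6)] a' ww2 ne ne2 d w2 in auto)
  have Nt: "E t u \<longleftrightarrow> u \<in> {q, q', s, t2}" for u
    by (rule N4) (use E_sym[OF edges(3)] E_sym[OF edges(7)] a' ww2 ne ne2 d t2 in auto)
  \<comment> \<open>All six neighborhoods are known and lead out of this set only to
    \<open>w2\<close> and \<open>t2\<close>, so the graph has eight vertices.\<close>
  let ?D = "{q, q', w, t, s, s'}"
  have inS: "{w2, t2} \<subseteq> V" "card {w2, t2} < 4" using w2 t2 by (auto simp: card_insert_if)
  have "closed_in E (V - {w2, t2}) ?D"
    unfolding closed_in_def
  proof (intro conjI ballI impI)
    show "?D \<subseteq> V - {w2, t2}" using inV d w2(3) t2(3) by auto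
    fix u v assume "u \<in> ?D" "v \<in> V - {w2, t2}" "E u v"
    then show "v \<in> ?D" using Nq[of v] Nq'[of v] Nw[of v] Nt[of v] Ns[of v] Ns'[of v] by auto
  qed
  from conn[OF inS _ this] have eqD: "?D = V - {w2, t2}" by simp
  have V8: "V \<subseteq> ?D \<union> {w2, t2}" unfolding eqD by blast
  have na: "\<not> E q w2" "\<not> E w2 q" "\<not> E q' t2" "\<not> E t2 q'" "\<not> E w t2" "\<not> E t2 w" "\<not> E s s'" "\<not> E s' s"
  proof -
    show 1: "\<not> E q w2" using Nq[of w2] d by auto
    show 2: "\<not> E q' t2" using Nq'[of t2] d by auto
    show 3: "\<not> E w t2" using Nw[of t2] d wt2 by auto
    show 4: "\<not> E s s'" using Ns[of s'] ne d w2(3) by auto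
    show "\<not> E w2 q" "\<not> E t2 q'" "\<not> E t2 w" "\<not> E s' s" using 1 2 3 4 E_sym by blast+
  qed
  have dq: "dist2 q w2" using dist2I[OF E_sym[OF edges(2)] ww2(1)] na d by auto
  \<comment> \<open>Partitions of the eight vertices into four nonadjacent pairs link every pair at
    \<open>q\<close> to the pair \<open>q\<close>, \<open>w2\<close>.\<close>
  have 1: "lk (Same w t) (Same q w2)"
    by (rule coloring_by_classes[of "{w, t}" "{q, w2}" "{s, s'}" "{q', t2}"])
      (use V8 na nonadj E_irr dists(1) dq d ne2 in auto)
  have 2: "lk (Same q' s) (Same q w2)"
    by (rule coloring_by_classes[of "{q', s}" "{q, w2}" "{t, s'}" "{w, t2}"])
      (use V8 na nonadj n a' E_irr dists(2) dq d ne ne2 in auto)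
  have 3: "lk (Same s w) (Same q w2)"
    by (rule coloring_by_classes[of "{s, w}" "{q, w2}" "{t, s'}" "{q', t2}"])
      (use V8 na nonadj n a' E_irr dists(4)[OF n(1)] dq d ne ne2 in auto)
  have swap_conn
    by (rule finish_q[OF 1 2 3 _ Same_ne[OF dq]]) (use a in auto)
  then show False using no by blast
qed

text \<open>The ten cases cover all possible edges between \<open>{s, s'}\<close> and
  \<open>{w, t}\<close>; up to the two symmetries they are the four situations above.\<close>

lemma swap_conn_diamond: swap_conn
proof -
  note wt = diamond_swap_w_t and qq = diamond_swap_q
  consider "E s w" "E s t" | "E s' w" "E s' t" | "\<not> E s' w" "\<not> E s' t" "\<not> E s w" |
    "\<not> E s' w" "\<not> E s' t" "\<not> E s t" | "\<not> E s w" "\<not> E s t" "\<not> E s' w" |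
    "\<not> E s w" "\<not> E s t" "\<not> E s' t" | "E s t" "E s' t" "\<not> E s w" "\<not> E s' w" |
    "E s w" "E s' w" "\<not> E s t" "\<not> E s' t" | "E s t" "E s' w" "\<not> E s w" "\<not> E s' t" |
    "E s w" "E s' t" "\<not> E s t" "\<not> E s' w" by blast
  then show ?thesis
  proof cases
    case 1 then show ?thesis by (rule swap_conn_both)
  next
    case 2 then show ?thesis by (rule diamond.swap_conn_both[OF qq])
  next
    case 3 then show ?thesis by (rule swap_conn_none)
  next
    case 4
    show ?thesis by (rule diamond.swap_conn_none[OF wt 4(2,1,3)])
  next
    case 5
    show ?thesis by (rule diamond.swap_conn_none[OF qq 5])
  next
    case 6
    show ?thesis by (rule diamond.swap_conn_none[OF diamond.diamond_swap_w_t[OF qq] 6(2,1,3)])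
  next
    case 7 then show ?thesis by (rule swap_conn_same_side)
  next
    case 8 then show ?thesis by (rule diamond.swap_conn_same_side[OF wt])
  next
    case 9 then show ?thesis by (rule swap_conn_opposite_side)
  next
    case 10 then show ?thesis by (rule diamond.swap_conn_opposite_side[OF wt])
  qed
qed

end

text \<open>Every edge lies in exactly one triangle, so the neighborhood of each vertex consists of
  two disjoint edges.\<close>

locale linear_triangles = quartic +
  assumes uniq: "E u v \<Longrightarrow> E u y \<Longrightarrow> E v y \<Longrightarrow> E u z \<Longrightarrow> E v z \<Longrightarrow> y = z"
    and third: "E u v \<Longrightarrow> \<exists>y. E u y \<and> E v y"
begin

lemma other_triangle:
  assumes "E v a" "E v b" "E a b"
  obtains c d where "E v c" "E v d" "E c d" "\<And>u. E v u \<longleftrightarrow> u \<in> {a, b, c, d}"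
    "c \<noteq> a" "c \<noteq> b" "d \<noteq> a" "d \<noteq> b" "\<not> E a c" "\<not> E a d" "\<not> E b c" "\<not> E b d"
proof -
  have ba: "E b a" using E_sym[OF assms(3)] .
  obtain c where c: "E v c" "c \<noteq> a" "c \<noteq> b" using other_neighbor3[OF E_V[OF assms(1)], of a b a] by blast
  obtain d where d: "E v d" "E c d" using third[OF c(1)] by blast
  have ac: "\<not> E a c" using uniq[OF assms(1,2,3) c(1)] c by blast
  have bc: "\<not> E b c" using uniq[OF assms(2,1) ba c(1)] c by blast
  have da: "d \<noteq> a" "d \<noteq> b" using d E_sym ac bc by blast+
  have ad: "\<not> E a d" using uniq[OF assms(1,2,3) d(1)] da by blast
  have bd: "\<not> E b d" using uniq[OF assms(2,1) ba d(1)] da by blast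
  have "E v u \<longleftrightarrow> u \<in> {a, b, c, d}" for u
    by (rule N4) (use assms c d da E_neq[OF assms(3)] E_neq[OF d(2)] in auto)
  then show ?thesis using that c d ac bc ad bd da by blast
qed

text \<open>The hypotheses describe the product of two triangles with rows \<open>w x a\<close>,
  \<open>q b1 a1\<close>, \<open>q' b2 a2\<close>; closedness shows that there are no further
  vertices. Two colorings lead through the pair \<open>w\<close>, \<open>b1\<close>.\<close>

lemma lk_grid:
  assumes N: "\<And>u. E w u \<longleftrightarrow> u \<in> {x, a, q, q'}" "\<And>u. E x u \<longleftrightarrow> u \<in> {w, a, b1, b2}"
    "\<And>u. E a u \<longleftrightarrow> u \<in> {w, x, a1, a2}" "\<And>u. E q u \<longleftrightarrow> u \<in> {w, q', a1, b1}"
    "\<And>u. E q' u \<longleftrightarrow> u \<in> {w, q, a2, b2}" "\<And>u. E a1 u \<longleftrightarrow> u \<in> {a, a2, q, b1}"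
    "\<And>u. E a2 u \<longleftrightarrow> u \<in> {a, a1, q', b2}" "\<And>u. E b1 u \<longleftrightarrow> u \<in> {x, b2, q, a1}"
    "\<And>u. E b2 u \<longleftrightarrow> u \<in> {x, b1, q', a2}"
    and dst: "distinct [w, x, a, q, q', a1, a2, b1, b2]"
  shows "lk (Same x q) (Same x q')"
proof -
  let ?V = "{w, x, a, q, q', a1, a2, b1, b2}"
  have inV: "?V \<subseteq> V"
  proof -
    have e: "E w x" "E w a" "E w q" "E w q'" "E x b1" "E x b2" "E a a1" "E a a2" using N by auto
    show ?thesis using E_V[OF e(1)] e[THEN E_V2] by simp
  qed
  have cl: "closed_in E (V - {}) ?V"
    unfolding closed_in_def
  proof (intro conjI ballI impI)
    show "?V \<subseteq> V - {}" using inV by simp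
    fix u v assume "u \<in> ?V" "E u v"
    then show "v \<in> ?V"
      using N(1)[of v] N(2)[of v] N(3)[of v] N(4)[of v] N(5)[of v] N(6)[of v] N(7)[of v] N(8)[of v] N(9)[of v]
      by auto
  qed
  from conn[OF _ _ _ cl] have Veq: "?V = V - {}" by simp
  then have V9: "V \<subseteq> ?V" by blast
  have d: "dist2 x q" "dist2 x q'" "dist2 w b1"
  proof -
    show "dist2 x q" by (rule dist2I[of w]) (use N dst in auto)
    show "dist2 x q'" by (rule dist2I[of w]) (use N dst in auto)
    show "dist2 w b1" by (rule dist2I[of x]) (use N dst in auto)
  qed
  have 1: "lk (Same x q) (Same w b1)"
    by (rule coloring_by_classes[of "{x, q, a2}" "{w, b1}" "{a, q'}" "{a1, b2}"])
      (use V9 N dst d in auto)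
  have 2: "lk (Same w b1) (Same x q')"
    by (rule coloring_by_classes[of "{w, b1, a2}" "{x, q', a1}" "{a, q, b2}" "{}"])
      (use V9 N dst d in auto)
  show ?thesis using lk_trans2[OF 1 d(3) 2] .
qed

text \<open>A vertex at distance two from \<open>x\<close> that is adjacent neither to \<open>q\<close> nor to \<open>q'\<close> provides the link;
  otherwise \<open>G\<close> is the Cartesian product of two triangles.\<close>

lemma lk_triangle_side:
  assumes w: "E w x" "E w a" "E x a" "E w q" "E w q'" "E q q'"
    and ne: "x \<noteq> q" "x \<noteq> q'" "\<not> E x q" "\<not> E x q'" "\<not> E a q" "\<not> E a q'" "a \<noteq> q" "a \<noteq> q'"
  shows "lk (Same x q) (Same x q')"
proof (rule ccontr)
  assume no: "\<not> ?thesis"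
  have dq: "dist2 x q" "dist2 x q'" using dist2I[OF w(1,4)] dist2I[OF w(1,5)] ne by auto
  have z: "z = q \<or> z = q' \<or> E z q \<or> E z q'" if zz: "dist2 x z" for z
  proof (rule ccontr)
    assume n: "\<not> ?thesis"
    then have "\<not> E q z" using E_sym by blast
    then have 1: "lk (Same x q) (Same x z)" using lk_triple[OF dq(1) zz] n by auto
    have 2: "lk (Same x z) (Same x q')" using lk_triple[OF zz dq(2)] n by auto
    show False using lk_trans2[OF 1 zz 2] no by blast
  qed
  have Nw: "E w u \<longleftrightarrow> u \<in> {x, a, q, q'}" for u
    by (rule N4) (use w ne E_neq[OF w(3)] E_neq[OF w(6)] in auto)
  have xw: "E x w" "E a w" "E q w" "E q' w" "E q' q" "E a x" using w E_sym by blast+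
  obtain b1' b2' where b': "E x b1'" "E x b2'" "E b1' b2'" "\<And>u. E x u \<longleftrightarrow> u \<in> {w, a, b1', b2'}"
    "b1' \<noteq> w" "b1' \<noteq> a" "b2' \<noteq> w" "b2' \<noteq> a" "\<not> E w b1'" "\<not> E w b2'" "\<not> E a b1'" "\<not> E a b2'"
    using other_triangle[OF xw(1) w(3,2)] by blast
  obtain a1' a2' where a': "E a a1'" "E a a2'" "E a1' a2'" "\<And>u. E a u \<longleftrightarrow> u \<in> {w, x, a1', a2'}"
    "a1' \<noteq> w" "a1' \<noteq> x" "a2' \<noteq> w" "a2' \<noteq> x" "\<not> E w a1'" "\<not> E w a2'" "\<not> E x a1'" "\<not> E x a2'"
    using other_triangle[OF xw(2,6) w(1)] by blast
  have za: "E u q \<or> E u q'" if "u = a1' \<or> u = a2'" for u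
  proof -
    have "dist2 x u" using dist2I[OF xw(6), of u] a' that by auto
    moreover have "u \<noteq> q" "u \<noteq> q'" using a' that ne by auto
    ultimately show ?thesis using z by blast
  qed
  have nb: "\<not> (E u p \<and> E v p)" if "E y u" "E y v" "E u v" "y \<noteq> p" for u v y p
    using uniq[OF that(3) E_sym[OF that(1)] E_sym[OF that(2)], of p] that(4) by blast
  have na: "\<not> (E a1' q \<and> E a2' q)" "\<not> (E a1' q' \<and> E a2' q')"
    using nb[OF a'(1,2,3)] ne by blast+
  \<comment> \<open>One vertex of the second triangle at \<open>a\<close> is adjacent to
    \<open>q\<close> and the other to \<open>q'\<close>: a common neighbor of both besides
    \<open>a\<close> would put their edge into two triangles. They are named accordingly.\<close>
  obtain a1 a2 where a12: "E a a1" "E a a2" "E a1 a2" "\<And>u. E a u \<longleftrightarrow> u \<in> {w, x, a1, a2}"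
    "a1 \<noteq> w" "a1 \<noteq> x" "a2 \<noteq> w" "a2 \<noteq> x" "\<not> E w a1" "\<not> E w a2" "\<not> E x a1" "\<not> E x a2" "E a1 q" "E a2 q'"
  proof (cases "E a1' q")
    case True
    then have "E a2' q'" using na za by blast
    then show ?thesis using that[of a1' a2'] a' True by blast
  next
    case False
    then have q: "E a1' q'" "E a2' q" using na za by blast+
    have "E a u \<longleftrightarrow> u \<in> {w, x, a2', a1'}" for u using a'(4) by blast
    then show ?thesis using that[of a2' a1'] a' q E_sym[OF a'(3)] by blast
  qed
  have aq: "E q a1" "E q' a2" "E a2 a1" "E a1 a" "E a2 a" using a12 E_sym by blast+
  \<comment> \<open>\<open>s2\<close> and \<open>s4\<close> complete the triangles on the edges
    \<open>q a1\<close> and \<open>q' a2\<close>; in the end they turn out to be \<open>b1\<close>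
    and \<open>b2\<close>.\<close>
  obtain s2 where s2: "E q s2" "E a1 s2" using third[OF aq(1)] by blast
  obtain s4 where s4: "E q' s4" "E a2 s4" using third[OF aq(2)] by blast
  have s2n: "s2 \<noteq> w" "s2 \<noteq> q'" "s2 \<noteq> a" "s2 \<noteq> a2"
  proof -
    show "s2 \<noteq> w" using s2 a12 E_sym by blast
    show "s2 \<noteq> q'"
    proof
      assume "s2 = q'"
      then have "E q' a1" using s2 E_sym by blast
      then show False using uniq[OF w(6) xw(3,4) aq(1)] a12 by blast
    qed
    show "s2 \<noteq> a" using s2 ne E_sym by blast
    show "s2 \<noteq> a2" using s2 nb[OF a12(1,2,3), of q] a12 ne E_sym by blast
  qed
  have s4n: "s4 \<noteq> w" "s4 \<noteq> q" "s4 \<noteq> a" "s4 \<noteq> a1"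
  proof -
    show "s4 \<noteq> w" using s4 a12 E_sym by blast
    show "s4 \<noteq> q"
    proof
      assume "s4 = q"
      then have "E q a2" using s4 E_sym by blast
      then show False using uniq[OF w(6) xw(3,4) _ aq(2)] a12 by blast
    qed
    show "s4 \<noteq> a" using s4 ne E_sym by blast
    show "s4 \<noteq> a1" using s4 nb[OF a12(1,2,3), of q'] a12 ne E_sym by blast
  qed
  have qn: "a1 \<noteq> q'" "a1 \<noteq> q" "a2 \<noteq> q" "a2 \<noteq> q'" using a12 ne by blast+
  have Nq: "E q u \<longleftrightarrow> u \<in> {w, q', a1, s2}" for u
    by (rule N4) (use xw w aq s2 s2n E_neq[OF s2(2)] E_neq[OF w(5)] a12(5) qn in auto)
  have Nq': "E q' u \<longleftrightarrow> u \<in> {w, q, a2, s4}" for u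
    by (rule N4) (use xw aq s4 s4n E_neq[OF s4(2)] E_neq[OF w(4)] a12(7) qn in auto)
  have Na1: "E a1 u \<longleftrightarrow> u \<in> {a, a2, q, s2}" for u
    by (rule N4) (use aq a12 s2 s2n ne E_neq[OF a12(2)] E_neq[OF s2(1)] qn in auto)
  have Na2: "E a2 u \<longleftrightarrow> u \<in> {a, a1, q', s4}" for u
    by (rule N4) (use aq a12 s4 s4n ne E_neq[OF a12(1)] E_neq[OF s4(1)] qn in auto)
  \<comment> \<open>If \<open>b\<close> is adjacent neither to \<open>q\<close> nor to
    \<open>q'\<close>, its triangle away from \<open>x\<close> has two further vertices at distance
    two from \<open>x\<close>, so one is a neighbor of \<open>q\<close> and one of
    \<open>q'\<close>; only \<open>s2\<close> and \<open>s4\<close> qualify.\<close>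
  have far: "E b s2 \<and> E b s4 \<and> E s2 s4"
    if b: "E x b" "b \<noteq> w" "b \<noteq> a" and n: "\<not> E b q" "\<not> E b q'" for b
  proof -
    obtain b' where bb: "E x b'" "E b b'" using third[OF b(1)] by blast
    obtain c d where c: "E b c" "E b d" "E c d" "\<And>u. E b u \<longleftrightarrow> u \<in> {x, b', c, d}"
      "c \<noteq> x" "c \<noteq> b'" "d \<noteq> x" "d \<noteq> b'" "\<not> E x c" "\<not> E x d" "\<not> E b' c" "\<not> E b' d"
      using other_triangle[OF E_sym[OF b(1)] bb(2,1)] by blast
    have zc: "E u q \<or> E u q'" if "u = c \<or> u = d" for u
    proof -
      have "dist2 x u" using dist2I[OF E_sym[OF b(1)], of u] c that by auto
      moreover have "u \<noteq> q" "u \<noteq> q'" using c that n by auto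
      ultimately show ?thesis using z by blast
    qed
    have bq: "b \<noteq> q" "b \<noteq> q'" using b(1) ne by auto
    have nc: "\<not> (E c q \<and> E d q)" "\<not> (E c q' \<and> E d q')" using nb[OF c(1,2,3)] bq by blast+
    have bne: "b \<noteq> a1" "b \<noteq> a2" "b \<noteq> s2" "b \<noteq> s4" using b(1) a12 n s2 s4 E_sym by blast+
    have nbE: "\<not> E b w" "\<not> E b a1" "\<not> E b a2"
    proof -
      have "\<not> E w b" using Nw[of b] bq b(3) E_neq[OF b(1)] by auto
      moreover have "\<not> E a1 b" using Na1[of b] bq b(3) bne by auto
      moreover have "\<not> E a2 b" using Na2[of b] bq b(3) bne by auto
      ultimately show "\<not> E b w" "\<not> E b a1" "\<not> E b a2" using E_sym by blast+
    qed
    have isS2: "u = s2" if u: "E b u" "E u q" for u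
    proof -
      have "u \<in> {w, q', a1, s2}" using Nq[of u] E_sym[OF u(2)] by blast
      moreover have "u \<noteq> w" "u \<noteq> q'" "u \<noteq> a1" using u(1) n nbE by auto
      ultimately show ?thesis by blast
    qed
    have isS4: "u = s4" if u: "E b u" "E u q'" for u
    proof -
      have "u \<in> {w, q, a2, s4}" using Nq'[of u] E_sym[OF u(2)] by blast
      moreover have "u \<noteq> w" "u \<noteq> q" "u \<noteq> a2" using u(1) n nbE by auto
      ultimately show ?thesis by blast
    qed
    show ?thesis
    proof (cases "E c q")
      case True
      then have "E d q'" using nc zc by blast
      then have "c = s2" "d = s4" using isS2[OF c(1) True] isS4[OF c(2)] by auto
      then show ?thesis using c by blast
    next
      case False
      then have "E c q'" "E d q" using nc zc by blast+
      then have "d = s2" "c = s4" using isS2[OF c(2)] isS4[OF c(1)] by auto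
      then show ?thesis using c E_sym by blast
    qed
  qed
  \<comment> \<open>A vertex \<open>b\<close> as in \<open>far\<close> would fill up the
    neighborhoods of \<open>s2\<close> and \<open>s4\<close>, which leaves no place for
    \<open>b'\<close>.\<close>
  have near: "E b q \<or> E b q'"
    if b: "E x b" "E x b'" "E b b'" "b \<noteq> w" "b \<noteq> a" "b' \<noteq> w" "b' \<noteq> a" for b b'
  proof (rule ccontr)
    assume n: "\<not> ?thesis"
    then have f: "E b s2" "E b s4" "E s2 s4" using far[OF b(1,4,5)] by blast+
    have bne: "b \<noteq> a1" "b \<noteq> a2" "b \<noteq> q" "b \<noteq> q'" using b(1) a12 ne by blast+
    have Ns2: "E s2 u \<longleftrightarrow> u \<in> {q, a1, b, s4}" for u
      by (rule N4) (use E_sym[OF s2(1)] E_sym[OF s2(2)] E_sym[OF f(1)] f(3) bne qn s4n E_neq[OF f(2)] in auto)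
    have Ns4: "E s4 u \<longleftrightarrow> u \<in> {q', a2, b, s2}" for u
      by (rule N4) (use E_sym[OF s4(1)] E_sym[OF s4(2)] E_sym[OF f(2)] E_sym[OF f(3)] bne qn s2n E_neq[OF f(1)] in auto)
    have xs2: "\<not> E x s2"
    proof
      assume "E x s2"
      then have "E s2 x" using E_sym by blast
      then have "x \<in> {q, a1, b, s4}" using Ns2[of x] by blast
      moreover have "x \<noteq> s4" using s4 ne E_sym by blast
      ultimately show False using ne a12(6) E_neq[OF b(1)] by blast
    qed
    have xs4: "\<not> E x s4"
    proof
      assume "E x s4"
      then have "E s4 x" using E_sym by blast
      then have "x \<in> {q', a2, b, s2}" using Ns4[of x] by blast
      moreover have "x \<noteq> s2" using s2 ne E_sym by blast
      ultimately show False using ne a12(8) E_neq[OF b(1)] by blast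
    qed
    show False
    proof (cases "E b' q \<or> E b' q'")
      case True
      then have "E q b' \<or> E q' b'" using E_sym by blast
      then have "b' \<in> {w, q', a1, s2} \<or> b' \<in> {w, q, a2, s4}" using Nq[of b'] Nq'[of b'] by blast
      then show False using b(2,6) ne a12 xs2 xs4 by blast
    next
      case False
      then have "E b' s2" using far[OF b(2,6,7)] by blast
      then have "E s2 b'" using E_sym by blast
      then have "b' \<in> {q, a1, b, s4}" using Ns2[of b'] by blast
      then show False using b(2) ne a12 xs4 E_neq[OF b(3)] by blast
    qed
  qed
  have n1: "E b1' q \<or> E b1' q'" using near[OF b'(1,2,3,5,6,7,8)] .
  have n2: "E b2' q \<or> E b2' q'" using near[OF b'(2,1) E_sym[OF b'(3)] b'(7,8,5,6)] .
  have nbq: "\<not> (E b1' q \<and> E b2' q)" "\<not> (E b1' q' \<and> E b2' q')" using nb[OF b'(1,2,3)] ne by blast+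
  obtain b1 b2 where b: "E x b1" "E x b2" "E b1 b2" "\<And>u. E x u \<longleftrightarrow> u \<in> {w, a, b1, b2}"
    "b1 \<noteq> w" "b1 \<noteq> a" "b2 \<noteq> w" "b2 \<noteq> a" "E b1 q" "E b2 q'"
  proof (cases "E b1' q")
    case True
    then have "E b2' q'" using nbq n2 by blast
    then show ?thesis using that[of b1' b2'] b' True by blast
  next
    case False
    then have q: "E b1' q'" "E b2' q" using nbq n1 n2 by blast+
    have "E x u \<longleftrightarrow> u \<in> {w, a, b2', b1'}" for u using b'(4) by blast
    then show ?thesis using that[of b2' b1'] b' q E_sym[OF b'(3)] by blast
  qed
  have bs: "b1 = s2" "b2 = s4"
  proof -
    have "b1 \<in> {w, q', a1, s2}" using Nq[of b1] E_sym[OF b(9)] by blast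
    then show "b1 = s2" using b ne a12 by blast
    have "b2 \<in> {w, q, a2, s4}" using Nq'[of b2] E_sym[OF b(10)] by blast
    then show "b2 = s4" using b ne a12 by blast
  qed
  have dst: "distinct [w, x, a, q, q', a1, a2, b1, b2]"
    using E_neq[OF w(1)] E_neq[OF w(2)] E_neq[OF w(3)] E_neq[OF w(4)] E_neq[OF w(5)] E_neq[OF w(6)] ne
      a12(5-8) b(5-8) E_neq[OF a12(1)] E_neq[OF a12(2)] E_neq[OF a12(3)] E_neq[OF b(1)] E_neq[OF b(2)] E_neq[OF b(3)]
      E_neq[OF b(9)] E_neq[OF b(10)] qn b(1,2) a12(11,12) by auto
  have Nb1: "E b1 u \<longleftrightarrow> u \<in> {x, b2, q, a1}" for u
    by (rule N4) (use E_sym[OF b(1)] b(3,9) bs s2(2) E_sym[OF s2(2)] dst in auto)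
  have Nb2: "E b2 u \<longleftrightarrow> u \<in> {x, b1, q', a2}" for u
    by (rule N4) (use E_sym[OF b(2)] E_sym[OF b(3)] b(10) bs E_sym[OF s4(2)] dst in auto)
  have "lk (Same x q) (Same x q')"
    by (rule lk_grid[OF Nw b(4) a12(4) Nq[folded bs] Nq'[folded bs] Na1[folded bs] Na2[folded bs] Nb1 Nb2 dst])
  then show False using no by blast
qed

text \<open>The pairs around \<open>w\<close> join an end of \<open>x a\<close> to an end of
  \<open>q q'\<close>. They form a cycle of four, and three of its links suffice.\<close>

lemma swap_conn_linear: swap_conn
proof -
  have "V \<noteq> {}" using big by auto
  then obtain w where w: "w \<in> V" by blast
  obtain x where x: "E w x" using other_neighbor3[OF w] by blast
  obtain a where a: "E w a" "E x a" using third[OF x] by blast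
  obtain q q' where q: "E w q" "E w q'" "E q q'" "\<And>u. E w u \<longleftrightarrow> u \<in> {x, a, q, q'}"
    "q \<noteq> x" "q \<noteq> a" "q' \<noteq> x" "q' \<noteq> a" "\<not> E x q" "\<not> E x q'" "\<not> E a q" "\<not> E a q'"
    using other_triangle[OF x a] by blast
  have sy: "E a x" "E q' q" "\<not> E q x" "\<not> E q' x" "\<not> E q a" "\<not> E q' a" using a q E_sym by blast+
  have 1: "lk (Same x q') (Same x q)"
    by (rule lk_triangle_side[OF x a q(2,1) sy(2)]) (use q in auto)
  have 2: "lk (Same a q') (Same a q)"
    by (rule lk_triangle_side[OF a(1) x sy(1) q(2,1) sy(2)]) (use q in auto)
  have "lk (Same q a) (Same q x)"
    by (rule lk_triangle_side[OF q(1,2,3) a(1) x sy(1)]) (use q sy in auto)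
  then have 3: "lk (Same a q) (Same x q)" using Same_sym by metis
  have daq: "dist2 a q" "dist2 x q" using dist2I[OF a(1) q(1)] dist2I[OF x q(1)] q by auto
  have 4: "lk (Same a q') (Same x q)" using lk_trans2[OF 2 daq(1) 3] .
  have all: "lk (Same u v) (Same x q)" if uv: "E w u" "E w v" "u \<noteq> v" "\<not> E u v" for u v
  proof -
    have "u \<in> {x, a, q, q'}" "v \<in> {x, a, q, q'}" using q(4) uv by blast+
    then show ?thesis
      using uv(3,4) a sy q(3) 1 3 4 lk_Same[OF daq(2)] Same_sym[of q x] Same_sym[of q' x] Same_sym[of q a] Same_sym[of q' a]
      by auto
  qed
  show ?thesis
  proof (rule finish_pairs[OF w])
    fix u v c d assume 1: "E w u" "E w v" "u \<noteq> v" "\<not> E u v" and 2: "E w c" "E w d" "c \<noteq> d" "\<not> E c d"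
    show "lk (Same u v) (Same c d)" using lk_trans2[OF all[OF 1] daq(2) lk_sym[OF all[OF 2]]] .
  qed
qed

end

section \<open>Assembling the 4-regular case\<close>

context quartic
begin

text \<open>An edge in two triangles gives a diamond or, if its ends have three common neighbors, an
  independent set that contains all pairs. Otherwise every edge lies in exactly one triangle, or
  some edge \<open>v a\<close> lies in none.\<close>

lemma swap_conn_quartic: swap_conn
proof (cases "\<exists>q q' w t. E q q' \<and> E q w \<and> E q' w \<and> E q t \<and> E q' t \<and> w \<noteq> t")
  case True
  then obtain q q' w t where e: "E q q'" "E q w" "E q' w" "E q t" "E q' t" and wt: "w \<noteq> t" by blast
  have qV: "q \<in> V" "q' \<in> V" using e E_V by blast+
  have qn: "w \<noteq> q'" "t \<noteq> q'" "w \<noteq> q" "t \<noteq> q" using e E_irr by auto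
  obtain s where s: "E q s" "s \<noteq> q'" "s \<noteq> w" "s \<noteq> t" using other_neighbor3[OF qV(1)] by blast
  have Nq: "E q v \<longleftrightarrow> v \<in> {q', w, t, s}" for v by (rule N4) (use e s wt qn in auto)
  show ?thesis
  proof (cases "E q' s")
    case True
    let ?I = "{w, t, s}"
    have q'I: "E q' u" "E q u" if "u \<in> ?I" for u using that e s True by auto
    have ind: "\<not> E u v" if "u \<in> ?I" "v \<in> ?I" for u v
      using noK4[OF e(1) q'I(2)[OF that(1)] q'I(2)[OF that(2)] q'I(1)[OF that(1)] q'I(1)[OF that(2)]] .
    show ?thesis
    proof (rule finish_pairs[OF qV(1)])
      fix x y a b assume *: "E q x" "E q y" "x \<noteq> y" "\<not> E x y" "E q a" "E q b" "a \<noteq> b" "\<not> E a b"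
      have inI: "u \<in> ?I" if "E q u" "E q v" "u \<noteq> v" "\<not> E u v" for u v
      proof -
        have "u \<noteq> q'"
        proof
          assume u: "u = q'"
          then have "v \<in> ?I" using Nq[of v] that by auto
          then show False using q'I that u by blast
        qed
        then show ?thesis using Nq[of u] that(1) by auto
      qed
      have r: "\<not> E y x" "\<not> E b a" using * E_sym by blast+
      have 4: "x \<in> ?I" "y \<in> ?I" "a \<in> ?I" "b \<in> ?I"
        using inI[OF *(1-4)] inI[OF *(2,1) *(3)[symmetric] r(1)] inI[OF *(5-8)] inI[OF *(6,5) *(7)[symmetric] r(2)]
        by auto
      show "lk (Same x y) (Same a b)"
        by (rule lk_independent[where w = q and I = ?I, OF q'I(2) ind 4(1,2) *(3) 4(3,4) *(7)])
    qed
  next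
    case False
    obtain s' where s': "E q' s'" "s' \<noteq> q" "s' \<noteq> w" "s' \<noteq> t" using other_neighbor3[OF qV(2)] by blast
    have Nq': "E q' v \<longleftrightarrow> v \<in> {q, w, t, s'}" for v
      by (rule N4) (use E_sym[OF e(1)] e s' wt qn in auto)
    have "s \<noteq> s'" using False s' by auto
    then interpret diamond V E k C q q' w t s s'
      by unfold_locales (use Nq Nq' s s' wt in auto)
    show ?thesis by (rule swap_conn_diamond)
  qed
next
  case nod: False
  show ?thesis
  proof (cases "\<forall>u v. E u v \<longrightarrow> (\<exists>y. E u y \<and> E v y)")
    case True
    interpret linear_triangles V E k C
      by unfold_locales (use True nod in blast)+
    show ?thesis by (rule swap_conn_linear)
  next
    case False
    then obtain v a where va: "E v a" and iso: "\<And>y. E v y \<Longrightarrow> \<not> E a y" by blast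
    have vV: "v \<in> V" using E_V[OF va] .
    obtain b where b: "E v b" "b \<noteq> a" using other_neighbor3[OF vV] by blast
    obtain c where c: "E v c" "c \<noteq> a" "c \<noteq> b" using other_neighbor3[OF vV] by blast
    obtain d where d: "E v d" "d \<noteq> a" "d \<noteq> b" "d \<noteq> c" using other_neighbor3[OF vV] by blast
    have Nv: "E v u \<longleftrightarrow> u \<in> {a, b, c, d}" for u by (rule N4) (use va b c d in auto)
    \<comment> \<open>No edge at \<open>v\<close> lies in two triangles, so \<open>N v\<close>
      induces a graph of maximum degree one. It has no edge at \<open>a\<close>, and by parity none
      at one more of the remaining three vertices. With \<open>a\<close> and this \<open>d'\<close>,
      independent triples link all pairs.\<close>
    have "\<exists>d'. E v d' \<and> d' \<noteq> a \<and> (\<forall>y. E v y \<longrightarrow> \<not> E d' y)"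
    proof (rule ccontr)
      assume neg: "\<not> ?thesis"
      have pb: "\<exists>y \<in> {b, c, d}. E u y" if uu: "E v u" "u \<noteq> a" for u
      proof -
        obtain y where y: "E v y" "E u y" using neg uu by blast
        then have "y \<noteq> a" using iso[OF uu(1)] E_sym by blast
        then show ?thesis using Nv[of y] y by blast
      qed
      have two: False if "E v p" "E p r" "E p r'" "E v r" "E v r'" "r \<noteq> r'" for p r r'
        using nod that by blast
      obtain y where y: "y \<in> {b, c, d}" "E b y" using pb[OF b] by blast
      have yv: "E v y" "y \<noteq> b" using y b c d E_irr by auto
      obtain u where u: "u \<in> {c, d}" "u \<noteq> y" using d by blast
      have uv: "E v u" "u \<noteq> a" "u \<noteq> b" using u c d by auto
      obtain z where z: "z \<in> {b, c, d}" "E u z" using pb[OF uv(1,2)] by blast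
      have "z = b \<or> z = y" using z u y yv E_irr by auto
      then show False
      proof
        assume "z = b"
        then have "E b u" using z E_sym by blast
        then show False using two[OF b(1) y(2)] yv uv u by blast
      next
        assume "z = y"
        then have "E y u" using z E_sym by blast
        then show False using two[OF yv(1) E_sym[OF y(2)]] b uv by blast
      qed
    qed
    then obtain d' where d': "E v d'" "d' \<noteq> a" "\<And>y. E v y \<Longrightarrow> \<not> E d' y" by blast
    have ad: "dist2 a d'" using dist2I[OF va d'(1)] iso d' by auto
    have da: "dist2 d' a" using dist2_sym[OF ad] .
    have va2: "lk (Same a y) (Same a d')" if "E v y" "y \<noteq> a" for y
    proof (cases "y = d'")
      case True then show ?thesis using lk_Same[OF ad] by simp
    next
      case False
      have "\<not> E y d'" using d'(3)[OF that(1)] E_sym by blast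
      then show ?thesis using lk_triple[OF dist2I[OF va that(1)] ad False] that iso by auto
    qed
    have all: "lk (Same x y) (Same a d')" if xy: "E v x" "E v y" "x \<noteq> y" "\<not> E x y" for x y
    proof -
      consider "x = a" | "y = a" | "x \<noteq> a" "y \<noteq> a" by blast
      then show ?thesis
      proof cases
        case 1 then show ?thesis using va2 xy by auto
      next
        case 2 then show ?thesis using va2[of x] xy Same_sym[of x a] by auto
      next
        case 3
        have dx: "dist2 x a" using dist2I[OF xy(1) va] 3 iso[OF xy(1)] E_sym by blast
        have "lk (Same x y) (Same x a)"
          using lk_triple[OF dist2I[OF xy] dx] 3 iso[OF xy(2)] E_sym by blast
        then show ?thesis using lk_trans2[OF _ dx] va2[OF xy(1) 3(1)] Same_sym[of a x] by simp
      qed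
    qed
    show ?thesis
    proof (rule finish_pairs[OF vV])
      fix x y p r assume 1: "E v x" "E v y" "x \<noteq> y" "\<not> E x y" and 2: "E v p" "E v r" "p \<noteq> r" "\<not> E p r"
      show "lk (Same x y) (Same p r)" using lk_trans2[OF all[OF 1] ad lk_sym[OF all[OF 2]]] .
    qed
  qed
qed

end

context conn4const
begin

theorem swap_conn_constant: swap_conn
proof (cases "\<exists>Q. Q \<subseteq> V \<and> card Q = k \<and> (\<forall>u \<in> Q. \<forall>v \<in> Q. u \<noteq> v \<longrightarrow> E u v)")
  case True
  then show ?thesis using swap_conn_clique_k by blast
next
  case noK: False
  show ?thesis
  proof (cases "\<exists>Q. Q \<subseteq> V \<and> card Q = k - 1 \<and> (\<forall>u \<in> Q. \<forall>v \<in> Q. u \<noteq> v \<longrightarrow> E u v)")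
    case False
    show ?thesis by (rule swap_conn_no_large_clique) (use False in blast)
  next
    case True
    then obtain Q where Q: "Q \<subseteq> V" "card Q = k - 1" "\<forall>u \<in> Q. \<forall>v \<in> Q. u \<noteq> v \<longrightarrow> E u v" by blast
    show ?thesis
    proof (cases "5 \<le> k")
      case True
      interpret near_clique V E k C Q
        by unfold_locales (use Q noK True in blast)+
      show ?thesis by (rule swap_conn_near_clique)
    next
      case False
      then have k4: "k = 4" using k_ge_4 by simp
      interpret quartic V E k C
      proof unfold_locales
        show "k = 4" using k4 .
        fix a b c d assume *: "E a b" "E a c" "E a d" "E b c" "E b d"
        show "\<not> E c d"
        proof
          assume cd: "E c d"
          have "{a, b, c, d} \<subseteq> V" using E_V[OF *(1)] E_V2[OF *(1)] E_V2[OF *(2)] E_V2[OF *(3)] by simp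
          moreover have "card {a, b, c, d} = k"
            using k4 E_neq[OF *(1)] E_neq[OF *(2)] E_neq[OF *(3)] E_neq[OF *(4)] E_neq[OF *(5)] E_neq[OF cd] by simp
          moreover have "\<forall>u \<in> {a, b, c, d}. \<forall>v \<in> {a, b, c, d}. u \<noteq> v \<longrightarrow> E u v"
            using * cd *[THEN E_sym] E_sym[OF cd] by auto
          ultimately show False using noK by blast
        qed
      qed
      show ?thesis by (rule swap_conn_quartic)
    qed
  qed
qed

end

section \<open>From digraphs to adjacency relations\<close>

lemma kempe_eq_lists_cong:
  assumes "\<And>v. v \<in> U \<Longrightarrow> L v = L' v"
  shows "proper_on E U L = proper_on E U L'" "kempe_eq E U L = kempe_eq E U L'"
proof -
  show 1: "proper_on E U L = proper_on E U L'" using assms unfolding proper_on_def fun_eq_iff by auto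
  show "kempe_eq E U L = kempe_eq E U L'" unfolding kempe_eq_def kempe_step_def 1 ..
qed

context graph
begin

abbreviation adj :: "'a \<Rightarrow> 'a \<Rightarrow> bool" where "adj u v \<equiv> u \<rightarrow>\<^bsub>G\<^esub> v"

lemma adj_sym: "adj u v \<Longrightarrow> adj v u"
  using sym_arcs unfolding symmetric_def by (rule symE)

lemma adj_irr: "\<not> adj u u"
  using adj_not_same by blast

lemma nb_out_degree: "card (nb adj (verts G) v) = out_degree G v"
proof -
  have "nb adj (verts G) v = head G ` out_arcs G v"
    unfolding nb_def by (auto simp: arcs_ends_conv)
  moreover have "inj_on (head G) (out_arcs G v)"
    by (rule inj_onI) (auto intro!: no_multi_arcs simp: arc_to_ends_def)
  ultimately show ?thesis unfolding out_degree_def by (simp add: card_image)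
qed

lemma adj_induced: "u \<rightarrow>\<^bsub>G \<restriction> W\<^esub> v \<longleftrightarrow> u \<in> W \<and> v \<in> W \<and> adj u v"
  by (auto simp: arcs_ends_conv)

text \<open>Connectedness is strong connectedness of the symmetric closure; a path from
  \<open>u\<close> cannot leave the closed set.\<close>

lemma closed_in_connected:
  assumes c: "Digraph_Component.connected (G \<restriction> W)" and W: "W \<subseteq> verts G"
    and D: "closed_in adj W D" "D \<noteq> {}"
  shows "D = W"
proof
  show "D \<subseteq> W" using D unfolding closed_in_def by blast
  obtain u where u: "u \<in> D" using D by blast
  then have uW: "u \<in> W" using D unfolding closed_in_def by blast
  show "W \<subseteq> D"
  proof
    fix v assume "v \<in> W"
    then have "u \<rightarrow>\<^sup>*\<^bsub>with_proj (mk_symmetric (G \<restriction> W))\<^esub> v"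
      using c uW unfolding Digraph_Component.connected_def strongly_connected_def by auto
    then have "(u, v) \<in> (arcs_ends (with_proj (mk_symmetric (G \<restriction> W))))\<^sup>*" by (rule reachable_rtranclI)
    then show "v \<in> D"
    proof (induction rule: rtrancl_induct)
      case base then show ?case using u .
    next
      case (step y z)
      then have "(y, z) \<in> parcs (mk_symmetric (G \<restriction> W))" by simp
      then have "y \<rightarrow>\<^bsub>G \<restriction> W\<^esub> z \<or> z \<rightarrow>\<^bsub>G \<restriction> W\<^esub> y" by (auto simp: parcs_mk_symmetric arcs_ends_conv)
      then have "adj y z" "z \<in> W" unfolding adj_induced using adj_sym by auto
      then show ?case using D(1) step.IH unfolding closed_in_def by blast
    qed
  qed
qed

text \<open>As arcs come in both directions, the strong component of \<open>u\<close> is the least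
  closed set that contains \<open>u\<close>.\<close>

lemma kempe_component_closed:
  fixes \<phi> :: "'a \<Rightarrow> 'c" and \<alpha> \<beta> :: 'c
  defines "W \<equiv> {v \<in> verts G. \<phi> v \<in> {\<alpha>, \<beta>}}"
  assumes u: "u \<in> W"
  shows "u \<in> kempe_component G \<phi> \<alpha> \<beta> u" "closed_in adj W (kempe_component G \<phi> \<alpha> \<beta> u)"
    "closed_in adj W K \<Longrightarrow> u \<in> K \<Longrightarrow> kempe_component G \<phi> \<alpha> \<beta> u \<subseteq> K"
proof -
  interpret H: wf_digraph "G \<restriction> W" by (rule wellformed_induce_subgraph)
  have C: "kempe_component G \<phi> \<alpha> \<beta> u = {v. u \<rightarrow>\<^sup>*\<^bsub>G \<restriction> W\<^esub> v \<and> v \<rightarrow>\<^sup>*\<^bsub>G \<restriction> W\<^esub> u}"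
    unfolding kempe_component_def pre_digraph.scc_of_def W_def ..
  show "u \<in> kempe_component G \<phi> \<alpha> \<beta> u" unfolding C using u by simp
  show "closed_in adj W (kempe_component G \<phi> \<alpha> \<beta> u)"
    unfolding closed_in_def C
  proof (intro conjI ballI impI subsetI)
    fix v assume "v \<in> {v. u \<rightarrow>\<^sup>*\<^bsub>G \<restriction> W\<^esub> v \<and> v \<rightarrow>\<^sup>*\<^bsub>G \<restriction> W\<^esub> u}"
    then show "v \<in> W" using H.reachable_in_verts(2) by auto
  next
    fix v x assume v: "v \<in> {v. u \<rightarrow>\<^sup>*\<^bsub>G \<restriction> W\<^esub> v \<and> v \<rightarrow>\<^sup>*\<^bsub>G \<restriction> W\<^esub> u}" and x: "x \<in> W" "adj v x"
    have vW: "v \<in> W" using v H.reachable_in_verts(2) by auto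
    have vx: "v \<rightarrow>\<^bsub>G \<restriction> W\<^esub> x" "x \<rightarrow>\<^bsub>G \<restriction> W\<^esub> v"
      using x vW adj_sym[OF x(2)] unfolding adj_induced by blast+
    have "u \<rightarrow>\<^sup>*\<^bsub>G \<restriction> W\<^esub> x" by (rule H.reachable_adj_trans[OF _ vx(1)]) (use v in blast)
    moreover have "x \<rightarrow>\<^sup>*\<^bsub>G \<restriction> W\<^esub> u" by (rule H.adj_reachable_trans[OF vx(2)]) (use v in blast)
    ultimately show "x \<in> {v. u \<rightarrow>\<^sup>*\<^bsub>G \<restriction> W\<^esub> v \<and> v \<rightarrow>\<^sup>*\<^bsub>G \<restriction> W\<^esub> u}" by blast
  qed
  show "kempe_component G \<phi> \<alpha> \<beta> u \<subseteq> K" if K: "closed_in adj W K" "u \<in> K"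
  proof
    fix v assume "v \<in> kempe_component G \<phi> \<alpha> \<beta> u"
    then have "u \<rightarrow>\<^sup>*\<^bsub>G \<restriction> W\<^esub> v" unfolding C by blast
    then have "(u, v) \<in> (arcs_ends (G \<restriction> W))\<^sup>*" by (rule reachable_rtranclI)
    then show "v \<in> K"
    proof (induction rule: rtrancl_induct)
      case base then show ?case using K by simp
    next
      case (step y z)
      then show ?case using K unfolding adj_induced closed_in_def by blast
    qed
  qed
qed

lemma list_colorings_proper: "\<phi> \<in> list_colorings G L \<Longrightarrow> proper_on adj (verts G) L \<phi>"
  unfolding list_colorings_def proper_on_def by auto

lemma proper_list_colorings:
  assumes "proper_on adj (verts G) L f"
  shows "restrict f (verts G) \<in> list_colorings G L"
  using assms adj_in_verts unfolding list_colorings_def proper_on_def by auto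

text \<open>A swap on a union of components is performed one component \<open>M\<close> at a time.
  Each intermediate coloring is valid for \<open>L\<close>, since it agrees with \<open>g\<close> on
  \<open>M\<close> and with \<open>f\<close> elsewhere, and the rest \<open>K - M\<close> remains
  closed.\<close>

lemma list_equivalent_swap:
  assumes "proper_on adj (verts G) L f" "proper_on adj (verts G) L g"
    "closed_in adj {v \<in> verts G. f v \<in> {\<alpha>, \<beta>}} K"
    "\<And>u. u \<in> verts G \<Longrightarrow> g u = (if u \<in> K then Transposition.transpose \<alpha> \<beta> (f u) else f u)"
  shows "list_equivalent G L (restrict f (verts G)) (restrict g (verts G))"
  using assms
proof (induction "card K" arbitrary: f K rule: less_induct)
  case less
  let ?V = "verts G"
  let ?W = "{v \<in> ?V. f v \<in> {\<alpha>, \<beta>}}"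
  have KW: "K \<subseteq> ?W" and Kcl: "\<And>u v. u \<in> K \<Longrightarrow> v \<in> ?W \<Longrightarrow> adj u v \<Longrightarrow> v \<in> K"
    using less.prems(3) unfolding closed_in_def by blast+
  have finK: "finite K" by (rule finite_subset[OF KW]) simp
  show ?case
  proof (cases "K = {}")
    case True
    then have "restrict f ?V = restrict g ?V" using less.prems(4) by auto
    then show ?thesis unfolding list_equivalent_def by simp
  next
    case False
    then obtain u where u: "u \<in> K" by blast
    define \<phi> where "\<phi> = restrict f ?V"
    define M where "M = kempe_component G \<phi> \<alpha> \<beta> u"
    have W: "{v \<in> ?V. \<phi> v \<in> {\<alpha>, \<beta>}} = ?W" unfolding \<phi>_def by auto
    have uW: "u \<in> {v \<in> ?V. \<phi> v \<in> {\<alpha>, \<beta>}}" using u KW W by blast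
    note comp = kempe_component_closed[OF uW, unfolded W, folded M_def]
    have MK: "M \<subseteq> K" using comp(3)[OF less.prems(3) u] .
    have Mcl: "\<And>x y. x \<in> M \<Longrightarrow> y \<in> ?W \<Longrightarrow> adj x y \<Longrightarrow> y \<in> M"
      using comp(2) unfolding closed_in_def by blast
    define f1 where "f1 = (\<lambda>v. if v \<in> M then Transposition.transpose \<alpha> \<beta> (f v) else f v)"
    have pair: "f1 v \<in> {\<alpha>, \<beta>} \<longleftrightarrow> f v \<in> {\<alpha>, \<beta>}" for v
      unfolding f1_def by (auto simp: Transposition.transpose_def split: if_splits)
    have cross: "f1 x \<noteq> f1 y" if "x \<in> M" "y \<in> ?V" "y \<notin> M" "adj x y" for x y
    proof -
      have "f y \<notin> {\<alpha>, \<beta>}" using Mcl[OF that(1) _ that(4)] that by blast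
      moreover have "f1 x \<in> {\<alpha>, \<beta>}" using pair[of x] that(1) MK KW by blast
      moreover have "f1 y = f y" using that(3) unfolding f1_def by simp
      ultimately show ?thesis by auto
    qed
    have p1: "proper_on adj ?V L f1"
      unfolding proper_on_def
    proof (intro conjI ballI impI)
      fix v assume v: "v \<in> ?V"
      show "f1 v \<in> L v"
      proof (cases "v \<in> M")
        case True
        then have "f1 v = g v" using less.prems(4)[OF v] MK unfolding f1_def by auto
        then show ?thesis using proper_on_inL[OF less.prems(2) v] by simp
      next
        case False then show ?thesis using proper_on_inL[OF less.prems(1) v] unfolding f1_def by simp
      qed
    next
      fix x y assume xy: "x \<in> ?V" "y \<in> ?V" "adj x y"
      consider "x \<in> M" "y \<notin> M" | "x \<notin> M" "y \<in> M" | "x \<in> M" "y \<in> M" | "x \<notin> M" "y \<notin> M" by blast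
      then show "f1 x \<noteq> f1 y"
      proof cases
        case 1 then show ?thesis using cross xy by blast
      next
        case 2 then show ?thesis using cross[of y x] xy adj_sym by metis
      next
        case 3
        have "f x \<noteq> f y" using proper_onD[OF less.prems(1) xy] .
        then show ?thesis using 3 unfolding f1_def by (metis transpose_involutory)
      next
        case 4 then show ?thesis using proper_onD[OF less.prems(1) xy] unfolding f1_def by simp
      qed
    qed
    have sw: "kempe_swap G \<alpha> \<beta> u \<phi> = restrict f1 ?V"
    proof
      fix v
      have "kempe_swap G \<alpha> \<beta> u \<phi> v = (if v \<in> M then Transposition.transpose \<alpha> \<beta> (\<phi> v) else \<phi> v)"
        unfolding kempe_swap_def M_def ..
      moreover have "v \<in> M \<Longrightarrow> v \<in> ?V" using MK KW by blast
      ultimately show "kempe_swap G \<alpha> \<beta> u \<phi> v = restrict f1 ?V v"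
        unfolding f1_def \<phi>_def by auto
    qed
    have step: "valid_kempe_step G L \<phi> (restrict f1 ?V)"
      unfolding valid_kempe_step_def
    proof (intro conjI)
      show "\<phi> \<in> list_colorings G L" using proper_list_colorings[OF less.prems(1)] unfolding \<phi>_def .
      show "restrict f1 ?V \<in> list_colorings G L" using proper_list_colorings[OF p1] .
      show "\<exists>\<alpha> \<beta>. \<exists>u \<in> ?V. \<phi> u \<in> {\<alpha>, \<beta>} \<and> restrict f1 ?V = kempe_swap G \<alpha> \<beta> u \<phi>"
        by (rule exI[of _ \<alpha>], rule exI[of _ \<beta>], rule bexI[of _ u]) (use sw uW in auto)
    qed
    have "list_equivalent G L (restrict f1 ?V) (restrict g ?V)"
    proof (rule less.hyps[of "K - M"])
      have "K - M \<subset> K" using comp(1) u by blast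
      then show "card (K - M) < card K" using finK psubset_card_mono by blast
      have "{v \<in> ?V. f1 v \<in> {\<alpha>, \<beta>}} = ?W" unfolding pair ..
      moreover have "closed_in adj ?W (K - M)"
        unfolding closed_in_def
      proof (intro conjI ballI impI)
        show "K - M \<subseteq> ?W" using KW by blast
        fix x y assume xy: "x \<in> K - M" "y \<in> ?W" "adj x y"
        have "y \<in> K" using Kcl xy by blast
        moreover have "y \<notin> M"
        proof
          assume "y \<in> M"
          then have "x \<in> M" using Mcl[OF _ _ adj_sym[OF xy(3)]] xy(1) KW by blast
          then show False using xy by blast
        qed
        ultimately show "y \<in> K - M" by blast
      qed
      ultimately show "closed_in adj {v \<in> ?V. f1 v \<in> {\<alpha>, \<beta>}} (K - M)" by simp
      show "g v = (if v \<in> K - M then Transposition.transpose \<alpha> \<beta> (f1 v) else f1 v)" if "v \<in> ?V" for v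
        using less.prems(4)[OF that] MK unfolding f1_def by auto
    qed (use p1 less.prems in auto)
    then show ?thesis using step unfolding list_equivalent_def \<phi>_def
      by (meson converse_rtranclp_into_rtranclp)
  qed
qed

lemma kempe_eq_list_equivalent:
  assumes "kempe_eq adj (verts G) L f g"
  shows "list_equivalent G L (restrict f (verts G)) (restrict g (verts G))"
  using assms unfolding kempe_eq_def
proof (induction rule: rtranclp_induct)
  case base then show ?case unfolding list_equivalent_def by simp
next
  case (step y z)
  from step(2) have "list_equivalent G L (restrict y (verts G)) (restrict z (verts G))"
    by (elim kempe_stepE) (rule list_equivalent_swap)
  then show ?case using step.IH unfolding list_equivalent_def by (meson rtranclp_trans)
qed

lemma list_swappableI:
  assumes ex: "\<exists>f. proper_on adj (verts G) L f"
    and eq: "\<And>f g. proper_on adj (verts G) L f \<Longrightarrow> proper_on adj (verts G) L g \<Longrightarrow> kempe_eq adj (verts G) L f g"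
  shows "list_swappable G L"
  unfolding list_swappable_def
proof (intro conjI ballI)
  show "list_colorings G L \<noteq> {}" using ex proper_list_colorings by blast
  fix \<phi> \<psi> assume p: "\<phi> \<in> list_colorings G L" "\<psi> \<in> list_colorings G L"
  have "list_equivalent G L (restrict \<phi> (verts G)) (restrict \<psi> (verts G))"
    using kempe_eq_list_equivalent[OF eq[OF list_colorings_proper[OF p(1)] list_colorings_proper[OF p(2)]]] .
  moreover have "restrict \<phi> (verts G) = \<phi>" "restrict \<psi> (verts G) = \<psi>"
    using p PiE_restrict unfolding list_colorings_def by blast+
  ultimately show "list_equivalent G L \<phi> \<psi>" by simp
qed

section \<open>The two halves of the theorem\<close>

lemma conn4reg_adj:
  assumes conn: "vertex_connected 4 G" and reg: "regular_graph k G"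
  shows "conn4reg (verts G) adj k"
proof
  show "finite (verts G)" by simp
  show "adj v u" if "adj u v" for u v using adj_sym[OF that] .
  show "\<not> adj v v" for v by (rule adj_irr)
  show "u \<in> verts G" if "adj u v" for u v using adj_in_verts(1)[OF that] .
  show "card (nb adj (verts G) v) = k" if "v \<in> verts G" for v
    using nb_out_degree reg that unfolding regular_graph_def by simp
  show "D = verts G - S"
    if "S \<subseteq> verts G" "card S < 4" "D \<noteq> {}" "closed_in adj (verts G - S) D" for S D
    using closed_in_connected[OF _ _ that(4,3)] conn that unfolding vertex_connected_def by blast
  show "4 < card (verts G)" using conn unfolding vertex_connected_def by blast
qed

lemma list_swappable_nonconstant:
  assumes "vertex_connected 4 G" "regular_graph k G" "list_assignment G k L"
    and uw: "u \<in> verts G" "w \<in> verts G" "L u \<noteq> L w"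
  shows "list_swappable G L"
proof -
  interpret c: conn4reg "verts G" adj k by (rule conn4reg_adj[OF assms(1,2)])
  interpret c: conn4lists "verts G" adj k L
    by unfold_locales (use assms(3) in \<open>auto simp: list_assignment_def\<close>)
  have c.swap_conn by (rule c.swap_conn_nonconstant[OF uw])
  then show ?thesis unfolding c.swap_conn_def by (intro list_swappableI) blast+
qed

lemma list_swappable_constant:
  assumes "vertex_connected 4 G" "regular_graph k G" "\<not> complete_digraph (k + 1) G"
    "list_assignment G k L" and const: "\<And>u w. u \<in> verts G \<Longrightarrow> w \<in> verts G \<Longrightarrow> L u = L w"
  shows "list_swappable G L"
proof -
  interpret c: conn4reg "verts G" adj k by (rule conn4reg_adj[OF assms(1,2)])
  have "verts G \<noteq> {}" using c.big by auto
  then obtain v0 where v0: "v0 \<in> verts G" by blast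
  define C where "C = L v0"
  have L: "L v = C" if "v \<in> verts G" for v using const[OF that v0] unfolding C_def .
  \<comment> \<open>Without a nonadjacent pair the graph would be complete, on \<open>k + 1\<close>
    vertices by regularity.\<close>
  have nc: "\<exists>u \<in> verts G. \<exists>v \<in> verts G. u \<noteq> v \<and> \<not> adj u v"
  proof (rule ccontr)
    assume neg: "\<not> ?thesis"
    have all: "adj u v" if "u \<in> verts G" "v \<in> verts G" "u \<noteq> v" for u v using neg that by blast
    have "nb adj (verts G) v0 = verts G - {v0}" using all[OF v0] adj_irr[of v0] unfolding nb_def by auto
    then have "card (verts G) = k + 1" using c.reg[OF v0] c.k_ge_4 v0 by auto
    moreover have "arcs_ends G = {(u, v). (u, v) \<in> verts G \<times> verts G \<and> u \<noteq> v}"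
    proof (intro set_eqI iffI)
      fix p assume p: "p \<in> arcs_ends G"
      obtain u v where uv: "p = (u, v)" by (cases p)
      have "adj u v" using p uv by simp
      moreover from this have "u \<noteq> v" using adj_irr by blast
      ultimately show "p \<in> {(u, v). (u, v) \<in> verts G \<times> verts G \<and> u \<noteq> v}"
        using adj_in_verts uv by auto
    next
      fix p assume "p \<in> {(u, v). (u, v) \<in> verts G \<times> verts G \<and> u \<noteq> v}"
      then show "p \<in> arcs_ends G" using all by auto
    qed
    ultimately have "complete_digraph (k + 1) G" unfolding complete_digraph_def using graph_axioms by auto
    then show False using assms(3) by blast
  qed
  interpret c: conn4const "verts G" adj k C
    by unfold_locales (use assms(4) v0 nc in \<open>auto simp: list_assignment_def C_def\<close>)
  have c.swap_conn by (rule c.swap_conn_constant)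
  then show ?thesis
    unfolding c.swap_conn_def
    using kempe_eq_lists_cong[of "verts G" L "\<lambda>_. C" adj] L by (intro list_swappableI) auto
qed

end

theorem theorem4:
  fixes G :: "('a, 'b) pre_digraph" and k :: nat
  assumes "graph G" and "vertex_connected 4 G"
  shows "(regular_graph k G \<and> \<not> complete_digraph (k + 1) G \<longrightarrow> swappable TYPE('c) G k) \<and>
         (complete_digraph (k + 1) G \<longrightarrow>
           (\<forall>L :: 'a \<Rightarrow> 'c set. list_assignment G k L \<and> (\<exists>u \<in> verts G. \<exists>w \<in> verts G. L u \<noteq> L w)
              \<longrightarrow> list_swappable G L))"
proof -
  interpret graph G by (rule assms(1))
  have "list_swappable G L"
    if "regular_graph k G" "\<not> complete_digraph (k + 1) G" "list_assignment G k L" for L :: "'a \<Rightarrow> 'c set"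
    using list_swappable_nonconstant[OF assms(2) that(1,3)] list_swappable_constant[OF assms(2) that] by blast
  \<comment> \<open>The complete graph on \<open>k + 1\<close> vertices is \<open>k\<close>-regular,
    so the second half is an instance of the case of different lists.\<close>
  moreover have "regular_graph k G" if "complete_digraph (k + 1) G"
    unfolding regular_graph_def
  proof
    fix v assume v: "v \<in> verts G"
    have "nb adj (verts G) v = verts G - {v}"
      using that v unfolding complete_digraph_def nb_def by auto
    then show "out_degree G v = k"
      using nb_out_degree[of v] that v unfolding complete_digraph_def by simp
  qed
  ultimately show ?thesis
    unfolding swappable_def using list_swappable_nonconstant[OF assms(2)] by blast
qed

end
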